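(* Let $\mathbb M^1,\mathbb M^2,\mathbb M^3\subset\mathbb C^{1+8}$ be the three real analytic CR-generic submanifolds, in coordinates $(z,w^1,\dots,w^8)$, given by the six shared equations $$w^1-\overline w^1=2i\,z\overline z,\quad w^2-\overline w^2=2i(z^2\overline z+z\overline z^2),\quad w^3-\overline w^3=2(z^2\overline z-z\overline z^2),$$ $$w^4-\overline w^4=2i(z^3\overline z+z\overline z^3),\quad w^5-\overline w^5=2(z^3\overline z-z\overline z^3),\quad w^6-\overline w^6=2i\,z^2\overline z^2,$$ together with: for $\mathbb M^1$: $w^7-\overline w^7=2i(z^4\overline z+z\overline z^4)$, $w^8-\overline w^8=2(z^4\overline z-z\overline z^4)$; for $\mathbb M^2$: $w^7-\overline w^7=2i(z^3\overline z^2+z^2\overline z^3)$, $w^8-\overline w^8=2(z^3\overline z^2-z^2\overline z^3)$; for $\mathbb M^3$: $w^7-\overline w^7=2i(z^3\overline z^2+z^2\overline z^3)$, $w^8-\overline w^8=2i(z^4\overline z+z\overline z^4)$. Then the Lie algebras of infinitesimal CR-automorphisms $\mathfrak{aut}_{CR}(\mathbb M^1)$, $\mathfrak{aut}_{CR}(\mathbb M^2)$ and $\mathfrak{aut}_{CR}(\mathbb M^3)$ are of (real) dimensions $12$, $12$ and $11$, respectively, and are generated by the $\mathbb R$-linearly independent real parts of the following collections of holomorphic vector fields. For $\mathbb M^1$: $\mathsf X_i=\partial_{w^i}$ for $i=1,\dots,8$, and $$\mathsf X_9=z\partial_z+2w^1\partial_{w^1}+3w^2\partial_{w^2}+3w^3\partial_{w^3}+4w^4\partial_{w^4}+4w^5\partial_{w^5}+4w^6\partial_{w^6}+5w^7\partial_{w^7}+5w^8\partial_{w^8},$$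 $$\mathsf X_{10}=iz\partial_z-w^3\partial_{w^2}+w^2\partial_{w^3}-2w^5\partial_{w^4}+2w^4\partial_{w^5}-3w^8\partial_{w^7}+3w^7\partial_{w^8},$$ $$\mathsf X_{11}=\partial_z+2iz\partial_{w^1}+(4w^1+2iz^2)\partial_{w^2}+2z^2\partial_{w^3}+(3w^2+2iz^3)\partial_{w^4}+(3w^3+2z^3)\partial_{w^5}+2w^2\partial_{w^6}+(4w^4+2iz^4)\partial_{w^7}+(4w^5+2z^4)\partial_{w^8},$$ $$\mathsf X_{12}=i\partial_z+2z\partial_{w^1}+2z^2\partial_{w^2}+(4w^1-2iz^2)\partial_{w^3}+(-3w^3+2z^3)\partial_{w^4}+(3w^2-2iz^3)\partial_{w^5}+2w^3\partial_{w^6}+(-4w^5+2z^4)\partial_{w^7}+(4w^4-2iz^4)\partial_{w^8}.$$ For $\mathbb M^2$: $\mathsf X_i=\partial_{w^i}$ for $i=1,\dots,8$, and $$\mathsf X_9=z\partial_z+2w^1\partial_{w^1}+3w^2\partial_{w^2}+3w^3\partial_{w^3}+4w^4\partial_{w^4}+4w^5\partial_{w^5}+4w^6\partial_{w^6}+5w^7\partial_{w^7}+5w^8\partial_{w^8},$$ $$\mathsf X_{10}=iz\partial_z-w^3\partial_{w^2}+w^2\partial_{w^3}-2w^5\partial_{w^4}+2w^4\partial_{w^5}-w^8\partial_{w^7}+w^7\partial_{w^8},$$ $$\mathsf X_{11}=\partial_z+2iz\partial_{w^1}+(4w^1+2iz^2)\partial_{w^2}+2z^2\partial_{w^3}+(3w^2+2iz^3)\partial_{w^4}+(3w^3+2z^3)\partial_{w^5}+2w^2\partial_{w^6}+(2w^4+6w^6)\partial_{w^7}+2w^5\partial_{w^8},$$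 $$\mathsf X_{12}=i\partial_z+2z\partial_{w^1}+2z^2\partial_{w^2}+(4w^1-2iz^2)\partial_{w^3}+(-3w^3+2z^3)\partial_{w^4}+(3w^2-2iz^3)\partial_{w^5}+2w^3\partial_{w^6}+2w^5\partial_{w^7}+(-2w^4+6w^6)\partial_{w^8}.$$ For $\mathbb M^3$: $\mathsf X_i=\partial_{w^i}$ for $i=1,\dots,8$, and $$\mathsf X_9=z\partial_z+2w^1\partial_{w^1}+3w^2\partial_{w^2}+3w^3\partial_{w^3}+4w^4\partial_{w^4}+4w^5\partial_{w^5}+4w^6\partial_{w^6}+5w^7\partial_{w^7}+5w^8\partial_{w^8},$$ $$\mathsf X_{10}=\partial_z+2iz\partial_{w^1}+(4w^1+2iz^2)\partial_{w^2}+2z^2\partial_{w^3}+(3w^2+2iz^3)\partial_{w^4}+(3w^3+2z^3)\partial_{w^5}+2w^2\partial_{w^6}+(2w^4+6w^6)\partial_{w^7}+(4w^4+2iz^4)\partial_{w^8},$$ $$\mathsf X_{11}=i\partial_z+2z\partial_{w^1}+2z^2\partial_{w^2}+(4w^1-2iz^2)\partial_{w^3}+(-3w^3+2z^3)\partial_{w^4}+(3w^2-2iz^3)\partial_{w^5}+2w^3\partial_{w^6}+2w^5\partial_{w^7}+(-4w^5+2z^4)\partial_{w^8}.$$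
   Context: For a real analytic CR-generic submanifold $M\subset\mathbb C^{n+k}$ through the origin, with coordinates $(z,w)$, an infinitesimal CR-automorphism of $M$ is a $(1,0)$ vector field $\mathsf X=\sum_i Z^i(z,w)\,\partial_{z_i}+\sum_l W^l(z,w)\,\partial_{w_l}$ with coefficients holomorphic near the origin such that the real vector field $\mathsf X+\overline{\mathsf X}$ is tangent to $M$, i.e. $(\mathsf X+\overline{\mathsf X})|_M$ applied to the defining equations of $M$ vanishes identically on $M$. The set of these is the real Lie algebra $\mathfrak{aut}_{CR}(M)$ (with $\mathsf X$ identified with twice its real part $\mathsf X+\overline{\mathsf X}$). Here superscripts on $w$ are indices, while powers of $z,\overline z$ are exponents. *)

theory Defs
  imports "HOL-Analysis.Analysis"
begin

text \<open>A vector field \<open>\<Sum>i. X\<^sub>i \<partial>\<^sub>i\<close> of type \<open>(1,0)\<close> on \<open>\<complex>\<^sup>m\<close> is represented by its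
  coefficient vector, a map from \<open>complex^'m\<close> to itself.  Since
  \<open>a \<partial>/\<partial>z + cnj a \<partial>/\<partial>(cnj z) = Re a \<partial>/\<partial>x + Im a \<partial>/\<partial>y\<close>, the same map, read through
  \<open>\<complex>\<^sup>m = \<real>\<^sup>2\<^sup>m\<close>, is the coefficient vector of the real vector field \<open>X + cnj X\<close>, so identifying
  \<open>X\<close> with twice its real part needs no conversion, and real-linear notions
  (\<open>dim\<close>, \<open>span\<close>, \<open>independent\<close>) apply directly.\<close>

type_synonym 'm vfield = "complex^'m \<Rightarrow> complex^'m"


subsection \<open>Wirtinger derivatives and the action of vector fields\<close>

definition wirtinger :: "'m::finite \<Rightarrow> (complex^'m \<Rightarrow> complex) \<Rightarrow> complex^'m \<Rightarrow> complex" where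
  "wirtinger i f p =
     (frechet_derivative f (at p) (axis i 1) - \<i> * frechet_derivative f (at p) (axis i \<i>)) / 2"

definition wirtinger_bar :: "'m::finite \<Rightarrow> (complex^'m \<Rightarrow> complex) \<Rightarrow> complex^'m \<Rightarrow> complex" where
  "wirtinger_bar i f p =
     (frechet_derivative f (at p) (axis i 1) + \<i> * frechet_derivative f (at p) (axis i \<i>)) / 2"

definition apply_vf :: "'m::finite vfield \<Rightarrow> (complex^'m \<Rightarrow> complex) \<Rightarrow> complex^'m \<Rightarrow> complex" where
  "apply_vf X f p = (\<Sum>i\<in>UNIV. X p $ i * wirtinger i f p)"

definition apply_vf_bar :: "'m::finite vfield \<Rightarrow> (complex^'m \<Rightarrow> complex) \<Rightarrow> complex^'m \<Rightarrow> complex" where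
  "apply_vf_bar X f p = (\<Sum>i\<in>UNIV. cnj (X p $ i) * wirtinger_bar i f p)"


subsection \<open>Germs of vector fields at the origin\<close>

text \<open>The fields are only required to exist near the origin; two of them count as equal when they
  agree on some neighbourhood of it.\<close>

quotient_type (overloaded) 'm vf_germ = "'m::finite vfield" /
  "\<lambda>X Y. \<forall>\<^sub>F p in nhds 0. X p = Y p"
proof (rule equivpI)
  show "reflp (\<lambda>X Y :: 'm vfield. \<forall>\<^sub>F p in nhds 0. X p = Y p)"
    by (simp add: reflp_def)
  show "symp (\<lambda>X Y :: 'm vfield. \<forall>\<^sub>F p in nhds 0. X p = Y p)"
    by (simp add: symp_def eq_commute)
  show "transp (\<lambda>X Y :: 'm vfield. \<forall>\<^sub>F p in nhds 0. X p = Y p)"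
    unfolding transp_def by (auto elim: eventually_elim2)
qed

lift_definition germ :: "'m::finite vfield \<Rightarrow> 'm vf_germ" is "\<lambda>X. X" .

instantiation vf_germ :: (finite) real_vector
begin

lift_definition zero_vf_germ :: "'a vf_germ" is "\<lambda>_. 0" .

lift_definition plus_vf_germ :: "'a vf_germ \<Rightarrow> 'a vf_germ \<Rightarrow> 'a vf_germ"
  is "\<lambda>X Y p. X p + Y p" by (auto elim: eventually_elim2)

lift_definition minus_vf_germ :: "'a vf_germ \<Rightarrow> 'a vf_germ \<Rightarrow> 'a vf_germ"
  is "\<lambda>X Y p. X p - Y p" by (auto elim: eventually_elim2)

lift_definition uminus_vf_germ :: "'a vf_germ \<Rightarrow> 'a vf_germ"
  is "\<lambda>X p. - X p" by (auto elim: eventually_mono)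

lift_definition scaleR_vf_germ :: "real \<Rightarrow> 'a vf_germ \<Rightarrow> 'a vf_germ"
  is "\<lambda>r X p. r *\<^sub>R X p" by (auto elim: eventually_mono)

instance
  by (standard; transfer; simp add: algebra_simps)

end


subsection \<open>Infinitesimal CR-automorphisms\<close>

text \<open>A submanifold through the origin is given by a set \<open>R\<close> of complex-valued defining functions,
  one for each equation, with all terms moved to the left-hand side.\<close>

definition zero_locus :: "(complex^'m \<Rightarrow> complex) set \<Rightarrow> (complex^'m) set" where
  "zero_locus R = {p. \<forall>r\<in>R. r p = 0}"

definition holomorphic_near_origin :: "(complex^'m::finite \<Rightarrow> complex) \<Rightarrow> bool" where
  "holomorphic_near_origin f \<longleftrightarrow>
     (\<forall>\<^sub>F p in nhds 0. \<exists>c :: complex^'m. (f has_derivative (\<lambda>v. \<Sum>j\<in>UNIV. c $ j * v $ j)) (at p))"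

definition tangent_to :: "'m::finite vfield \<Rightarrow> (complex^'m \<Rightarrow> complex) set \<Rightarrow> bool" where
  "tangent_to X R \<longleftrightarrow>
     (\<forall>\<^sub>F p in nhds 0. p \<in> zero_locus R \<longrightarrow> (\<forall>r\<in>R. apply_vf X r p + apply_vf_bar X r p = 0))"

definition aut_CR :: "(complex^'m::finite \<Rightarrow> complex) set \<Rightarrow> 'm vf_germ set" where
  "aut_CR R = germ ` {X. (\<forall>i. holomorphic_near_origin (\<lambda>p. X p $ i)) \<and> tangent_to X R}"


subsection \<open>The three submanifolds of \<open>\<complex>\<^sup>1\<^sup>+\<^sup>8\<close>\<close>

text \<open>In \<open>complex^9\<close> the component with index \<open>0\<close> is \<open>z\<close> and the one with index \<open>l\<close>,
  \<open>1 \<le> l \<le> 8\<close>, is \<open>w\<^sup>l\<close>.  (In the index type the numeral \<open>9\<close> equals \<open>0\<close>.)\<close>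

definition eqn :: "9 \<Rightarrow> (complex \<Rightarrow> complex \<Rightarrow> complex) \<Rightarrow> complex^9 \<Rightarrow> complex" where
  "eqn l \<phi> = (\<lambda>p. (p $ l - cnj (p $ l)) - \<phi> (p $ 0) (cnj (p $ 0)))"

definition shared_eqns :: "(complex^9 \<Rightarrow> complex) set" where
  "shared_eqns =
    {eqn 1 (\<lambda>z zb. 2*\<i> * (z * zb)),
     eqn 2 (\<lambda>z zb. 2*\<i> * (z^2 * zb + z * zb^2)),
     eqn 3 (\<lambda>z zb. 2 * (z^2 * zb - z * zb^2)),
     eqn 4 (\<lambda>z zb. 2*\<i> * (z^3 * zb + z * zb^3)),
     eqn 5 (\<lambda>z zb. 2 * (z^3 * zb - z * zb^3)),
     eqn 6 (\<lambda>z zb. 2*\<i> * (z^2 * zb^2))}"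

definition M1_eqns :: "(complex^9 \<Rightarrow> complex) set" where
  "M1_eqns = shared_eqns \<union>
    {eqn 7 (\<lambda>z zb. 2*\<i> * (z^4 * zb + z * zb^4)),
     eqn 8 (\<lambda>z zb. 2 * (z^4 * zb - z * zb^4))}"

definition M2_eqns :: "(complex^9 \<Rightarrow> complex) set" where
  "M2_eqns = shared_eqns \<union>
    {eqn 7 (\<lambda>z zb. 2*\<i> * (z^3 * zb^2 + z^2 * zb^3)),
     eqn 8 (\<lambda>z zb. 2 * (z^3 * zb^2 - z^2 * zb^3))}"

definition M3_eqns :: "(complex^9 \<Rightarrow> complex) set" where
  "M3_eqns = shared_eqns \<union>
    {eqn 7 (\<lambda>z zb. 2*\<i> * (z^3 * zb^2 + z^2 * zb^3)),
     eqn 8 (\<lambda>z zb. 2*\<i> * (z^4 * zb + z * zb^4))}"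


subsection \<open>The vector fields\<close>

definition dz :: "complex^9" where "dz = axis 0 1"

definition dw :: "9 \<Rightarrow> complex^9" where "dw l = axis l 1"

definition vf :: "(complex \<Rightarrow> (9 \<Rightarrow> complex) \<Rightarrow> complex^9) \<Rightarrow> 9 vfield" where
  "vf F = (\<lambda>p. F (p $ 0) (\<lambda>l. p $ l))"

text \<open>\<open>\<partial>\<^sub>w\<^sub>l\<close> for \<open>1 \<le> l \<le> 8\<close> and the weighted Euler field occur in all three lists.\<close>

definition common_fields :: "9 vfield set" where
  "common_fields =
    {vf (\<lambda>z w. dw 1), vf (\<lambda>z w. dw 2), vf (\<lambda>z w. dw 3), vf (\<lambda>z w. dw 4),
     vf (\<lambda>z w. dw 5), vf (\<lambda>z w. dw 6), vf (\<lambda>z w. dw 7), vf (\<lambda>z w. dw 8),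
     vf (\<lambda>z w. z *s dz + (2 * w 1) *s dw 1 + (3 * w 2) *s dw 2 + (3 * w 3) *s dw 3
       + (4 * w 4) *s dw 4 + (4 * w 5) *s dw 5 + (4 * w 6) *s dw 6
       + (5 * w 7) *s dw 7 + (5 * w 8) *s dw 8)}"

definition fields1 :: "9 vfield set" where
  "fields1 = common_fields \<union>
    {vf (\<lambda>z w. (\<i> * z) *s dz + (- w 3) *s dw 2 + (w 2) *s dw 3
       + (- 2 * w 5) *s dw 4 + (2 * w 4) *s dw 5
       + (- 3 * w 8) *s dw 7 + (3 * w 7) *s dw 8),
     vf (\<lambda>z w. dz + (2*\<i> * z) *s dw 1
       + (4 * w 1 + 2*\<i> * z^2) *s dw 2 + (2 * z^2) *s dw 3
       + (3 * w 2 + 2*\<i> * z^3) *s dw 4 + (3 * w 3 + 2 * z^3) *s dw 5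
       + (2 * w 2) *s dw 6
       + (4 * w 4 + 2*\<i> * z^4) *s dw 7 + (4 * w 5 + 2 * z^4) *s dw 8),
     vf (\<lambda>z w. \<i> *s dz + (2 * z) *s dw 1
       + (2 * z^2) *s dw 2 + (4 * w 1 - 2*\<i> * z^2) *s dw 3
       + (- 3 * w 3 + 2 * z^3) *s dw 4 + (3 * w 2 - 2*\<i> * z^3) *s dw 5
       + (2 * w 3) *s dw 6
       + (- 4 * w 5 + 2 * z^4) *s dw 7 + (4 * w 4 - 2*\<i> * z^4) *s dw 8)}"

definition fields2 :: "9 vfield set" where
  "fields2 = common_fields \<union>
    {vf (\<lambda>z w. (\<i> * z) *s dz + (- w 3) *s dw 2 + (w 2) *s dw 3
       + (- 2 * w 5) *s dw 4 + (2 * w 4) *s dw 5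
       + (- w 8) *s dw 7 + (w 7) *s dw 8),
     vf (\<lambda>z w. dz + (2*\<i> * z) *s dw 1
       + (4 * w 1 + 2*\<i> * z^2) *s dw 2 + (2 * z^2) *s dw 3
       + (3 * w 2 + 2*\<i> * z^3) *s dw 4 + (3 * w 3 + 2 * z^3) *s dw 5
       + (2 * w 2) *s dw 6
       + (2 * w 4 + 6 * w 6) *s dw 7 + (2 * w 5) *s dw 8),
     vf (\<lambda>z w. \<i> *s dz + (2 * z) *s dw 1
       + (2 * z^2) *s dw 2 + (4 * w 1 - 2*\<i> * z^2) *s dw 3
       + (- 3 * w 3 + 2 * z^3) *s dw 4 + (3 * w 2 - 2*\<i> * z^3) *s dw 5
       + (2 * w 3) *s dw 6
       + (2 * w 5) *s dw 7 + (- 2 * w 4 + 6 * w 6) *s dw 8)}"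

definition fields3 :: "9 vfield set" where
  "fields3 = common_fields \<union>
    {vf (\<lambda>z w. dz + (2*\<i> * z) *s dw 1
       + (4 * w 1 + 2*\<i> * z^2) *s dw 2 + (2 * z^2) *s dw 3
       + (3 * w 2 + 2*\<i> * z^3) *s dw 4 + (3 * w 3 + 2 * z^3) *s dw 5
       + (2 * w 2) *s dw 6
       + (2 * w 4 + 6 * w 6) *s dw 7 + (4 * w 4 + 2*\<i> * z^4) *s dw 8),
     vf (\<lambda>z w. \<i> *s dz + (2 * z) *s dw 1
       + (2 * z^2) *s dw 2 + (4 * w 1 - 2*\<i> * z^2) *s dw 3
       + (- 3 * w 3 + 2 * z^3) *s dw 4 + (3 * w 2 - 2*\<i> * z^3) *s dw 5
       + (2 * w 3) *s dw 6
       + (2 * w 5) *s dw 7 + (- 4 * w 5 + 2 * z^4) *s dw 8)}"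

end

theory Submission
  imports Defs "HOL-Complex_Analysis.Conformal_Mappings"
begin

text \<open>All three submanifolds have the form \<open>w\<^sub>l - cnj w\<^sub>l = \<phi>\<^sub>l(z, cnj z)\<close>, \<open>1 \<le> l \<le> 8\<close>, where \<open>\<phi>\<^sub>l\<close> is a
polynomial of degree at most five divisible by \<open>z * cnj z\<close>, and they share \<open>\<phi>\<^sub>1, \<dots>, \<phi>\<^sub>6\<close>.  Write
\<open>Z\<close> and \<open>W\<^sub>l\<close> for the coefficients of a vector field.  It is an infinitesimal automorphism iff
\<open>W\<^sub>l - cnj W\<^sub>l = (\<partial>\<phi>\<^sub>l/\<partial>z) Z + (\<partial>\<phi>\<^sub>l/\<partial>cnj z) cnj Z\<close> on the submanifold.

The conjugate coordinates can be treated as independent of the coordinates themselves: the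
equation persists when \<open>cnj z\<close> is replaced by a free complex variable \<open>s\<close> and \<open>cnj w\<^sub>l\<close> by
\<open>w\<^sub>l - \<phi>\<^sub>l(z, s)\<close> (\<open>polarized_tangency\<close>).  Now expand in powers of \<open>s\<close>.  Order zero gives
\<open>W\<^sub>l(z, w) = A\<^sub>l(w) + k\<^sub>l(z) B(w)\<close>, where \<open>A\<^sub>l\<close> is real at real points, \<open>k\<^sub>l\<close> is an explicit
polynomial and \<open>B\<close> is the conjugate of \<open>C(w) = Z(0, w)\<close>.  Orders one and two
(\<open>jet_equations\<close>), sorted by powers of \<open>z\<close>, become linear differential equations
with constant coefficients for \<open>A\<^sub>l\<close>, \<open>B\<close>, \<open>C\<close> and the first \<open>z\<close>-derivative of \<open>Z\<close> at \<open>z = 0\<close>.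
The derivatives in them are taken along constant vectors built from the coefficients of the
\<open>\<phi>\<^sub>l\<close>; conjugating an equation conjugates the vector.

This system is overdetermined.  For instance \<open>A\<^sub>4 - \<i> A\<^sub>5\<close> has vanishing derivative along
four of these vectors, whereas one of its derivatives along a conjugate vector is a multiple of
\<open>B\<close>; derivatives along constant vectors commute, so \<open>B\<close> is annihilated by the four vectors too.
Repeating such steps shows that \<open>B\<close>, \<open>C\<close> and the \<open>z\<close>-derivative of \<open>Z\<close> along \<open>z = 0\<close> are
constant (\<open>C_Ks_constant\<close>).  If these constants are zero, the \<open>A\<^sub>l\<close> are constant as well, so an
automorphism is determined by \<open>Z(0)\<close>, \<open>(\<partial>Z/\<partial>z)(0)\<close> and the eight real numbers \<open>W\<^sub>l(0)\<close>
(\<open>vanishes_if_data_vanish\<close>).  That leaves at most twelve real parameters.  On the third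
submanifold the equation for \<open>w\<^sub>8\<close> forces \<open>(\<partial>Z/\<partial>z)(0)\<close> to be real
(\<open>Ks_eq_K_if_no_rotation\<close>): there is no rotation field, and eleven parameters remain.

Conversely the listed fields are tangent, by substitution, and reading off these parameters maps
them precisely onto the standard basis.  Independence, spanning and the dimension then follow
together (\<open>basis_of_coordinates\<close>).\<close>

section \<open>Holomorphic functions of several complex variables\<close>

text \<open>Only complex differentiability at each point is demanded.  Continuity of the derivative and
existence of higher derivatives are consequences, proved below from Cauchy's integral formula.\<close>

definition holo_on :: "(complex^'n::finite \<Rightarrow> complex) \<Rightarrow> (complex^'n) set \<Rightarrow> bool" where
  "holo_on f S \<longleftrightarrow> (\<forall>p\<in>S. \<exists>f'. (f has_derivative f') (at p) \<and> (\<forall>c v. f' (c *s v) = c * f' v))"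

definition dderiv :: "complex^'n::finite \<Rightarrow> (complex^'n \<Rightarrow> complex) \<Rightarrow> complex^'n \<Rightarrow> complex" where
  "dderiv v f p = frechet_derivative f (at p) v"

lemma norm_smult_complex: "norm (c *s v) = norm c * norm (v :: complex^'n::finite)"
  by (simp add: norm_vec_def L2_set_right_distrib norm_mult)

lemma scaleR_eq_smult: "r *\<^sub>R v = complex_of_real r *s (v :: complex^'n)"
  unfolding vec_eq_iff vector_scaleR_component vector_smult_component
  by (rule allI) (rule scaleR_conv_of_real)

lemma has_derivative_imp_dderiv: "(f has_derivative f') (at p) \<Longrightarrow> dderiv v f p = f' v"
  unfolding dderiv_def by (metis frechet_derivative_at)

lemma holo_on_has_derivative:
  assumes "holo_on f S" "p \<in> S"
  shows "(f has_derivative (\<lambda>v. dderiv v f p)) (at p)"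
  using assms unfolding holo_on_def dderiv_def by (metis frechet_derivative_at)

lemma dderiv_smult:
  assumes "holo_on f S" "p \<in> S"
  shows "dderiv (c *s v) f p = c * dderiv v f p"
  using assms unfolding holo_on_def by (metis has_derivative_imp_dderiv)

lemma dderiv_dir_add:
  assumes "holo_on f S" "p \<in> S"
  shows "dderiv (u + v) f p = dderiv u f p + dderiv v f p"
  by (rule linear_add[OF bounded_linear.linear[OF has_derivative_bounded_linear[OF holo_on_has_derivative[OF assms]]]])

lemma dderiv_dir_diff:
  assumes "holo_on f S" "p \<in> S"
  shows "dderiv (u - v) f p = dderiv u f p - dderiv v f p"
  by (rule linear_diff[OF bounded_linear.linear[OF has_derivative_bounded_linear[OF holo_on_has_derivative[OF assms]]]])

lemma dderiv_dir_sum: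
  assumes "holo_on f S" "p \<in> S"
  shows "dderiv (\<Sum>i\<in>I. u i) f p = (\<Sum>i\<in>I. dderiv (u i) f p)"
  by (rule linear_sum[OF bounded_linear.linear[OF has_derivative_bounded_linear[OF holo_on_has_derivative[OF assms]]]])

lemma holo_on_continuous_on: "holo_on f S \<Longrightarrow> continuous_on S f"
  by (meson holo_on_has_derivative continuous_at_imp_continuous_on has_derivative_continuous)

lemma holo_on_subset: "holo_on f S \<Longrightarrow> T \<subseteq> S \<Longrightarrow> holo_on f T"
  unfolding holo_on_def by blast

lemma holo_on_const: "holo_on (\<lambda>_. c) S"
  unfolding holo_on_def by (intro ballI exI[of _ "\<lambda>_. 0"]) simp

lemma holo_onI:
  assumes "\<And>p. p \<in> S \<Longrightarrow> (f has_derivative f' p) (at p)"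
    and "\<And>p c v. p \<in> S \<Longrightarrow> f' p (c *s v) = c * f' p v"
  shows "holo_on f S"
  using assms unfolding holo_on_def by blast

lemma holo_on_add:
  assumes "holo_on f S" "holo_on g S"
  shows "holo_on (\<lambda>p. f p + g p) S"
  by (rule holo_onI[OF has_derivative_add[OF assms[THEN holo_on_has_derivative]]])
    (simp_all add: dderiv_smult[OF assms(1)] dderiv_smult[OF assms(2)] distrib_left)

lemma holo_on_cmult:
  assumes "holo_on f S"
  shows "holo_on (\<lambda>p. c * f p) S"
  by (rule holo_onI[OF has_derivative_mult_right[OF holo_on_has_derivative[OF assms]]])
    (simp_all add: dderiv_smult[OF assms])

lemma holo_on_diff: "holo_on f S \<Longrightarrow> holo_on g S \<Longrightarrow> holo_on (\<lambda>p. f p - g p) S"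
  using holo_on_add[of f S "\<lambda>p. (-1) * g p"] holo_on_cmult[of g S "-1"] by simp

lemma dderiv_const: "dderiv v (\<lambda>_. c) p = 0"
  by (rule has_derivative_imp_dderiv) simp

lemma dderiv_add:
  assumes "holo_on f S" "holo_on g S" "p \<in> S"
  shows "dderiv v (\<lambda>p. f p + g p) p = dderiv v f p + dderiv v g p"
  using assms by (intro has_derivative_imp_dderiv has_derivative_add holo_on_has_derivative)

lemma dderiv_diff:
  assumes "holo_on f S" "holo_on g S" "p \<in> S"
  shows "dderiv v (\<lambda>p. f p - g p) p = dderiv v f p - dderiv v g p"
  using assms by (intro has_derivative_imp_dderiv has_derivative_diff holo_on_has_derivative)

lemma dderiv_cmult:
  assumes "holo_on f S" "p \<in> S"
  shows "dderiv v (\<lambda>p. c * f p) p = c * dderiv v f p"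
  using assms by (intro has_derivative_imp_dderiv has_derivative_mult_right holo_on_has_derivative)

lemma dderiv_cong:
  assumes "open S" "\<And>p. p \<in> S \<Longrightarrow> f p = g p" "p \<in> S"
  shows "dderiv v f p = dderiv v g p"
proof -
  have "(f has_derivative f') (at p) \<longleftrightarrow> (g has_derivative f') (at p)" for f'
    using assms has_derivative_transform_within_open[of f f' p UNIV S g] 
      has_derivative_transform_within_open[of g f' p UNIV S f] by auto
  then show ?thesis unfolding dderiv_def frechet_derivative_def by simp
qed

lemma holo_on_chain:
  assumes f: "holo_on f S" "\<gamma> s \<in> S"
    and \<gamma>: "\<And>i. ((\<lambda>s. \<gamma> s $ i) has_field_derivative d $ i) (at s)"
  shows "((\<lambda>s. f (\<gamma> s)) has_field_derivative dderiv d f (\<gamma> s)) (at s)"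
proof -
  have "(\<gamma> has_derivative (\<lambda>h. h *s d)) (at s)"
  proof (subst has_derivative_componentwise_within, intro ballI)
    fix b :: "complex^'a" assume "b \<in> Basis"
    then obtain i c where b: "b = axis i c" by (auto simp: Basis_vec_def)
    have "((\<lambda>s. (\<gamma> s $ i) \<bullet> c) has_derivative (\<lambda>h. (h * d $ i) \<bullet> c)) (at s)"
      using has_derivative_inner_left[OF \<gamma>[of i, unfolded has_field_derivative_def], of c]
      by (simp add: mult.commute[of "d $ i"])
    then show "((\<lambda>x. \<gamma> x \<bullet> b) has_derivative (\<lambda>h. (h *s d) \<bullet> b)) (at s)"
      by (simp add: b inner_axis)
  qed
  from diff_chain_at[OF this holo_on_has_derivative[OF f]]
  show ?thesis
    unfolding has_field_derivative_def o_def dderiv_smult[OF f] mult.commute[of _ "dderiv d f (\<gamma> s)"] .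
qed

text \<open>This is Cauchy's formula for the derivative at the centre of a disc, applied to
\<open>f\<close> on the complex line through \<open>p\<close> in direction \<open>v\<close>.  It turns differentiation in the direction
\<open>v\<close> into an integral of \<open>f\<close> over nearby points, so that regularity of \<open>f\<close> passes to its derivative.\<close>

lemma dderiv_circle_integral:
  assumes f: "holo_on f S" and \<rho>: "\<rho> > 0" and in_S: "\<And>s. norm s \<le> \<rho> \<Longrightarrow> p + s *s v \<in> S"
  shows "dderiv v f p = integral {0..1} (\<lambda>t. inverse (circlepath 0 \<rho> t) * f (p + circlepath 0 \<rho> t *s v))"
proof -
  define g where "g s = f (p + s *s v)" for s
  have g: "(g has_field_derivative dderiv v f (p + s *s v)) (at s)" if "norm s \<le> \<rho>" for s
    unfolding g_def using in_S[OF that]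
    by (intro holo_on_chain[OF f]) (auto intro!: derivative_eq_intros)
  have "continuous_on (cball 0 \<rho>) g"
    using g by (intro continuous_at_imp_continuous_on ballI) (meson DERIV_isCont mem_cball_0)
  moreover have "g holomorphic_on ball 0 \<rho>"
    using g by (intro holomorphic_onI) (meson field_differentiable_at_within field_differentiable_def less_imp_le mem_ball_0)
  ultimately have "(g has_field_derivative (1 / (2 * of_real pi * \<i>) * contour_integral(circlepath 0 \<rho>) (\<lambda>u. g u / (u-0)^2))) (at 0)"
    using \<rho> by (intro Cauchy_derivative_integral_circlepath) auto
  moreover have "(g has_field_derivative dderiv v f p) (at 0)"
    using g[of 0] \<rho> by simp
  ultimately have "dderiv v f p = 1 / (2 * of_real pi * \<i>) * contour_integral(circlepath 0 \<rho>) (\<lambda>u. g u / u^2)"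
    by (simp add: DERIV_unique)
  also have "\<dots> = integral {0..1} (\<lambda>t. 1 / (2 * of_real pi * \<i>) * (g (circlepath 0 \<rho> t) / (circlepath 0 \<rho> t)^2 * vector_derivative (circlepath 0 \<rho>) (at t)))"
    by (simp only: contour_integral_integral integral_mult_right)
  also have "\<dots> = integral {0..1} (\<lambda>t. inverse (circlepath 0 \<rho> t) * g (circlepath 0 \<rho> t))"
    unfolding vector_derivative_circlepath
    using \<rho> by (intro integral_cong) (simp add: circlepath field_simps power2_eq_square)
  finally show ?thesis by (simp add: g_def)
qed

lemma thickened_disc_in_open:
  fixes v :: "complex^'n::finite"
  assumes "open S" "p0 \<in> S"
  obtains \<rho> where "\<rho> > 0" "\<And>p s. p \<in> ball p0 \<rho> \<Longrightarrow> norm s \<le> \<rho> \<Longrightarrow> p + s *s v \<in> S"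
proof -
  obtain e where e: "e > 0" "ball p0 e \<subseteq> S" using assms open_contains_ball by blast
  define \<rho> where "\<rho> = e / (2 + 2 * norm v)"
  have \<rho>: "\<rho> > 0" unfolding \<rho>_def using e by (simp add: add_pos_nonneg)
  have "p + s *s v \<in> S" if "p \<in> ball p0 \<rho>" "norm s \<le> \<rho>" for p s
  proof -
    have "norm (p + s *s v - p0) \<le> norm (p - p0) + norm (s *s v)"
      by (metis add_diff_eq add.commute norm_triangle_ineq)
    also have "\<dots> < \<rho> + \<rho> * norm v"
      using that by (intro add_less_le_mono) (auto simp: dist_norm norm_minus_commute norm_smult_complex intro: mult_right_mono)
    also have "\<rho> + \<rho> * norm v = e / 2"
    proof -
      have "\<rho> * (2 + 2 * norm v) = e"
        unfolding \<rho>_def by (smt (verit) norm_ge_zero nonzero_eq_divide_eq)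
      then show ?thesis by (simp add: algebra_simps)
    qed
    finally have "p + s *s v \<in> ball p0 e" using e by (simp add: dist_norm norm_minus_commute)
    then show ?thesis using e by blast
  qed
  with \<rho> that show ?thesis by blast
qed

lemma continuous_on_circle_kernel:
  assumes g: "continuous_on S g" and \<rho>: "\<rho> > 0"
    and in_S: "\<And>p s. p \<in> U \<Longrightarrow> norm s \<le> \<rho> \<Longrightarrow> p + s *s v \<in> S"
  shows "continuous_on (U \<times> cbox 0 1)
    (\<lambda>x. inverse (circlepath 0 \<rho> (snd x)) * g (fst x + circlepath 0 \<rho> (snd x) *s v))"
proof -
  have c: "continuous_on (U \<times> cbox 0 1) (\<lambda>x. circlepath 0 \<rho> (snd x))"
    unfolding circlepath by (intro continuous_intros)
  have n: "norm (circlepath 0 \<rho> t) = \<rho>" for t using \<rho> by (simp add: circlepath norm_mult)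
  have nz: "circlepath 0 \<rho> t \<noteq> 0" for t using n[of t] \<rho> by auto
  have "continuous_on (U \<times> cbox 0 1) (\<lambda>x. fst x + circlepath 0 \<rho> (snd x) *s v)"
    unfolding vector_scalar_mult_def by (intro continuous_intros c)
  then show ?thesis using in_S nz n
    by (intro continuous_on_mult continuous_on_inverse c continuous_on_compose2[OF g]) auto
qed

lemma continuous_on_dderiv:
  assumes "open S" "holo_on f S"
  shows "continuous_on S (dderiv v f)"
proof (intro continuous_at_imp_continuous_on ballI)
  fix p0 assume "p0 \<in> S"
  then obtain \<rho> where \<rho>: "\<rho> > 0" "\<And>p s. p \<in> ball p0 \<rho> \<Longrightarrow> norm s \<le> \<rho> \<Longrightarrow> p + s *s v \<in> S"
    using thickened_disc_in_open[OF assms(1)] by blast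
  have "continuous_on (ball p0 \<rho> \<times> cbox 0 1)
      (\<lambda>(p,t). inverse (circlepath 0 \<rho> t) * f (p + circlepath 0 \<rho> t *s v))"
    unfolding split_def using \<rho> by (intro continuous_on_circle_kernel[OF holo_on_continuous_on[OF assms(2)]])
  from integral_continuous_on_param[OF this]
  have "continuous_on (ball p0 \<rho>) (dderiv v f)"
    using dderiv_circle_integral[OF assms(2) \<rho>(1) \<rho>(2)]
    by (subst continuous_on_cong[OF refl]) (auto cong: continuous_on_cong)
  then show "isCont (dderiv v f) p0" using \<rho> continuous_on_interior by fastforce
qed

text \<open>Differentiation under the integral sign in Cauchy's formula.  The derivative of the
integrand is continuous because directional derivatives are themselves given by such integrals.
The resulting formula also contains the symmetry of second derivatives: its right-hand side is
Cauchy's formula for \<open>dderiv u f\<close>.\<close>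

lemma has_derivative_dderiv:
  assumes S: "open S" and f: "holo_on f S" and p0: "p0 \<in> S"
  shows "\<exists>\<rho>>0. (\<forall>s. norm s \<le> \<rho> \<longrightarrow> p0 + s *s v \<in> S) \<and>
    (dderiv v f has_derivative
       (\<lambda>u. integral {0..1} (\<lambda>t. inverse (circlepath 0 \<rho> t) * dderiv u f (p0 + circlepath 0 \<rho> t *s v)))) (at p0)"
proof -
  obtain \<rho> where \<rho>: "\<rho> > 0" "\<And>p s. p \<in> ball p0 \<rho> \<Longrightarrow> norm s \<le> \<rho> \<Longrightarrow> p + s *s v \<in> S"
    using thickened_disc_in_open[OF S p0] by blast
  let ?\<gamma> = "circlepath 0 \<rho>"
  have n: "norm (?\<gamma> t) = \<rho>" for t using \<rho> by (simp add: circlepath norm_mult)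
  have nz: "?\<gamma> t \<noteq> 0" for t using n[of t] \<rho> by auto
  have in_S: "p + ?\<gamma> t *s v \<in> S" if "p \<in> ball p0 \<rho>" for p t
    using \<rho>(2)[OF that] n by simp
  have cont: "continuous_on (ball p0 \<rho> \<times> cbox 0 1) (\<lambda>x. inverse (?\<gamma> (snd x)) * g (fst x + ?\<gamma> (snd x) *s v))"
    if "continuous_on S g" for g :: "complex^'a \<Rightarrow> complex"
    using \<rho> by (intro continuous_on_circle_kernel[OF that])
  define fx where "fx p t = Blinfun (\<lambda>u. inverse (?\<gamma> t) * dderiv u f (p + ?\<gamma> t *s v))" for p t
  have bl: "bounded_linear (\<lambda>u. inverse (?\<gamma> t) * dderiv u f (p + ?\<gamma> t *s v))" if "p \<in> ball p0 \<rho>" for p t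
    using has_derivative_bounded_linear[OF holo_on_has_derivative[OF f in_S[OF that, of t]]]
    by (rule bounded_linear_const_mult)
  have fx: "blinfun_apply (fx p t) u = inverse (?\<gamma> t) * dderiv u f (p + ?\<gamma> t *s v)"
    if "p \<in> ball p0 \<rho>" for p t u
    unfolding fx_def using bounded_linear_Blinfun_apply[OF bl[OF that]] by simp
  have cont_fx: "continuous_on (ball p0 \<rho> \<times> cbox 0 1) (\<lambda>(p, t). fx p t)"
    unfolding split_def
  proof (rule continuous_on_blinfun_componentwise)
    fix u :: "complex^'a"
    have "continuous_on (ball p0 \<rho> \<times> cbox 0 1) (\<lambda>x. inverse (?\<gamma> (snd x)) * dderiv u f (fst x + ?\<gamma> (snd x) *s v))"
      using continuous_on_dderiv[OF S f] by (rule cont)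
    then show "continuous_on (ball p0 \<rho> \<times> cbox 0 1) (\<lambda>x. blinfun_apply (fx (fst x) (snd x)) u)"
      by (rule continuous_on_eq) (auto simp: fx)
  qed
  have slice_cont: "continuous_on (cbox 0 1) (\<lambda>t. h (p, t))"
    if "continuous_on (ball p0 \<rho> \<times> cbox (0::real) 1) h" "p \<in> ball p0 \<rho>"
    for h :: "_ \<Rightarrow> 'c::topological_space" and p
    using that(2) by (intro continuous_on_compose2[OF that(1)] continuous_intros) auto
  have slice: "continuous_on (cbox 0 1) (\<lambda>t. inverse (?\<gamma> t) * f (p + ?\<gamma> t *s v))" if "p \<in> ball p0 \<rho>" for p
    using slice_cont[OF cont[OF holo_on_continuous_on[OF f]] that] by simp
  have "((\<lambda>p. integral (cbox 0 1) (\<lambda>t. inverse (?\<gamma> t) * f (p + ?\<gamma> t *s v))) has_derivative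
      integral (cbox 0 1) (fx p0)) (at p0 within ball p0 \<rho>)"
  proof (rule leibniz_rule[OF _ _ cont_fx])
    fix p t assume p: "p \<in> ball p0 \<rho>"
    have "((\<lambda>p. f (p + ?\<gamma> t *s v)) has_derivative (\<lambda>u. dderiv u f (p + ?\<gamma> t *s v))) (at p)"
    proof -
      have "((\<lambda>p. p + ?\<gamma> t *s v) has_derivative (\<lambda>u. u)) (at p)"
        using has_derivative_add[OF has_derivative_ident has_derivative_const] by simp
      from has_derivative_compose[OF this, of f "\<lambda>u. dderiv u f (p + ?\<gamma> t *s v)"]
      show ?thesis using holo_on_has_derivative[OF f in_S[OF p, of t]] by simp
    qed
    from has_derivative_at_withinI[OF has_derivative_mult_right[OF this]]
    show "((\<lambda>p. inverse (?\<gamma> t) * f (p + ?\<gamma> t *s v)) has_derivative blinfun_apply (fx p t)) (at p within ball p0 \<rho>)"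
      unfolding ext[of "blinfun_apply (fx p t)", OF fx[OF p]] .
  qed (use \<rho> integrable_continuous[OF slice] in auto)
  then have "(dderiv v f has_derivative integral (cbox 0 1) (fx p0)) (at p0 within ball p0 \<rho>)"
    by (rule has_derivative_transform[rotated 2])
      (use dderiv_circle_integral[OF f \<rho>(1)] \<rho> in auto)
  then have "(dderiv v f has_derivative integral (cbox 0 1) (fx p0)) (at p0)"
    using \<rho> by (simp add: at_within_open[OF _ open_ball])
  moreover have int_apply: "blinfun_apply (integral (cbox 0 1) (fx p0)) u
      = integral {0..1} (\<lambda>t. inverse (?\<gamma> t) * dderiv u f (p0 + ?\<gamma> t *s v))" for u
  proof -
    have "continuous_on (cbox 0 1) (fx p0)"
      using slice_cont[OF cont_fx, of p0] \<rho> by simp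
    from blinfun_apply_integral[OF integrable_continuous[OF this]]
    show ?thesis using \<rho> by (simp add: fx)
  qed
  ultimately have "(dderiv v f has_derivative
      (\<lambda>u. integral {0..1} (\<lambda>t. inverse (?\<gamma> t) * dderiv u f (p0 + ?\<gamma> t *s v)))) (at p0)"
    unfolding ext[of "blinfun_apply (integral (cbox 0 1) (fx p0))", OF int_apply] by blast
  with \<rho>(1) \<rho>(2)[of p0] show ?thesis by (intro exI[of _ \<rho>]) auto
qed

lemma holo_on_dderiv:
  assumes S: "open S" and f: "holo_on f S"
  shows "holo_on (dderiv v f) S"
  unfolding holo_on_def
proof
  fix p assume "p \<in> S"
  then obtain \<rho> where \<rho>: "\<rho> > 0" "\<And>s. norm s \<le> \<rho> \<Longrightarrow> p + s *s v \<in> S"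
    "(dderiv v f has_derivative
       (\<lambda>u. integral {0..1} (\<lambda>t. inverse (circlepath 0 \<rho> t) * dderiv u f (p + circlepath 0 \<rho> t *s v)))) (at p)"
    (is "(_ has_derivative ?F) _") using has_derivative_dderiv[OF S f] by blast
  have in_S: "p + circlepath 0 \<rho> t *s v \<in> S" for t using \<rho> by (simp add: circlepath norm_mult)
  have "?F (c *s u) = c * ?F u" for c u
    unfolding dderiv_smult[OF f in_S] mult.left_commute[of _ c] by simp
  with \<rho>(3) show "\<exists>f'. (dderiv v f has_derivative f') (at p) \<and> (\<forall>c v. f' (c *s v) = c * f' v)" by blast
qed

lemma dderiv_commute:
  assumes S: "open S" and f: "holo_on f S" and p: "p \<in> S"
  shows "dderiv u (dderiv v f) p = dderiv v (dderiv u f) p"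
proof -
  obtain \<rho> where \<rho>: "\<rho> > 0" "\<And>s. norm s \<le> \<rho> \<Longrightarrow> p + s *s v \<in> S"
    "(dderiv v f has_derivative
       (\<lambda>u. integral {0..1} (\<lambda>t. inverse (circlepath 0 \<rho> t) * dderiv u f (p + circlepath 0 \<rho> t *s v)))) (at p)"
    using has_derivative_dderiv[OF S f p] by blast
  show ?thesis
    unfolding has_derivative_imp_dderiv[OF \<rho>(3)]
    using dderiv_circle_integral[OF holo_on_dderiv[OF S f] \<rho>(1), of p v u] \<rho>(2) by simp
qed

lemma holo_on_comp_holomorphic:
  assumes f: "holo_on f S" and A: "open A"
    and \<gamma>: "\<And>i. (\<lambda>s. \<gamma> s $ i) holomorphic_on A" "\<And>s. s \<in> A \<Longrightarrow> \<gamma> s \<in> S"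
  shows "(\<lambda>s. f (\<gamma> s)) holomorphic_on A"
proof (rule holomorphic_onI)
  fix s assume s: "s \<in> A"
  have "((\<lambda>s. \<gamma> s $ i) has_field_derivative (\<chi> i. deriv (\<lambda>s. \<gamma> s $ i) s) $ i) (at s)" for i
    using holomorphic_derivI[OF \<gamma>(1) A s] by simp
  from holo_on_chain[OF f \<gamma>(2)[OF s] this]
  show "(\<lambda>s. f (\<gamma> s)) field_differentiable at s within A"
    using field_differentiable_at_within field_differentiable_def by blast
qed

section \<open>Conjugation and the polynomial models\<close>

definition cnjv :: "complex^'n \<Rightarrow> complex^'n" where
  "cnjv p = (\<chi> i. cnj (p $ i))"

text \<open>The Schwarz reflection of \<open>f\<close>, the holomorphic function whose power series has the conjugate
coefficients.  A holomorphic \<open>f\<close> is real at real points iff it is fixed by this operation.\<close>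

definition star :: "(complex^'n \<Rightarrow> complex) \<Rightarrow> complex^'n \<Rightarrow> complex" where
  "star f p = cnj (f (cnjv p))"

lemma cnjv_nth [simp]: "cnjv p $ i = cnj (p $ i)"
  by (simp add: cnjv_def)

lemma cnjv_cnjv [simp]: "cnjv (cnjv p) = p"
  by (simp add: vec_eq_iff)

lemma norm_cnjv [simp]: "norm (cnjv p) = norm (p :: complex^'n::finite)"
  by (simp add: norm_vec_def)

lemma cnjv_add: "cnjv (p + v) = cnjv p + cnjv v"
  and cnjv_smult: "cnjv (c *s v) = cnj c *s cnjv v"
  and cnjv_axis: "cnjv (axis i c) = axis i (cnj c)"
  and cnjv_0: "cnjv 0 = 0"
  by (simp_all add: vec_eq_iff axis_def)

lemma bounded_linear_cnjv: "bounded_linear (cnjv :: complex^'n::finite \<Rightarrow> _)"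
proof (rule bounded_linear_intro[where K = 1])
  fix r :: real and x :: "complex^'n"
  show "cnjv (r *\<^sub>R x) = r *\<^sub>R cnjv x"
    unfolding scaleR_eq_smult cnjv_smult by simp
qed (simp_all add: cnjv_add)

lemma star_star [simp]: "star (star f) = f"
  by (simp add: star_def fun_eq_iff)

lemma has_derivative_star:
  assumes "holo_on f (ball 0 r)" "p \<in> ball 0 r"
  shows "(star f has_derivative (\<lambda>v. cnj (dderiv (cnjv v) f (cnjv p)))) (at p)"
proof -
  have "(f has_derivative (\<lambda>v. dderiv v f (cnjv p))) (at (cnjv p))"
    using assms by (intro holo_on_has_derivative[OF assms(1)]) simp
  with has_derivative_compose[OF bounded_linear_imp_has_derivative[OF bounded_linear_cnjv]]
  have "((\<lambda>p. f (cnjv p)) has_derivative (\<lambda>v. dderiv (cnjv v) f (cnjv p))) (at p)"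
    by blast
  from has_derivative_compose[OF this bounded_linear_imp_has_derivative[OF bounded_linear_cnj]]
  show ?thesis unfolding star_def .
qed

lemma holo_on_star:
  assumes "holo_on f (ball 0 r)"
  shows "holo_on (star f) (ball 0 r)"
proof (rule holo_onI[OF has_derivative_star[OF assms]])
  fix p v :: "complex^'a" and c assume "p \<in> ball 0 r"
  then have "cnjv p \<in> ball 0 r" by simp
  from dderiv_smult[OF assms this]
  show "cnj (dderiv (cnjv (c *s v)) f (cnjv p)) = c * cnj (dderiv (cnjv v) f (cnjv p))"
    by (simp add: cnjv_smult)
qed

text \<open>Through this rule every differential equation below yields its conjugate equation.\<close>

lemma dderiv_star:
  assumes "holo_on f (ball 0 r)" "p \<in> ball 0 r"
  shows "dderiv v (star f) p = star (dderiv (cnjv v) f) p"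
  using has_derivative_imp_dderiv[OF has_derivative_star[OF assms]] by (simp add: star_def)

lemma exhaust_9:
  fixes x :: 9
  shows "x = 0 \<or> x = 1 \<or> x = 2 \<or> x = 3 \<or> x = 4 \<or> x = 5 \<or> x = 6 \<or> x = 7 \<or> x = 8"
proof (induct x)
  case (of_int z)
  then have "z = 0 \<or> z = 1 \<or> z = 2 \<or> z = 3 \<or> z = 4 \<or> z = 5 \<or> z = 6 \<or> z = 7 \<or> z = 8" by fastforce
  then show ?case by auto
qed

lemma UNIV_9: "UNIV = {0, 1, 2, 3, 4, 5, 6, 7, 8 :: 9}"
  using exhaust_9 by auto

lemma nonzero_9: "{l::9. l \<noteq> 0} = {1, 2, 3, 4, 5, 6, 7, 8}"
  using exhaust_9 by auto

lemma sum_9: "sum f (UNIV :: 9 set) = f 0 + f 1 + f 2 + f 3 + f 4 + f 5 + f 6 + f 7 + f 8"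
  unfolding UNIV_9 by (simp add: ac_simps)

text \<open>The defining polynomials are \<open>\<phi>\<^sub>l = \<Sum> a\<^sub>j\<^sub>k z\<^sup>j s\<^sup>k\<close> with \<open>s\<close> in place of \<open>cnj z\<close>.
Since \<open>w\<^sub>l - cnj w\<^sub>l\<close> is imaginary, the coefficient of \<open>z\<^sup>k s\<^sup>j\<close> is \<open>- cnj a\<^sub>j\<^sub>k\<close>, so only \<open>j \<ge> k\<close>
has to be listed.\<close>

definition a11 :: "9 \<Rightarrow> complex" where "a11 l = (if l = 1 then 2 * \<i> else 0)"
definition a21 :: "9 \<Rightarrow> complex" where "a21 l = (if l = 2 then 2 * \<i> else if l = 3 then 2 else 0)"
definition a31 :: "9 \<Rightarrow> complex" where "a31 l = (if l = 4 then 2 * \<i> else if l = 5 then 2 else 0)"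
definition a22 :: "9 \<Rightarrow> complex" where "a22 l = (if l = 6 then 2 * \<i> else 0)"

lemma cnj_a11 [simp]: "cnj (a11 l) = - a11 l" and cnj_a22 [simp]: "cnj (a22 l) = - a22 l"
  by (simp_all add: a11_def a22_def)

lemma imaginary_pair_eq_0:
  fixes x y :: complex
  assumes "2 * \<i> * x + 2 * y = 0" "- 2 * \<i> * x + 2 * y = 0"
  shows "x = 0 \<and> y = 0"
proof -
  have "4 * y = (2 * \<i> * x + 2 * y) + (- 2 * \<i> * x + 2 * y)" by simp
  then have "y = 0" unfolding assms by simp
  with assms(1) show ?thesis by simp
qed

text \<open>The family containing the three submanifolds: the first six equations are the shared ones,
the last two are arbitrary real combinations of the degree five terms.  Condition \<open>nondegenerate\<close>
says that these two equations are nontrivial enough for their coefficient vectors and the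
conjugates of these to span the \<open>(w\<^sub>7, w\<^sub>8)\<close> directions over the complex numbers.\<close>

locale quintic_model =
  fixes a41 a32 :: "9 \<Rightarrow> complex"
  assumes a41_support: "l \<notin> {7, 8} \<Longrightarrow> a41 l = 0"
    and a32_support: "l \<notin> {7, 8} \<Longrightarrow> a32 l = 0"
    and nondegenerate: "a41 7 * x + a41 8 * y = 0 \<Longrightarrow> cnj (a41 7) * x + cnj (a41 8) * y = 0 \<Longrightarrow>
      a32 7 * x + a32 8 * y = 0 \<Longrightarrow> cnj (a32 7) * x + cnj (a32 8) * y = 0 \<Longrightarrow> x = 0 \<and> y = 0"
begin

text \<open>\<open>k1, \<dots>, k4\<close> are the coefficients of \<open>s, \<dots>, s\<^sup>4\<close> in \<open>\<phi>\<^sub>l(z, s)\<close>, and the primed functions are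
their derivatives in \<open>z\<close>.\<close>

definition k1 where "k1 l z = a11 l * z + a21 l * z^2 + a31 l * z^3 + a41 l * z^4"
definition k2 where "k2 l z = - cnj (a21 l) * z + a22 l * z^2 + a32 l * z^3"
definition k3 where "k3 l z = - cnj (a31 l) * z - cnj (a32 l) * z^2"
definition k4 where "k4 l z = - cnj (a41 l) * z"

definition k1' where "k1' l z = a11 l + 2 * a21 l * z + 3 * a31 l * z^2 + 4 * a41 l * z^3"
definition k2' where "k2' l z = - cnj (a21 l) + 2 * a22 l * z + 3 * a32 l * z^2"
definition k3' where "k3' l z = - cnj (a31 l) - 2 * cnj (a32 l) * z"
definition k4' where "k4' l z = - cnj (a41 l)" for z :: complex

definition phi where "phi l z s = k1 l z * s + k2 l z * s^2 + k3 l z * s^3 + k4 l z * s^4"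
definition phi_z where "phi_z l z s = k1' l z * s + k2' l z * s^2 + k3' l z * s^3 + k4' l z * s^4"
definition phi_s where "phi_s l z s = k1 l z + 2 * k2 l z * s + 3 * k3 l z * s^2 + 4 * k4 l z * s^3"

lemmas k_defs = k1_def k2_def k3_def k4_def k1'_def k2'_def k3'_def k4'_def

definition Meqns :: "(complex^9 \<Rightarrow> complex) set" where
  "Meqns = (\<lambda>l. eqn l (phi l)) ` {l. l \<noteq> 0}"

lemma cnj_phi: "cnj (phi l z s) = - phi l (cnj s) (cnj z)"
  by (simp add: phi_def k_defs algebra_simps)

lemma phi_has_derivative:
  assumes "(x has_derivative x') (at p)" "(y has_derivative y') (at p)"
  shows "((\<lambda>p. phi l (x p) (y p)) has_derivative
    (\<lambda>v. phi_z l (x p) (y p) * x' v + phi_s l (x p) (y p) * y' v)) (at p)"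
  unfolding phi_def k_defs phi_z_def phi_s_def
  by (rule derivative_eq_intros assms refl)+
    (simp add: fun_eq_iff algebra_simps power2_eq_square power3_eq_cube power4_eq_xxxx)

lemma phi_holomorphic [holomorphic_intros]:
  assumes "x holomorphic_on A" "y holomorphic_on A"
  shows "(\<lambda>s. phi l (x s) (y s)) holomorphic_on A"
    "(\<lambda>s. phi_z l (x s) (y s)) holomorphic_on A"
    "(\<lambda>s. phi_s l (x s) (y s)) holomorphic_on A"
  unfolding phi_def phi_z_def phi_s_def k_defs by (intro holomorphic_intros assms)+

lemma phi_0 [simp]: "phi l 0 s = 0" "phi l z 0 = 0"
  by (simp_all add: phi_def k_defs)

text \<open>Tangency at \<open>p\<close> with the Wirtinger derivatives of the defining functions computed.\<close>

definition tangent_at :: "9 vfield \<Rightarrow> complex^9 \<Rightarrow> bool" where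
  "tangent_at X p \<longleftrightarrow> (\<forall>l. l \<noteq> 0 \<longrightarrow> X p $ l - cnj (X p $ l)
     - phi_z l (p $ 0) (cnj (p $ 0)) * X p $ 0 - phi_s l (p $ 0) (cnj (p $ 0)) * cnj (X p $ 0) = 0)"

lemma apply_vf_eqn:
  assumes "l \<noteq> 0"
  shows "apply_vf X (eqn l (phi l)) p + apply_vf_bar X (eqn l (phi l)) p =
    X p $ l - cnj (X p $ l)
     - phi_z l (p $ 0) (cnj (p $ 0)) * X p $ 0 - phi_s l (p $ 0) (cnj (p $ 0)) * cnj (X p $ 0)"
proof -
  let ?z = "phi_z l (p $ 0) (cnj (p $ 0))" and ?s = "phi_s l (p $ 0) (cnj (p $ 0))"
  have "(eqn l (phi l) has_derivative
      (\<lambda>v. v $ l - cnj (v $ l) - (?z * v $ 0 + ?s * cnj (v $ 0)))) (at p)"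
    unfolding eqn_def
    by (intro has_derivative_diff phi_has_derivative bounded_linear_imp_has_derivative
        bounded_linear_vec_nth bounded_linear_compose[OF bounded_linear_cnj])
  then have *: "frechet_derivative (eqn l (phi l)) (at p) =
      (\<lambda>v. v $ l - cnj (v $ l) - (?z * v $ 0 + ?s * cnj (v $ 0)))"
    by (rule frechet_derivative_at[symmetric])
  have w: "wirtinger i (eqn l (phi l)) p = (if i = l then 1 else 0) - (if i = 0 then ?z else 0)"
    and wb: "wirtinger_bar i (eqn l (phi l)) p = (if i = l then - 1 else 0) - (if i = 0 then ?s else 0)" for i
    unfolding wirtinger_def wirtinger_bar_def * using assms by (auto simp: axis_def algebra_simps)
  have "(\<Sum>i\<in>UNIV. f i * ((if i = l then c else 0) - (if i = 0 then d else 0))) = f l * c - f 0 * d"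
    for f :: "9 \<Rightarrow> complex" and c d
    by (simp add: right_diff_distrib sum_subtractf if_distrib[of "\<lambda>x. _ * x"] cong: if_cong)
  then show ?thesis
    unfolding apply_vf_def apply_vf_bar_def w wb by (simp add: mult.commute)
qed

lemma tangent_to_Meqns:
  "tangent_to X Meqns \<longleftrightarrow> (\<forall>\<^sub>F p in nhds 0. p \<in> zero_locus Meqns \<longrightarrow> tangent_at X p)"
  unfolding tangent_to_def tangent_at_def Meqns_def by (simp add: apply_vf_eqn)

lemma zero_locus_Meqns:
  "p \<in> zero_locus Meqns \<longleftrightarrow> (\<forall>l. l \<noteq> 0 \<longrightarrow> p $ l - cnj (p $ l) = phi l (p $ 0) (cnj (p $ 0)))"
  unfolding zero_locus_def Meqns_def eqn_def by auto

end

section \<open>Polarization of the tangency condition\<close>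

definition setz :: "complex \<Rightarrow> complex^9 \<Rightarrow> complex^9" where
  "setz z w = (\<chi> i. if i = 0 then z else w $ i)"

lemma setz_nth [simp]: "setz z w $ i = (if i = 0 then z else w $ i)"
  by (simp add: setz_def)

lemma norm_setz_le: "norm (setz z w) \<le> norm w + norm z"
proof -
  have "norm (setz z w) = norm (setz 0 w + axis 0 z)"
    by (rule arg_cong[of _ _ norm]) (simp add: vec_eq_iff axis_def)
  also have "\<dots> \<le> norm (setz 0 w) + norm (axis 0 z :: complex^9)"
    by (rule norm_triangle_ineq)
  also have "norm (setz 0 w) \<le> norm w"
    by (rule norm_le_componentwise_cart) simp
  also have "norm (axis 0 z :: complex^9) = norm z"
    by (simp add: norm_vec_def L2_set_def axis_def if_distrib[of norm] if_distrib[of "\<lambda>x. x^2"] cong: if_cong)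
  finally show ?thesis by simp
qed

text \<open>A holomorphic function of one variable that vanishes on a real segment vanishes identically.
Used on a complex line \<open>a + t b\<close> with \<open>a\<close>, \<open>b\<close> in a real form, evaluation at \<open>t = \<i>\<close> reaches every point
of the complexified space.\<close>

lemma holomorphic_zero_on_reals:
  assumes "h holomorphic_on ball 0 2" "\<And>t::real. \<bar>t\<bar> < 2 \<Longrightarrow> h (complex_of_real t) = 0"
  shows "h \<i> = 0"
proof (rule analytic_continuation[OF assms(1)])
  show "0 islimpt complex_of_real ` {-2<..<2}"
    unfolding islimpt_approachable
  proof (intro allI impI)
    fix e :: real assume "e > 0"
    then show "\<exists>x'\<in>complex_of_real ` {-2<..<2}. x' \<noteq> 0 \<and> dist x' 0 < e"
      by (intro bexI[of _ "complex_of_real (min 1 (e/2))"]) auto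
  qed
qed (use assms(2) in auto)

lemma isCont_small:
  fixes G :: "'a::real_normed_vector \<times> 'b::real_normed_vector \<Rightarrow> 'c::real_normed_vector"
  assumes "isCont G (0, 0)" "G (0, 0) = 0" "d > 0"
  shows "\<exists>s>0. \<forall>x y. norm x < s \<longrightarrow> norm y < s \<longrightarrow> norm (G (x, y)) < d"
proof -
  obtain e where e: "e > 0" "\<And>x. dist x (0,0) < e \<Longrightarrow> dist (G x) (G (0,0)) < d"
    using assms(1,3) unfolding continuous_at_eps_delta by blast
  have "norm (G (x, y)) < d" if "norm x < e / 2" "norm y < e / 2" for x y
  proof -
    have "norm (x, y) \<le> norm x + norm y"
      by (rule norm_Pair_le)
    with that have "dist (x, y) (0, 0) < e" by (simp add: dist_norm)
    from e(2)[OF this] show ?thesis by (simp add: assms(2))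
  qed
  with e(1) show ?thesis by (intro exI[of _ "e/2"]) auto
qed

context quintic_model begin

text \<open>For \<open>x\<^sub>l\<close> real and \<open>s = cnj (x\<^sub>0)\<close> the point \<open>up x s\<close> runs through the submanifold, with
parameters \<open>z = x\<^sub>0\<close> and \<open>Re w\<^sub>l = x\<^sub>l\<close>, and \<open>down x s\<close> is its conjugate.\<close>

definition up :: "complex^9 \<Rightarrow> complex \<Rightarrow> complex^9" where
  "up x s = (\<chi> i. if i = 0 then x $ 0 else x $ i + phi i (x $ 0) s / 2)"

definition down :: "complex^9 \<Rightarrow> complex \<Rightarrow> complex^9" where
  "down x s = (\<chi> i. if i = 0 then s else x $ i - phi i (x $ 0) s / 2)"

text \<open>The point that takes the role of the conjugate of \<open>p\<close> once \<open>cnj (p\<^sub>0)\<close> is replaced by \<open>s\<close>;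
on the submanifold, and with \<open>s = cnj (p\<^sub>0)\<close>, it is the conjugate.\<close>

definition conj_pt :: "complex^9 \<Rightarrow> complex \<Rightarrow> complex^9" where
  "conj_pt p s = (\<chi> i. if i = 0 then s else p $ i - phi i (p $ 0) s)"

text \<open>The solution \<open>x\<close> of \<open>up x s = p\<close>.\<close>

definition mid :: "complex^9 \<Rightarrow> complex \<Rightarrow> complex^9" where
  "mid p s = (\<chi> i. if i = 0 then p $ 0 else p $ i - phi i (p $ 0) s / 2)"

lemma isCont_up: "isCont (\<lambda>x. up (fst x) (snd x)) (0, 0)"
  and isCont_down: "isCont (\<lambda>x. down (fst x) (snd x)) (0, 0)"
  and isCont_mid: "isCont (\<lambda>x. mid (fst x) (snd x)) (0, 0)"
  unfolding mid_def up_def down_def phi_def k_defs continuous_at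
  by (intro tendsto_vec_lambda, case_tac "i = 0"; force intro!: tendsto_eq_intros)+

text \<open>In the parameters \<open>(x, s)\<close> of \<open>up\<close> and \<open>down\<close> the tangency equation is holomorphic, and it
holds on the real form \<open>x\<^sub>l \<in> \<real>\<close>, \<open>s = cnj (x\<^sub>0)\<close>.  Every \<open>(x, s)\<close> is \<open>a + \<i> b\<close> with \<open>a\<close>, \<open>b\<close> in this
real form, so the one-variable principle above extends it to all small \<open>(x, s)\<close>.  Solving for \<open>x\<close>
in \<open>p = up x s\<close> gives the stated form.\<close>

lemma polarized_tangency:
  assumes r: "r > 0" and X: "\<And>l. holo_on (\<lambda>p. X p $ l) (ball 0 r)"
    and tan: "\<And>p. p \<in> ball 0 r \<Longrightarrow> p \<in> zero_locus Meqns \<Longrightarrow> tangent_at X p"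
  shows "\<exists>d>0. \<forall>p s. norm p < d \<longrightarrow> norm s < d \<longrightarrow> (\<forall>l. l \<noteq> 0 \<longrightarrow>
    X p $ l - star (\<lambda>p. X p $ l) (conj_pt p s) - phi_z l (p $ 0) s * X p $ 0
      - phi_s l (p $ 0) s * star (\<lambda>p. X p $ 0) (conj_pt p s) = 0)"
proof -
  define F where "F l x s = X (up x s) $ l - star (\<lambda>p. X p $ l) (down x s)
      - phi_z l (x $ 0) s * X (up x s) $ 0 - phi_s l (x $ 0) s * star (\<lambda>p. X p $ 0) (down x s)" for l x s
  have "up 0 0 = 0" "down 0 0 = 0"
    by (simp_all add: vec_eq_iff up_def down_def)
  then obtain d1 d2 where d: "d1 > 0" "d2 > 0"
    "\<And>x s. norm x < d1 \<Longrightarrow> norm s < d1 \<Longrightarrow> norm (up x s) < r"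
    "\<And>x s. norm x < d2 \<Longrightarrow> norm s < d2 \<Longrightarrow> norm (down x s) < r"
    using isCont_small[OF isCont_up _ r] isCont_small[OF isCont_down _ r] by auto
  define d where "d = min d1 d2"
  have d0: "d > 0" and up_in: "norm x < d \<Longrightarrow> norm s < d \<Longrightarrow> norm (up x s) < r"
    and down_in: "norm x < d \<Longrightarrow> norm s < d \<Longrightarrow> norm (down x s) < r" for x s
    using d by (auto simp: d_def)
  have real_form: "F l x (cnj (x $ 0)) = 0"
    if "l \<noteq> 0" "\<And>i. i \<noteq> 0 \<Longrightarrow> x $ i \<in> \<real>" "norm x < d" for l x
  proof -
    let ?s = "cnj (x $ 0)"
    have s: "norm ?s < d" using that(3) Finite_Cartesian_Product.norm_nth_le[of x 0] by simp
    have dn: "down x ?s = cnjv (up x ?s)"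
    proof -
      have "cnj (x $ i) = x $ i" if "i \<noteq> 0" for i using that \<open>\<And>i. i \<noteq> 0 \<Longrightarrow> x $ i \<in> \<real>\<close> Reals_cnj_iff by blast
      then show ?thesis by (simp add: vec_eq_iff up_def down_def cnj_phi)
    qed
    have "up x ?s \<in> zero_locus Meqns"
      unfolding zero_locus_Meqns
    proof (intro allI impI)
      fix i :: 9 assume i: "i \<noteq> 0"
      then have "cnj (x $ i) = x $ i" using that(2) Reals_cnj_iff by blast
      then show "up x ?s $ i - cnj (up x ?s $ i) = phi i (up x ?s $ 0) (cnj (up x ?s $ 0))"
        using i by (simp add: up_def cnj_phi)
    qed
    with tan[of "up x ?s"] up_in[OF that(3) s] have "tangent_at X (up x ?s)" by simp
    with \<open>l \<noteq> 0\<close> show ?thesis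
      unfolding tangent_at_def F_def dn star_def by (simp add: up_def)
  qed
  have F0: "F l x s = 0" if l: "l \<noteq> 0" and x: "norm x < d / 6" "norm s < d / 6" for l x s
  proof -
    \<comment> \<open>\<open>x'\<close> is the image of \<open>(x, s)\<close> under the conjugation that fixes the real form;
\<open>a\<close> and \<open>b\<close> are the real and imaginary parts with respect to it.\<close>
    define x' where "x' = cnjv (setz s x)"
    define a where "a = (1/2) *s (x + x')"
    define b where "b = (- \<i>/2) *s (x - x')"
    define y where "y t = a + t *s b" for t
    define s' where "s' t = cnj (a $ 0) + t * cnj (b $ 0)" for t
    have "norm x' < d / 3" unfolding x'_def using norm_setz_le[of s x] x by simp
    moreover have "norm a \<le> 1/2 * (norm x + norm x')" "norm b \<le> 1/2 * (norm x + norm x')"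
      unfolding a_def b_def norm_smult_complex using norm_triangle_ineq[of x x'] norm_triangle_ineq4[of x x'] by (auto simp: norm_mult norm_divide)
    ultimately have ab: "norm a < d / 3" "norm b < d / 3" using x(1) d0 by auto
    have small: "norm (y t) < d" "norm (s' t) < d" if "norm t < 2" for t
    proof -
      have "norm (t *s b) \<le> 2 * norm b"
        unfolding norm_smult_complex using that by (intro mult_right_mono) auto
      then show "norm (y t) < d"
        unfolding y_def using norm_triangle_ineq[of a "t *s b"] ab by linarith
      have "norm (t * cnj (b $ 0)) \<le> 2 * norm b"
        unfolding norm_mult complex_mod_cnj using that Finite_Cartesian_Product.norm_nth_le[of b 0]
        by (intro mult_mono) auto
      then show "norm (s' t) < d"
        unfolding s'_def using norm_triangle_ineq[of "cnj (a $ 0)" "t * cnj (b $ 0)"] ab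
          Finite_Cartesian_Product.norm_nth_le[of a 0] by simp
    qed
    define h where "h t = F l (y t) (s' t)" for t
    have hol: "(\<lambda>t. y t $ i) holomorphic_on A" "s' holomorphic_on A" for i A
      unfolding y_def s'_def by (auto intro!: holomorphic_intros)
    have hol_up: "(\<lambda>t. up (y t) (s' t) $ i) holomorphic_on A"
      and hol_down: "(\<lambda>t. down (y t) (s' t) $ i) holomorphic_on A" for i A
      unfolding up_def down_def using hol by (cases "i = 0"; simp; intro holomorphic_intros hol)+
    have "h holomorphic_on ball 0 2"
      unfolding h_def F_def
      using small up_in down_in
      by (intro holomorphic_intros holo_on_comp_holomorphic[OF X] holo_on_comp_holomorphic[OF holo_on_star[OF X]] hol hol_up hol_down open_ball) auto
    moreover have "h (complex_of_real t) = 0" if "\<bar>t\<bar> < 2" for t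
    proof -
      have "s' (complex_of_real t) = cnj (y (complex_of_real t) $ 0)"
        by (simp add: s'_def y_def)
      moreover have "y (complex_of_real t) $ i \<in> \<real>" if "i \<noteq> 0" for i
        using that unfolding y_def a_def b_def x'_def by (simp add: complex_is_Real_iff)
      ultimately show ?thesis
        unfolding h_def using real_form[OF l] small(1)[of "complex_of_real t"] that by simp
    qed
    ultimately have "h \<i> = 0" by (rule holomorphic_zero_on_reals)
    moreover have "y \<i> = x"
      unfolding y_def a_def b_def by (simp add: vec_eq_iff algebra_simps)
    moreover have "s' \<i> = s"
      unfolding s'_def a_def b_def x'_def by (simp add: algebra_simps)
    ultimately show ?thesis by (simp add: h_def)
  qed
  have "mid 0 0 = 0" by (simp add: mid_def vec_eq_iff)
  then obtain d3 where d3: "d3 > 0" "\<And>x s. norm x < d3 \<Longrightarrow> norm s < d3 \<Longrightarrow> norm (mid x s) < d / 6"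
    using isCont_small[OF isCont_mid, of "d/6"] d0 by auto
  define e where "e = min d3 (d / 6)"
  have "e > 0" using d3 d0 by (simp add: e_def)
  moreover have "(\<forall>l. l \<noteq> 0 \<longrightarrow>
    X p $ l - star (\<lambda>p. X p $ l) (conj_pt p s) - phi_z l (p $ 0) s * X p $ 0
      - phi_s l (p $ 0) s * star (\<lambda>p. X p $ 0) (conj_pt p s) = 0)" if "norm p < e" "norm s < e" for p s
  proof -
    have "up (mid p s) s = p" "down (mid p s) s = conj_pt p s" "mid p s $ 0 = p $ 0"
      by (simp_all add: vec_eq_iff up_def down_def mid_def conj_pt_def)
    moreover have "norm (mid p s) < d / 6" "norm s < d / 6" using that d3(2) by (auto simp: e_def)
    ultimately show ?thesis
      using F0[of _ "mid p s" s] that unfolding F_def by (auto simp: e_def)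
  qed
  ultimately show ?thesis by blast
qed

end

section \<open>Second-order expansion along the conjugate variable\<close>

text \<open>The Taylor expansion of \<open>g\<close> at 0 starts with \<open>a + b s + c s\<^sup>2\<close>.\<close>

definition jet2 :: "(complex \<Rightarrow> complex) \<Rightarrow> complex \<Rightarrow> complex \<Rightarrow> complex \<Rightarrow> bool" where
  "jet2 g a b c \<longleftrightarrow> (\<exists>g'. (\<forall>\<^sub>F s in nhds 0. (g has_field_derivative g' s) (at s)) \<and>
     g 0 = a \<and> g' 0 = b \<and> (g' has_field_derivative 2 * c) (at 0))"

lemma jet2_const: "jet2 (\<lambda>_. c) c 0 0"
  unfolding jet2_def by (intro exI[of _ "\<lambda>_. 0"]) simp

lemma jet2_diff:
  assumes "jet2 f a b c" "jet2 g a' b' c'"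
  shows "jet2 (\<lambda>s. f s - g s) (a - a') (b - b') (c - c')"
proof -
  obtain f' g' where fg: "\<forall>\<^sub>F s in nhds 0. (f has_field_derivative f' s) (at s)"
    "\<forall>\<^sub>F s in nhds 0. (g has_field_derivative g' s) (at s)"
    "(f' has_field_derivative 2 * c) (at 0)" "(g' has_field_derivative 2 * c') (at 0)"
    "f 0 = a" "g 0 = a'" "f' 0 = b" "g' 0 = b'"
    using assms unfolding jet2_def by blast
  have "\<forall>\<^sub>F s in nhds 0. ((\<lambda>s. f s - g s) has_field_derivative f' s - g' s) (at s)"
    using fg(1,2) by eventually_elim (rule DERIV_diff)
  then show ?thesis
    unfolding jet2_def using fg DERIV_diff[OF fg(3,4)]
    by (intro exI[of _ "\<lambda>s. f' s - g' s"]) (simp add: right_diff_distrib)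
qed

lemma jet2_add:
  assumes "jet2 f a b c" "jet2 g a' b' c'"
  shows "jet2 (\<lambda>s. f s + g s) (a + a') (b + b') (c + c')"
proof -
  have "jet2 (\<lambda>s. 0 - g s) (0 - a') (0 - b') (0 - c')"
    by (rule jet2_diff[OF jet2_const assms(2)])
  from jet2_diff[OF assms(1) this] show ?thesis by simp
qed

lemma jet2_mult:
  assumes "jet2 f a b c" "jet2 g a' b' c'"
  shows "jet2 (\<lambda>s. f s * g s) (a * a') (a * b' + b * a') (a * c' + b * b' + c * a')"
proof -
  obtain f' g' where fg: "\<forall>\<^sub>F s in nhds 0. (f has_field_derivative f' s) (at s)"
    "\<forall>\<^sub>F s in nhds 0. (g has_field_derivative g' s) (at s)"
    "(f' has_field_derivative 2 * c) (at 0)" "(g' has_field_derivative 2 * c') (at 0)"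
    "f 0 = a" "g 0 = a'" "f' 0 = b" "g' 0 = b'"
    using assms unfolding jet2_def by blast
  have "\<forall>\<^sub>F s in nhds 0. ((\<lambda>s. f s * g s) has_field_derivative f' s * g s + f s * g' s) (at s)"
    using fg(1,2) by eventually_elim (rule DERIV_cong[OF DERIV_mult], assumption+, simp)
  moreover have "((\<lambda>s. f' s * g s + f s * g' s) has_field_derivative 2 * (a * c' + b * b' + c * a')) (at 0)"
    using fg(1,2)[THEN eventually_nhds_x_imp_x] fg(3-)
    by (auto intro!: derivative_eq_intros simp: algebra_simps)
  ultimately show ?thesis
    unfolding jet2_def using fg
    by (intro exI[of _ "\<lambda>s. f' s * g s + f s * g' s"]) (simp add: algebra_simps)
qed

lemma jet2_poly:
  "jet2 (\<lambda>s. a0 + a1 * s + a2 * s^2 + a3 * s^3 + a4 * s^4) a0 a1 a2"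
  unfolding jet2_def
  by (intro exI[of _ "\<lambda>s. a1 + 2 * a2 * s + 3 * a3 * s^2 + 4 * a4 * s^3"] conjI always_eventually allI)
    (auto intro!: derivative_eq_intros simp: eval_nat_numeral)

lemma jet2_eventually_0:
  assumes "jet2 g a b c" "\<forall>\<^sub>F s in nhds 0. g s = 0"
  shows "a = 0 \<and> b = 0 \<and> c = 0"
proof -
  obtain g' where g': "\<forall>\<^sub>F s in nhds 0. (g has_field_derivative g' s) (at s)"
    "g 0 = a" "g' 0 = b" "(g' has_field_derivative 2 * c) (at 0)"
    using assms(1) unfolding jet2_def by blast
  have "\<forall>\<^sub>F s in nhds 0. g' s = 0"
  proof -
    have "\<forall>\<^sub>F s in nhds 0. \<forall>\<^sub>F t in nhds s. g t = 0"
      using assms(2) by (simp add: eventually_eventually)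
    with g'(1) show ?thesis
    proof eventually_elim
      case (elim s)
      then have "((\<lambda>_. 0) has_field_derivative g' s) (at s)"
        using DERIV_cong_ev[of s s g "\<lambda>_. 0" "g' s" "g' s"] by simp
      then show ?case using DERIV_unique DERIV_const by blast
    qed
  qed
  then have "((\<lambda>_. 0) has_field_derivative 2 * c) (at 0)" "g' 0 = 0"
    using DERIV_cong_ev[of 0 0 g' "\<lambda>_. 0" "2 * c" "2 * c"] g'(4) eventually_nhds_x_imp_x by auto
  then show ?thesis
    using eventually_nhds_x_imp_x[OF assms(2)] g'(2,3) DERIV_unique[OF _ DERIV_const] by fastforce
qed

text \<open>Functions of \<open>w\<close> alone.  Keeping them on the whole space, instead of on the hyperplane \<open>z = 0\<close>,
lets the calculus of directional derivatives apply unchanged.\<close>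

definition z_free :: "(complex^9 \<Rightarrow> complex) \<Rightarrow> bool" where
  "z_free F \<longleftrightarrow> (\<forall>z w. F (setz z w) = F w)"

lemma setz_setz [simp]: "setz a (setz b w) = setz a w"
  by (simp add: vec_eq_iff)

lemma setz_eq_add: "setz z w = w + axis 0 (z - w $ 0)"
  by (simp add: vec_eq_iff axis_def)

lemma setz_self [simp]: "setz (w $ 0) w = w"
  by (simp add: vec_eq_iff)

lemma cnjv_setz: "cnjv (setz z w) = setz (cnj z) (cnjv w)"
  by (simp add: vec_eq_iff)

lemma z_free_add_axis: "z_free F \<Longrightarrow> F (w + axis 0 c) = F w"
  using setz_eq_add[of "w $ 0 + c" w] unfolding z_free_def by (metis add_diff_cancel_left')

lemma z_free_dderiv:
  assumes "z_free F"
  shows "z_free (dderiv v F)"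
proof -
  have shift: "(F has_derivative f') (at (w + axis 0 c))" if "(F has_derivative f') (at w)" for f' w c
  proof -
    have "((\<lambda>x. x + axis 0 (- c)) has_derivative (\<lambda>v. v)) (at (w + axis 0 c))"
      using has_derivative_add[OF has_derivative_ident has_derivative_const] by simp
    moreover have "w + axis 0 c + axis 0 (- c) = w" by (simp add: vec_eq_iff axis_def)
    ultimately have "((\<lambda>x. F (x + axis 0 (- c))) has_derivative f') (at (w + axis 0 c))"
      using that has_derivative_compose[of "\<lambda>x. x + axis 0 (- c)" "\<lambda>v. v" "w + axis 0 c" UNIV F f']
      by (simp only:)
    then show ?thesis by (simp add: z_free_add_axis[OF assms])
  qed
  have "(F has_derivative f') (at (setz z w)) \<longleftrightarrow> (F has_derivative f') (at w)" for f' z w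
  proof
    show "(F has_derivative f') (at w) \<Longrightarrow> (F has_derivative f') (at (setz z w))"
      unfolding setz_eq_add by (rule shift)
    assume "(F has_derivative f') (at (setz z w))"
    from shift[OF this, of "w $ 0 - z"] show "(F has_derivative f') (at w)"
      using setz_eq_add[of "w $ 0" "setz z w"] by simp
  qed
  then show ?thesis unfolding z_free_def dderiv_def frechet_derivative_def by simp
qed

lemma z_free_dderiv_axis_0:
  assumes "z_free F" "holo_on F S" "w \<in> S"
  shows "dderiv (axis 0 c) F w = 0"
proof -
  have "((\<lambda>s. F (w + s *s axis 0 c)) has_field_derivative dderiv (axis 0 c) F (w + 0 *s axis 0 c)) (at 0)"
    using assms by (intro holo_on_chain[of F S]) (auto intro!: derivative_eq_intros)
  moreover have "F (w + s *s axis 0 c) = F w" for s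
  proof -
    have "s *s axis 0 c = (axis 0 (s * c) :: complex^9)" by (simp add: vec_eq_iff axis_def)
    then show ?thesis using z_free_add_axis[OF assms(1)] by metis
  qed
  ultimately show ?thesis using DERIV_unique[OF _ DERIV_const] by fastforce
qed

lemma bounded_linear_setz_0: "bounded_linear (setz 0)"
  by (rule bounded_linear_intro[where K = 1])
    (use norm_setz_le[of 0] in \<open>auto simp: vec_eq_iff\<close>)

lemma holo_on_setz_0:
  fixes f :: "complex^9 \<Rightarrow> complex" and v w :: "complex^9"
  assumes "holo_on f (ball 0 r)"
  shows "holo_on (\<lambda>w. f (setz 0 w)) (ball 0 r)"
    and dderiv_setz_0: "w \<in> ball 0 r \<Longrightarrow> dderiv v (\<lambda>w. f (setz 0 w)) w = dderiv (setz 0 v) f (setz 0 w)"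
proof -
  have in_ball: "setz 0 w \<in> ball 0 r" if "w \<in> ball 0 r" for w
    using that norm_setz_le[of 0 w] by simp
  have der: "((\<lambda>w. f (setz 0 w)) has_derivative (\<lambda>v. dderiv (setz 0 v) f (setz 0 w))) (at w)"
    if "w \<in> ball 0 r" for w
    using has_derivative_compose[OF bounded_linear_imp_has_derivative[OF bounded_linear_setz_0]
        holo_on_has_derivative[OF assms in_ball[OF that]]] .
  show "holo_on (\<lambda>w. f (setz 0 w)) (ball 0 r)"
  proof (rule holo_onI[OF der])
    fix w v :: "complex^9" and c assume "w \<in> ball 0 r"
    moreover have "setz 0 (c *s v) = c *s setz 0 v" by (simp add: vec_eq_iff)
    ultimately show "dderiv (setz 0 (c *s v)) f (setz 0 w) = c * dderiv (setz 0 v) f (setz 0 w)"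
      using dderiv_smult[OF assms in_ball] by simp
  qed
  show "dderiv v (\<lambda>w. f (setz 0 w)) w = dderiv (setz 0 v) f (setz 0 w)" if "w \<in> ball 0 r"
    using has_derivative_imp_dderiv[OF der[OF that]] .
qed

definition wvec :: "(9 \<Rightarrow> complex) \<Rightarrow> complex^9" where
  "wvec k = (\<chi> i. if i = 0 then 0 else k i)"

lemma wvec_nth [simp]: "wvec k $ i = (if i = 0 then 0 else k i)"
  by (simp add: wvec_def)

lemma setz_0_wvec: "setz 0 (wvec f) = wvec f"
  by (simp add: vec_eq_iff)

context quintic_model begin

lemma conj_pt_nth_0 [simp]: "conj_pt p s $ 0 = s"
  by (simp add: conj_pt_def)

lemma conj_pt_0: "conj_pt (setz z w) 0 = setz 0 w"
  by (simp add: conj_pt_def vec_eq_iff)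

lemma phi_s_DERIV: "(phi l z has_field_derivative phi_s l z s) (at s)"
  unfolding phi_def phi_s_def by (auto intro!: derivative_eq_intros simp: eval_nat_numeral)

lemma conj_pt_DERIV:
  "((\<lambda>s. conj_pt p s $ i) has_field_derivative (axis 0 1 - wvec (\<lambda>i. phi_s i (p $ 0) s)) $ i) (at s)"
proof (cases "i = 0")
  case True then show ?thesis by (simp add: axis_def)
next
  case False then show ?thesis
    by (auto simp: conj_pt_def axis_def intro!: derivative_eq_intros phi_s_DERIV)
qed

lemma eventually_conj_pt_in_ball:
  assumes "w \<in> ball 0 \<rho>"
  shows "\<forall>\<^sub>F s in nhds 0. conj_pt (setz z w) s \<in> ball 0 \<rho>"
proof -
  have "isCont (conj_pt (setz z w)) 0"
    unfolding continuous_at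
  proof (rule vec_tendstoI)
    show "((\<lambda>s. conj_pt (setz z w) s $ i) \<longlongrightarrow> conj_pt (setz z w) 0 $ i) (at 0)" for i
      using DERIV_isCont[OF conj_pt_DERIV, of 0 "setz z w" i] by (simp add: continuous_at)
  qed
  then have "(conj_pt (setz z w) \<longlongrightarrow> setz 0 w) (nhds 0)"
    using conj_pt_0 by (metis continuous_at tendsto_nhds_iff)
  moreover have "setz 0 w \<in> ball 0 \<rho>" using assms norm_setz_le[of 0 w] by simp
  ultimately show ?thesis using topological_tendstoD[OF _ open_ball] by blast
qed

text \<open>As a function of \<open>s\<close> the \<open>w\<close>-part of \<open>conj_pt (setz z w) s\<close> is
\<open>w - s U1 - s\<^sup>2 U2 - \<dots>\<close>, so this is the second-order Taylor formula along that curve.\<close>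

lemma jet2_z_free_along_conj_pt:
  assumes F: "z_free F" "holo_on F (ball 0 \<rho>)" and w: "w \<in> ball 0 \<rho>"
  defines "U1 \<equiv> \<lambda>z. wvec (\<lambda>i. k1 i z)" and "U2 \<equiv> \<lambda>z. wvec (\<lambda>i. k2 i z)"
  shows "jet2 (\<lambda>s. F (conj_pt (setz z w) s)) (F w) (- dderiv (U1 z) F w)
    (dderiv (U1 z) (dderiv (U1 z) F) w / 2 - dderiv (U2 z) F w)"
proof -
  let ?c = "conj_pt (setz z w)"
  define U3 where "U3 = wvec (\<lambda>i. k3 i z)"
  define U4 where "U4 = wvec (\<lambda>i. k4 i z)"
  define g' where "g' s = - (dderiv (U1 z) F (?c s) + 2 * s * dderiv (U2 z) F (?c s)
    + 3 * s^2 * dderiv U3 F (?c s) + 4 * s^3 * dderiv U4 F (?c s))" for s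
  have vel: "wvec (\<lambda>i. phi_s i z s) = U1 z + (2 * s) *s U2 z + (3 * s^2) *s U3 + (4 * s^3) *s U4" for s
    by (simp add: phi_s_def U1_def U2_def U3_def U4_def vec_eq_iff)
  have chain: "((\<lambda>s. G (?c s)) has_field_derivative
      - (dderiv (U1 z) G (?c s) + 2 * s * dderiv (U2 z) G (?c s) + 3 * s^2 * dderiv U3 G (?c s) + 4 * s^3 * dderiv U4 G (?c s))) (at s)"
    if "z_free G" "holo_on G (ball 0 \<rho>)" "?c s \<in> ball 0 \<rho>" for G s
  proof -
    note dir = dderiv_dir_add[OF that(2,3)] dderiv_dir_diff[OF that(2,3)] dderiv_smult[OF that(2,3)]
    have "((\<lambda>s. G (?c s)) has_field_derivative dderiv (axis 0 1 - wvec (\<lambda>i. phi_s i (setz z w $ 0) s)) G (?c s)) (at s)"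
      by (rule holo_on_chain[OF that(2,3) conj_pt_DERIV])
    then show ?thesis
      by (simp add: vel dir z_free_dderiv_axis_0[OF that])
  qed
  have c0: "G (?c 0) = G w" if "z_free G" for G
    using that unfolding conj_pt_0 z_free_def by simp
  have w0: "?c 0 \<in> ball 0 \<rho>" using eventually_nhds_x_imp_x[OF eventually_conj_pt_in_ball[OF w]] .
  have "\<forall>\<^sub>F s in nhds 0. ((\<lambda>s. F (?c s)) has_field_derivative g' s) (at s)"
    using eventually_conj_pt_in_ball[OF w, of z] unfolding g'_def
    by eventually_elim (rule chain[OF F])
  moreover have "(g' has_field_derivative 2 * (dderiv (U1 z) (dderiv (U1 z) F) w / 2 - dderiv (U2 z) F w)) (at 0)"
  proof -
    have D: "((\<lambda>s. dderiv u F (?c s)) has_field_derivative - dderiv (U1 z) (dderiv u F) w) (at 0)" for u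
      using chain[OF z_free_dderiv[OF F(1)] holo_on_dderiv[OF open_ball F(2)] w0, of u]
      by (simp add: c0[OF z_free_dderiv[OF z_free_dderiv[OF F(1)]]])
    show ?thesis
      unfolding g'_def by (rule derivative_eq_intros D refl)+ (simp add: c0[OF z_free_dderiv[OF F(1)]])
  qed
  ultimately show ?thesis
    unfolding jet2_def using c0[OF F(1)] c0[OF z_free_dderiv[OF F(1)]]
    by (intro exI[of _ g']) (simp add: g'_def)
qed

text \<open>For a function that also depends on \<open>z\<close> the curve contributes \<open>\<partial>/\<partial>z\<close>, because the first
component of \<open>conj_pt p s\<close> is \<open>s\<close> itself.\<close>

lemma jet2_along_conj_pt:
  assumes F: "holo_on F (ball 0 \<rho>)" and w: "w \<in> ball 0 \<rho>"
  shows "\<exists>j. jet2 (\<lambda>s. F (conj_pt (setz z w) s)) (F (setz 0 w))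
    (dderiv (axis 0 1) F (setz 0 w) - dderiv (wvec (\<lambda>i. k1 i z)) F (setz 0 w)) j"
proof -
  let ?c = "conj_pt (setz z w)" and ?g = "\<lambda>s. F (conj_pt (setz z w) s)"
  define V where "V s = axis 0 1 - wvec (\<lambda>i. phi_s i z s)" for s
  have w0: "setz 0 w \<in> ball 0 \<rho>" using w norm_setz_le[of 0 w] by simp
  obtain e where e: "e > 0" "\<And>s. s \<in> ball 0 e \<Longrightarrow> ?c s \<in> ball 0 \<rho>"
    using eventually_conj_pt_in_ball[OF w, of z] unfolding eventually_nhds_metric
    by (metis dist_commute mem_ball)
  have D: "(?g has_field_derivative dderiv (V s) F (?c s)) (at s)" if "s \<in> ball 0 e" for s
    using holo_on_chain[OF F e(2)[OF that] conj_pt_DERIV] by (simp add: V_def)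
  then have "?g holomorphic_on ball 0 e"
    by (meson holomorphic_onI field_differentiable_at_within field_differentiable_def)
  then have "deriv ?g holomorphic_on ball 0 e" by (intro holomorphic_deriv) auto
  then have D2: "(deriv ?g has_field_derivative deriv (deriv ?g) 0) (at 0)"
    using e(1) by (intro holomorphic_derivI[of _ "ball 0 e"]) auto
  have "\<forall>\<^sub>F s in nhds 0. s \<in> ball 0 e" using e(1) by (intro eventually_nhds_in_open) auto
  then have "\<forall>\<^sub>F s in nhds 0. (?g has_field_derivative deriv ?g s) (at s)"
    by eventually_elim (metis D DERIV_imp_deriv)
  moreover have "deriv ?g 0 = dderiv (axis 0 1) F (setz 0 w) - dderiv (wvec (\<lambda>i. k1 i z)) F (setz 0 w)"
    using DERIV_imp_deriv[OF D[of 0]] e(1) dderiv_dir_diff[OF F w0]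
    by (simp add: V_def conj_pt_0 phi_s_def)
  ultimately show ?thesis
    unfolding jet2_def using D2
    by (intro exI[of _ "deriv (deriv ?g) 0 / 2"] exI[of _ "deriv ?g"]) (simp add: conj_pt_0)
qed

end

section \<open>The coefficients of an infinitesimal automorphism\<close>

text \<open>A polarized solution on a ball.  The radius \<open>2\<rho>\<close> is chosen so that \<open>setz z w\<close> stays inside for
\<open>norm w < \<rho>\<close> and \<open>norm z < \<rho>\<close>.\<close>

locale model_solution = quintic_model +
  fixes X :: "9 vfield" and \<rho> :: real
  assumes \<rho>_pos: "\<rho> > 0"
    and hol: "\<And>l. holo_on (\<lambda>p. X p $ l) (ball 0 (2 * \<rho>))"
    and pol: "\<And>p s l. norm p < 2 * \<rho> \<Longrightarrow> norm s < 2 * \<rho> \<Longrightarrow> l \<noteq> 0 \<Longrightarrow>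
      X p $ l - star (\<lambda>p. X p $ l) (conj_pt p s) - phi_z l (p $ 0) s * X p $ 0
        - phi_s l (p $ 0) s * star (\<lambda>p. X p $ 0) (conj_pt p s) = 0"
begin

text \<open>In terms of \<open>X = Z \<partial>\<^sub>z + \<Sum> W\<^sub>l \<partial>\<^sub>w\<^sub>l\<close>: \<open>A l\<close> and \<open>C\<close> are \<open>W\<^sub>l\<close> and \<open>Z\<close> on the hyperplane \<open>z = 0\<close>,
\<open>Ks\<close> is \<open>\<partial>Z/\<partial>z\<close> there, and \<open>B\<close>, \<open>K\<close> are the reflections of \<open>C\<close>, \<open>Ks\<close>.\<close>

definition A where "A l w = X (setz 0 w) $ l"
definition C where "C w = X (setz 0 w) $ 0"
definition B where "B w = star (\<lambda>p. X p $ 0) (setz 0 w)"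
definition Ks where "Ks w = dderiv (axis 0 1) (\<lambda>p. X p $ 0) (setz 0 w)"
definition K where "K w = dderiv (axis 0 1) (star (\<lambda>p. X p $ 0)) (setz 0 w)"

lemma norm_setz_less: "w \<in> ball 0 \<rho> \<Longrightarrow> norm z < \<rho> \<Longrightarrow> norm (setz z w) < 2 * \<rho>"
  using norm_setz_le[of z w] by simp

lemma ball_subset: "ball 0 \<rho> \<subseteq> ball 0 (2 * \<rho>)"
  using \<rho>_pos by auto

lemma z_free_data: "z_free (A l)" "z_free B" "z_free C" "z_free K" "z_free Ks"
  by (simp_all add: z_free_def A_def B_def C_def K_def Ks_def)

lemma holo_on_data: "holo_on (A l) (ball 0 \<rho>)" "holo_on B (ball 0 \<rho>)" "holo_on C (ball 0 \<rho>)"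
  "holo_on K (ball 0 \<rho>)" "holo_on Ks (ball 0 \<rho>)"
  unfolding A_def[abs_def] B_def[abs_def] C_def[abs_def] K_def[abs_def] Ks_def[abs_def]
  using hol by (auto intro!: holo_on_subset[OF holo_on_setz_0(1) ball_subset] holo_on_dderiv[OF open_ball] holo_on_star)

lemma star_C: "star C = B"
  by (simp add: fun_eq_iff star_def C_def B_def cnjv_setz)

lemma star_B: "star B = C"
  using star_C star_star by metis

lemma star_K:
  assumes "w \<in> ball 0 \<rho>"
  shows "star K w = Ks w"
proof -
  have "setz 0 (cnjv w) \<in> ball 0 (2 * \<rho>)"
    using norm_setz_less[of "cnjv w" 0] assms \<rho>_pos by simp
  from dderiv_star[OF hol[of 0] this, of "axis 0 1"] show ?thesis
    by (simp add: star_def[of K] K_def Ks_def star_def[of "dderiv _ _"] cnjv_axis cnjv_setz)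
qed

text \<open>The polarized equation at \<open>z = s = 0\<close>, where all terms with \<open>\<phi>\<^sub>l\<close> vanish.\<close>

lemma star_A:
  assumes "w \<in> ball 0 \<rho>" "l \<noteq> 0"
  shows "star (A l) w = A l w"
  using pol[of "setz 0 w" 0 l] norm_setz_less[OF assms(1), of 0] assms \<rho>_pos
  by (simp add: star_def A_def cnjv_setz conj_pt_0 phi_z_def phi_s_def k1_def)

text \<open>The polarized equation at \<open>s = 0\<close>.  All \<open>z\<close>-dependence of the components \<open>W\<^sub>l\<close> is explicit
from here on.\<close>

lemma X_eq:
  assumes "w \<in> ball 0 \<rho>" "norm z < \<rho>" "l \<noteq> 0"
  shows "X (setz z w) $ l = A l w + k1 l z * B w"
  using pol[of "setz z w" 0 l] norm_setz_less[OF assms(1,2)] assms \<rho>_pos star_A[OF assms(1,3)]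
  by (simp add: star_def A_def B_def cnjv_setz conj_pt_0 phi_z_def phi_s_def diff_eq_eq add.commute)

lemma star_X_eq:
  assumes "w \<in> ball 0 \<rho>" "norm s < \<rho>" "l \<noteq> 0"
  shows "star (\<lambda>p. X p $ l) (setz s w) = A l w + cnj (k1 l (cnj s)) * C w"
  using X_eq[of "cnjv w" "cnj s" l] assms star_A[of w l] star_B
  by (simp add: star_def[of "\<lambda>p. X p $ l"] cnjv_setz) (metis star_def)

abbreviation U1 where "U1 z \<equiv> wvec (\<lambda>i. k1 i z)"
abbreviation U2 where "U2 z \<equiv> wvec (\<lambda>i. k2 i z)"

text \<open>The coefficients of \<open>s\<close> and \<open>s\<^sup>2\<close> in the polarized equation.  The number \<open>j\<close> is the second Taylor
coefficient of the reflection of \<open>Z\<close> along the curve; it is the same for all \<open>l\<close> and therefore cancels in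
combinations of equations in which the terms \<open>k1 l z\<close> cancel.\<close>

lemma jet_equations:
  assumes w: "w \<in> ball 0 \<rho>" and z: "norm z < \<rho>"
  shows "\<exists>j. \<forall>l. l \<noteq> 0 \<longrightarrow>
     dderiv (U1 z) (A l) w - cnj (a11 l) * C w - k1' l z * X (setz z w) $ 0 - 2 * k2 l z * B w
       - k1 l z * (K w - dderiv (U1 z) B w) = 0 \<and>
     dderiv (U2 z) (A l) w - dderiv (U1 z) (dderiv (U1 z) (A l)) w / 2
       - (cnj (a21 l) * C w - cnj (a11 l) * dderiv (U1 z) C w) - k2' l z * X (setz z w) $ 0
       - (k1 l z * j + 2 * k2 l z * (K w - dderiv (U1 z) B w) + 3 * k3 l z * B w) = 0"
proof -
  let ?Z = "\<lambda>p. X p $ 0" and ?c = "conj_pt (setz z w)"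
  have cZ: "holo_on (star ?Z) (ball 0 (2 * \<rho>))" by (rule holo_on_star[OF hol])
  have w2: "w \<in> ball 0 (2 * \<rho>)" using w ball_subset by blast
  obtain j where "jet2 (\<lambda>s. star ?Z (?c s)) (star ?Z (setz 0 w))
      (dderiv (axis 0 1) (star ?Z) (setz 0 w) - dderiv (U1 z) (star ?Z) (setz 0 w)) j"
    using jet2_along_conj_pt[OF cZ w2] by blast
  moreover have "dderiv (U1 z) (star ?Z) (setz 0 w) = dderiv (U1 z) B w"
    using dderiv_setz_0[OF cZ w2] unfolding B_def[abs_def] by (simp add: setz_0_wvec)
  ultimately have jZ: "jet2 (\<lambda>s. star ?Z (?c s)) (B w) (K w - dderiv (U1 z) B w) j"
    by (simp add: B_def K_def)
  have eq: "dderiv (U1 z) (A l) w - cnj (a11 l) * C w - k1' l z * X (setz z w) $ 0 - 2 * k2 l z * B w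
       - k1 l z * (K w - dderiv (U1 z) B w) = 0 \<and>
     dderiv (U2 z) (A l) w - dderiv (U1 z) (dderiv (U1 z) (A l)) w / 2
       - (cnj (a21 l) * C w - cnj (a11 l) * dderiv (U1 z) C w) - k2' l z * X (setz z w) $ 0
       - (k1 l z * j + 2 * k2 l z * (K w - dderiv (U1 z) B w) + 3 * k3 l z * B w) = 0"
    if l: "l \<noteq> 0" for l
  proof -
    \<comment> \<open>On the curve the reflection of \<open>W\<^sub>l\<close> is explicit, by the equation at \<open>s = 0\<close>.\<close>
    define h where "h s = X (setz z w) $ l - (A l (?c s) + cnj (k1 l (cnj s)) * C (?c s))
      - phi_z l z s * ?Z (setz z w) - phi_s l z s * star ?Z (?c s)" for s
    have "\<forall>\<^sub>F s in nhds 0. s \<in> ball (0::complex) \<rho>"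
      using \<rho>_pos by (intro eventually_nhds_in_open) auto
    then have "\<forall>\<^sub>F s in nhds 0. h s = 0"
      using eventually_conj_pt_in_ball[OF w, of z]
    proof eventually_elim
      case (elim s)
      have "star (\<lambda>p. X p $ l) (?c s) = A l (?c s) + cnj (k1 l (cnj s)) * C (?c s)"
        using star_X_eq[OF elim(2) _ l, of s] elim(1) setz_self[of "?c s"] by simp
      then show ?case
        using pol[OF norm_setz_less[OF w z] _ l, of s] elim(1) \<rho>_pos by (simp add: h_def)
    qed
    moreover
    have "(\<lambda>s. cnj (k1 l (cnj s))) = (\<lambda>s. 0 + cnj (a11 l) * s + cnj (a21 l) * s^2 + cnj (a31 l) * s^3 + cnj (a41 l) * s^4)"
      by (simp add: k1_def)
    then have jk: "jet2 (\<lambda>s. cnj (k1 l (cnj s))) 0 (cnj (a11 l)) (cnj (a21 l))"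
      using jet2_poly[of 0 "cnj (a11 l)"] by (simp only:)
    have jz: "jet2 (phi_z l z) 0 (k1' l z) (k2' l z)"
      using jet2_poly[of 0] unfolding phi_z_def[abs_def] by simp
    have js: "jet2 (phi_s l z) (k1 l z) (2 * k2 l z) (3 * k3 l z)"
      using jet2_poly[of _ _ _ _ 0] unfolding phi_s_def[abs_def] by simp
    have jA: "jet2 (\<lambda>s. A l (?c s)) (A l w) (- dderiv (U1 z) (A l) w) (dderiv (U1 z) (dderiv (U1 z) (A l)) w / 2 - dderiv (U2 z) (A l) w)"
      and jC: "jet2 (\<lambda>s. C (?c s)) (C w) (- dderiv (U1 z) C w) (dderiv (U1 z) (dderiv (U1 z) C) w / 2 - dderiv (U2 z) C w)"
      by (rule jet2_z_free_along_conj_pt[OF z_free_data(1) holo_on_data(1) w]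
          jet2_z_free_along_conj_pt[OF z_free_data(3) holo_on_data(3) w])+
    note jet2_diff[OF jet2_diff[OF jet2_diff[OF jet2_const[of "X (setz z w) $ l"] jet2_add[OF jA jet2_mult[OF jk jC]]]
        jet2_mult[OF jz jet2_const[of "?Z (setz z w)"]]] jet2_mult[OF js jZ]]
    ultimately have *: "- (- dderiv (U1 z) (A l) w + cnj (a11 l) * C w) - k1' l z * ?Z (setz z w)
        - (k1 l z * (K w - dderiv (U1 z) B w) + 2 * k2 l z * B w) = 0"
      "- (dderiv (U1 z) (dderiv (U1 z) (A l)) w / 2 - dderiv (U2 z) (A l) w
          + (cnj (a11 l) * - dderiv (U1 z) C w + cnj (a21 l) * C w)) - k2' l z * ?Z (setz z w)
        - (k1 l z * j + 2 * k2 l z * (K w - dderiv (U1 z) B w) + 3 * k3 l z * B w) = 0"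
      using jet2_eventually_0[of h] unfolding h_def[abs_def] by force+
    from * show ?thesis by (simp add: algebra_simps)
  qed
  then show ?thesis by blast
qed

end

section \<open>First-order equations, sorted by powers of z\<close>

lemma poly_zero_near_0:
  fixes P :: "complex poly"
  assumes "\<rho> > 0" "\<And>z. norm z < \<rho> \<Longrightarrow> poly P z = 0"
  shows "P = 0"
proof (rule ccontr)
  assume "P \<noteq> 0"
  then have "finite {z. poly P z = 0}" by (rule poly_roots_finite)
  moreover have "ball 0 \<rho> \<subseteq> {z. poly P z = 0}" using assms(2) by auto
  ultimately have "finite (ball (0::complex) \<rho>)" using finite_subset by blast
  then show False using assms(1) finite_imp_not_open[of "ball (0::complex) \<rho>"] by simp
qed

lemma dderiv_lincomb:
  assumes "open S" "\<And>w. w \<in> S \<Longrightarrow> F w = c * G w + e * H w" "holo_on G S" "holo_on H S" "w \<in> S"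
  shows "dderiv v F w = c * dderiv v G w + e * dderiv v H w"
  using dderiv_cong[OF assms(1,2,5)] dderiv_add[OF holo_on_cmult[OF assms(3)] holo_on_cmult[OF assms(4)] assms(5)]
    dderiv_cmult[OF assms(3,5)] dderiv_cmult[OF assms(4,5)] by simp

context model_solution begin

abbreviation "S \<equiv> ball (0 :: complex^9) \<rho>"
text \<open>The vectors along which the equations differentiate: \<open>U1 z = z v1 + z\<^sup>2 v2 + z\<^sup>3 v3 + z\<^sup>4 v4\<close> and
\<open>U2 z = - z cnj v2 + z\<^sup>2 n2 + z\<^sup>3 n3\<close>.\<close>

abbreviation "v1 \<equiv> wvec a11"
abbreviation "v2 \<equiv> wvec a21"
abbreviation "v3 \<equiv> wvec a31"
abbreviation "v4 \<equiv> wvec a41"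
abbreviation "n2 \<equiv> wvec a22"
abbreviation "n3 \<equiv> wvec a32"

text \<open>The complex combinations belonging to \<open>w\<^sub>2 \<plusminus> \<i> w\<^sub>3\<close> and \<open>w\<^sub>4 \<plusminus> \<i> w\<^sub>5\<close>.  The defining polynomials of these
are the single monomials \<open>4 \<i> z\<^sup>2 s\<close>, \<open>4 \<i> z s\<^sup>2\<close>, \<open>4 \<i> z\<^sup>3 s\<close> and \<open>4 \<i> z s\<^sup>3\<close>, which makes the equations sparse.\<close>

definition A23p where "A23p w = A 2 w + \<i> * A 3 w"
definition A23m where "A23m w = A 2 w - \<i> * A 3 w"
definition A45p where "A45p w = A 4 w + \<i> * A 5 w"
definition A45m where "A45m w = A 4 w - \<i> * A 5 w"
definition L where "L = dderiv (axis 1 1) (A 1)"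

lemmas PM_defs = A23p_def[abs_def] A23m_def[abs_def] A45p_def[abs_def] A45m_def[abs_def]

lemma holo_on_PM: "holo_on A23p S" "holo_on A23m S" "holo_on A45p S" "holo_on A45m S" "holo_on L S"
  unfolding PM_defs L_def
  by (intro holo_on_add holo_on_diff holo_on_cmult holo_on_data holo_on_dderiv open_ball)+

lemma dderiv_PM:
  assumes "w \<in> S"
  shows "dderiv v A23p w = dderiv v (A 2) w + \<i> * dderiv v (A 3) w" "dderiv v A23m w = dderiv v (A 2) w - \<i> * dderiv v (A 3) w"
    "dderiv v A45p w = dderiv v (A 4) w + \<i> * dderiv v (A 5) w" "dderiv v A45m w = dderiv v (A 4) w - \<i> * dderiv v (A 5) w"
  unfolding PM_defs
  by (simp_all add: dderiv_add[OF _ _ assms] dderiv_diff[OF _ _ assms] dderiv_cmult[OF _ assms] holo_on_data holo_on_cmult)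

lemma star_PM:
  assumes "w \<in> S"
  shows "star A23p w = A23m w" "star A23m w = A23p w" "star A45p w = A45m w" "star A45m w = A45p w" "star L w = L w"
proof -
  have A: "cnj (A l (cnjv w)) = A l w" if "l \<noteq> 0" for l
    using star_A[OF assms that] by (simp add: star_def)
  show "star A23p w = A23m w" "star A23m w = A23p w" "star A45p w = A45m w" "star A45m w = A45p w"
    by (simp_all add: star_def PM_defs A)
  have "dderiv (axis 1 1) (star (A 1)) w = star (dderiv (axis 1 1) (A 1)) w"
    using dderiv_star[OF holo_on_data(1) assms, of "axis 1 1"] by (simp add: cnjv_axis)
  moreover have "dderiv (axis 1 1) (star (A 1)) w = dderiv (axis 1 1) (A 1) w"
    using star_A by (intro dderiv_cong[OF open_ball _ assms]) auto
  ultimately show "star L w = L w" by (simp add: L_def)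
qed

lemma dderiv_U1:
  assumes "holo_on F S" "w \<in> S"
  shows "dderiv (U1 z) F w = z * dderiv v1 F w + z^2 * dderiv v2 F w + z^3 * dderiv v3 F w + z^4 * dderiv v4 F w"
proof -
  have "U1 z = z *s v1 + z^2 *s v2 + z^3 *s v3 + z^4 *s v4"
    by (simp add: vec_eq_iff k1_def mult.commute)
  then show ?thesis by (simp add: dderiv_dir_add[OF assms] dderiv_smult[OF assms])
qed

lemma dderiv_U2:
  assumes "holo_on F S" "w \<in> S"
  shows "dderiv (U2 z) F w = - z * dderiv (cnjv v2) F w + z^2 * dderiv n2 F w + z^3 * dderiv n3 F w"
proof -
  have "U2 z = (- z) *s cnjv v2 + z^2 *s n2 + z^3 *s n3"
    by (simp add: vec_eq_iff k2_def mult.commute)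
  then show ?thesis by (simp only: dderiv_dir_add[OF assms] dderiv_smult[OF assms])
qed

lemma dderiv_v1_A1: "w \<in> S \<Longrightarrow> dderiv v1 (A 1) w = 2 * \<i> * L w"
proof -
  assume w: "w \<in> S"
  have "v1 = (2 * \<i>) *s axis 1 1" by (simp add: vec_eq_iff a11_def axis_def)
  then show ?thesis by (simp only: dderiv_smult[OF holo_on_data(1) w] L_def)
qed

text \<open>The coefficient of \<open>s\<close>, equation by equation.  The one for \<open>w\<^sub>1\<close> expresses \<open>Z\<close> through the other
unknowns, as a polynomial in \<open>z\<close>.\<close>

lemma first_order:
  assumes w: "w \<in> S" and z: "norm z < \<rho>"
  defines "Z \<equiv> X (setz z w) $ 0" and "T \<equiv> K w - dderiv (U1 z) B w"
  shows "Z = C w - \<i> / 2 * dderiv (U1 z) (A 1) w - z * T"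
    "dderiv (U1 z) (A 2) w = 4 * \<i> * z * Z + 4 * \<i> * z * B w + 2 * \<i> * z^2 * T"
    "dderiv (U1 z) (A 3) w = 4 * z * Z - 4 * z * B w + 2 * z^2 * T"
    "dderiv (U1 z) (A 4) w = 6 * \<i> * z^2 * Z + 2 * \<i> * z^3 * T"
    "dderiv (U1 z) (A 5) w = 6 * z^2 * Z + 2 * z^3 * T"
    "dderiv (U1 z) (A 6) w = 4 * \<i> * z^2 * B w"
    "l \<in> {7, 8} \<Longrightarrow> dderiv (U1 z) (A l) w = 4 * a41 l * z^3 * Z + 2 * a32 l * z^3 * B w + a41 l * z^4 * T"
proof -
  have J: "dderiv (U1 z) (A l) w - cnj (a11 l) * C w - k1' l z * Z - 2 * k2 l z * B w - k1 l z * T = 0"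
    if "l \<noteq> 0" for l
    using jet_equations[OF w z] that unfolding Z_def T_def by blast
  note d = k_defs a11_def a21_def a31_def a22_def a41_support a32_support algebra_simps
  show "Z = C w - \<i> / 2 * dderiv (U1 z) (A 1) w - z * T"
  proof -
    have "dderiv (U1 z) (A 1) w = 2 * \<i> * (Z - C w + z * T)"
      using J[of 1] by (simp add: d)
    then show ?thesis by (simp only:) (simp add: algebra_simps)
  qed
  show "dderiv (U1 z) (A 2) w = 4 * \<i> * z * Z + 4 * \<i> * z * B w + 2 * \<i> * z^2 * T"
    using J[of 2] by (simp add: d)
  show "dderiv (U1 z) (A 3) w = 4 * z * Z - 4 * z * B w + 2 * z^2 * T"
    using J[of 3] by (simp add: d)
  show "dderiv (U1 z) (A 4) w = 6 * \<i> * z^2 * Z + 2 * \<i> * z^3 * T"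
    using J[of 4] by (simp add: d)
  show "dderiv (U1 z) (A 5) w = 6 * z^2 * Z + 2 * z^3 * T"
    using J[of 5] by (simp add: d)
  show "dderiv (U1 z) (A 6) w = 4 * \<i> * z^2 * B w"
    using J[of 6] by (simp add: d)
  show "dderiv (U1 z) (A l) w = 4 * a41 l * z^3 * Z + 2 * a32 l * z^3 * B w + a41 l * z^4 * T" if "l \<in> {7, 8}"
    using J[of l] that by (auto simp: d)
qed

lemma first_order_PM:
  assumes w: "w \<in> S" and z: "norm z < \<rho>"
  shows "dderiv (U1 z) A45m w = 0" "dderiv (U1 z) A23m w = 8 * \<i> * z * B w"
    "dderiv (U1 z) A45p w = 12 * \<i> * z^2 * C w + 6 * z^2 * dderiv (U1 z) (A 1) w - 8 * \<i> * z^3 * (K w - dderiv (U1 z) B w)"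
    "dderiv (U1 z) A23p w = 8 * \<i> * z * C w + 4 * z * dderiv (U1 z) (A 1) w - 4 * \<i> * z^2 * (K w - dderiv (U1 z) B w)"
    "l \<in> {7, 8} \<Longrightarrow> dderiv (U1 z) (A l) w = 4 * a41 l * z^3 * C w - 2 * \<i> * a41 l * z^3 * dderiv (U1 z) (A 1) w
       + 2 * a32 l * z^3 * B w - 3 * a41 l * z^4 * (K w - dderiv (U1 z) B w)"
  by (simp_all only: dderiv_PM[OF w] first_order(2-)[OF w z] first_order(1)[OF w z])
    (simp_all add: algebra_simps eval_nat_numeral)

text \<open>From here on coefficients of powers of \<open>z\<close> are compared.  The function \<open>A45m\<close> is the most
restricted unknown: the polynomial \<open>4 \<i> z s\<^sup>3\<close> has no term of order one in \<open>s\<close>.\<close>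

lemma D_A45m:
  assumes w: "w \<in> S"
  shows "dderiv v1 A45m w = 0" "dderiv v2 A45m w = 0" "dderiv v3 A45m w = 0" "dderiv v4 A45m w = 0"
proof -
  have "[:0, dderiv v1 A45m w, dderiv v2 A45m w, dderiv v3 A45m w, dderiv v4 A45m w:] = 0"
    using first_order_PM(1)[OF w]
    by (intro poly_zero_near_0[OF \<rho>_pos]) (simp add: dderiv_U1[OF holo_on_PM(4) w] algebra_simps eval_nat_numeral)
  then show "dderiv v1 A45m w = 0" "dderiv v2 A45m w = 0" "dderiv v3 A45m w = 0" "dderiv v4 A45m w = 0" by simp_all
qed

lemma D_A23m:
  assumes w: "w \<in> S"
  shows "dderiv v1 A23m w = 8 * \<i> * B w" "dderiv v2 A23m w = 0" "dderiv v3 A23m w = 0" "dderiv v4 A23m w = 0"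
proof -
  have "[:0, dderiv v1 A23m w - 8 * \<i> * B w, dderiv v2 A23m w, dderiv v3 A23m w, dderiv v4 A23m w:] = 0"
    using first_order_PM(2)[OF w]
    by (intro poly_zero_near_0[OF \<rho>_pos]) (simp add: dderiv_U1[OF holo_on_PM(2) w] algebra_simps eval_nat_numeral)
  then show "dderiv v1 A23m w = 8 * \<i> * B w" "dderiv v2 A23m w = 0" "dderiv v3 A23m w = 0" "dderiv v4 A23m w = 0" by simp_all
qed

lemma D_A6:
  assumes w: "w \<in> S"
  shows "dderiv v2 (A 6) w = 4 * \<i> * B w"
proof -
  have "[:0, dderiv v1 (A 6) w, dderiv v2 (A 6) w - 4 * \<i> * B w, dderiv v3 (A 6) w, dderiv v4 (A 6) w:] = 0"
    using first_order(6)[OF w]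
    by (intro poly_zero_near_0[OF \<rho>_pos]) (simp add: dderiv_U1[OF holo_on_data(1) w] algebra_simps eval_nat_numeral)
  then show ?thesis by simp
qed

lemma D_A45p:
  assumes w: "w \<in> S"
  shows "dderiv v1 A45p w = 0" "dderiv v2 A45p w = 12 * \<i> * C w" "dderiv v3 A45p w = 12 * \<i> * L w - 8 * \<i> * K w"
    "dderiv v4 A45p w = 6 * dderiv v2 (A 1) w + 8 * \<i> * dderiv v1 B w"
    "6 * dderiv v3 (A 1) w + 8 * \<i> * dderiv v2 B w = 0" "6 * dderiv v4 (A 1) w + 8 * \<i> * dderiv v3 B w = 0"
proof -
  have "[:0, dderiv v1 A45p w, dderiv v2 A45p w - 12 * \<i> * C w, dderiv v3 A45p w - (12 * \<i> * L w - 8 * \<i> * K w),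
      dderiv v4 A45p w - (6 * dderiv v2 (A 1) w + 8 * \<i> * dderiv v1 B w), - (6 * dderiv v3 (A 1) w + 8 * \<i> * dderiv v2 B w),
      - (6 * dderiv v4 (A 1) w + 8 * \<i> * dderiv v3 B w), - 8 * \<i> * dderiv v4 B w:] = 0"
    using first_order_PM(3)[OF w]
    by (intro poly_zero_near_0[OF \<rho>_pos])
      (simp add: dderiv_U1[OF holo_on_PM(3) w] dderiv_U1[OF holo_on_data(1) w] dderiv_U1[OF holo_on_data(2) w] dderiv_v1_A1[OF w]
        algebra_simps eval_nat_numeral)
  then show "dderiv v1 A45p w = 0" "dderiv v2 A45p w = 12 * \<i> * C w" "dderiv v3 A45p w = 12 * \<i> * L w - 8 * \<i> * K w"
    "dderiv v4 A45p w = 6 * dderiv v2 (A 1) w + 8 * \<i> * dderiv v1 B w"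
    "6 * dderiv v3 (A 1) w + 8 * \<i> * dderiv v2 B w = 0" "6 * dderiv v4 (A 1) w + 8 * \<i> * dderiv v3 B w = 0"
    unfolding pCons_eq_0_iff right_minus_eq neg_equal_0_iff_equal by blast+
qed

lemma D_A23p:
  assumes w: "w \<in> S"
  shows "dderiv v2 A23p w = 8 * \<i> * L w - 4 * \<i> * K w" "dderiv v4 A23p w = 4 * dderiv v3 (A 1) w + 4 * \<i> * dderiv v2 B w"
proof -
  have "[:0, dderiv v1 A23p w - 8 * \<i> * C w, dderiv v2 A23p w - (8 * \<i> * L w - 4 * \<i> * K w),
      dderiv v3 A23p w - 4 * dderiv v2 (A 1) w - 4 * \<i> * dderiv v1 B w, dderiv v4 A23p w - (4 * dderiv v3 (A 1) w + 4 * \<i> * dderiv v2 B w),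
      - 4 * dderiv v4 (A 1) w - 4 * \<i> * dderiv v3 B w, - 4 * \<i> * dderiv v4 B w:] = 0"
    using first_order_PM(4)[OF w]
    by (intro poly_zero_near_0[OF \<rho>_pos])
      (simp add: dderiv_U1[OF holo_on_PM(1) w] dderiv_U1[OF holo_on_data(1) w] dderiv_U1[OF holo_on_data(2) w] dderiv_v1_A1[OF w]
        algebra_simps eval_nat_numeral)
  then show "dderiv v2 A23p w = 8 * \<i> * L w - 4 * \<i> * K w" "dderiv v4 A23p w = 4 * dderiv v3 (A 1) w + 4 * \<i> * dderiv v2 B w"
    unfolding pCons_eq_0_iff right_minus_eq neg_equal_0_iff_equal by blast+
qed

lemma D_A78:
  assumes w: "w \<in> S" and l: "l \<in> {7, 8}"
  shows "dderiv v4 (A l) w = a41 l * (4 * L w - 3 * K w)" "a41 l * (2 * \<i> * dderiv v2 (A 1) w - 3 * dderiv v1 B w) = 0"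
proof -
  have "[:0, dderiv v1 (A l) w, dderiv v2 (A l) w, dderiv v3 (A l) w - 4 * a41 l * C w - 2 * a32 l * B w,
      dderiv v4 (A l) w - a41 l * (4 * L w - 3 * K w), a41 l * (2 * \<i> * dderiv v2 (A 1) w - 3 * dderiv v1 B w),
      a41 l * (2 * \<i> * dderiv v3 (A 1) w - 3 * dderiv v2 B w), a41 l * (2 * \<i> * dderiv v4 (A 1) w - 3 * dderiv v3 B w),
      - 3 * a41 l * dderiv v4 B w:] = 0"
    using first_order_PM(5)[OF w _ l]
    by (intro poly_zero_near_0[OF \<rho>_pos])
      (simp add: dderiv_U1[OF holo_on_data(1) w] dderiv_U1[OF holo_on_data(2) w] dderiv_v1_A1[OF w]
        algebra_simps eval_nat_numeral)
  then show "dderiv v4 (A l) w = a41 l * (4 * L w - 3 * K w)" "a41 l * (2 * \<i> * dderiv v2 (A 1) w - 3 * dderiv v1 B w) = 0"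
    unfolding pCons_eq_0_iff right_minus_eq neg_equal_0_iff_equal by blast+
qed

end

section \<open>Rigidity\<close>

context model_solution begin

text \<open>Constant-coefficient vector fields commute, so the relation is inherited by all derivatives of
\<open>F\<close>; this is how an equation for one unknown restricts another.\<close>

definition kills :: "complex^9 \<Rightarrow> (complex^9 \<Rightarrow> complex) \<Rightarrow> bool" where
  "kills v F \<longleftrightarrow> (\<forall>w\<in>S. dderiv v F w = 0)"

lemma killsI: "(\<And>w. w \<in> S \<Longrightarrow> dderiv v F w = 0) \<Longrightarrow> kills v F"
  and killsD: "kills v F \<Longrightarrow> w \<in> S \<Longrightarrow> dderiv v F w = 0"
  by (simp_all add: kills_def)

lemma kills_dderiv:
  assumes "kills v F" "holo_on F S"
  shows "kills v (dderiv u F)"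
proof (rule killsI)
  fix w assume w: "w \<in> S"
  have "dderiv v (dderiv u F) w = dderiv u (dderiv v F) w" by (rule dderiv_commute[OF open_ball assms(2) w])
  also have "\<dots> = dderiv u (\<lambda>_. 0) w" using killsD[OF assms(1)] by (intro dderiv_cong[OF open_ball _ w])
  finally show "dderiv v (dderiv u F) w = 0" by (simp add: dderiv_const)
qed

lemma kills_lincomb:
  assumes "\<And>w. w \<in> S \<Longrightarrow> F w = c * G w + e * H w" "kills v F" "holo_on G S" "holo_on H S" "w \<in> S"
  shows "c * dderiv v G w + e * dderiv v H w = 0"
  using dderiv_lincomb[OF open_ball assms(1,3,4,5)] killsD[OF assms(2,5)] by simp

lemma kills_scale:
  assumes "\<And>w. w \<in> S \<Longrightarrow> F w = c * G w" "kills v F" "holo_on G S" "c \<noteq> 0"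
  shows "kills v G"
  using kills_lincomb[of F c G 0 G v] assms by (auto intro: killsI)

lemma dderiv_cnjv_star:
  assumes "holo_on F S" "\<And>w. w \<in> S \<Longrightarrow> star F w = F' w" "w \<in> S"
  shows "dderiv (cnjv v) F' w = cnj (dderiv v F (cnjv w))"
proof -
  have "dderiv (cnjv v) F' w = dderiv (cnjv v) (star F) w"
    using assms(2) by (intro dderiv_cong[OF open_ball _ assms(3)]) simp
  also have "\<dots> = cnj (dderiv v F (cnjv w))"
    using dderiv_star[OF assms(1,3), of "cnjv v"] by (simp add: star_def)
  finally show ?thesis .
qed

lemma kills_star:
  assumes "kills v F" "holo_on F S" "\<And>w. w \<in> S \<Longrightarrow> star F w = F' w"
  shows "kills (cnjv v) F'"
  using dderiv_cnjv_star[OF assms(2,3)] killsD[OF assms(1)] by (intro killsI) simp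

lemma cnjv_v1: "cnjv v1 = - v1" and cnjv_n2: "cnjv n2 = - n2"
  by (simp_all add: vec_eq_iff)

lemma dderiv_uminus: "holo_on F S \<Longrightarrow> w \<in> S \<Longrightarrow> dderiv (- v) F w = - dderiv v F w"
  using dderiv_smult[of F S w "-1" v] by (simp add: vector_smult_lneg)

lemma kills_uminus: "holo_on F S \<Longrightarrow> kills (- v) F \<longleftrightarrow> kills v F"
  unfolding kills_def by (simp add: dderiv_uminus)

lemma cnjv_in_S: "w \<in> S \<Longrightarrow> cnjv w \<in> S"
  by simp

lemma stars:
  assumes "w \<in> S"
  shows "cnj (B (cnjv w)) = C w" "cnj (C (cnjv w)) = B w" "cnj (K (cnjv w)) = Ks w" "cnj (Ks (cnjv w)) = K w"
    "cnj (L (cnjv w)) = L w"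
  using star_B star_C star_K[OF assms] star_K[OF cnjv_in_S[OF assms]] star_PM(5)[OF assms]
  unfolding star_def fun_eq_iff by (simp_all, metis complex_cnj_cnj)

lemma D_bar:
  assumes w: "w \<in> S"
  shows "dderiv (cnjv v2) A45m w = - 12 * \<i> * B w" "dderiv (cnjv v3) A45m w = - 12 * \<i> * L w + 8 * \<i> * Ks w"
    "dderiv (cnjv v2) A23m w = - 8 * \<i> * L w + 4 * \<i> * Ks w"
  using dderiv_cnjv_star[where v = v2, OF holo_on_PM(3) star_PM(3) w] dderiv_cnjv_star[where v = v3, OF holo_on_PM(3) star_PM(3) w]
    dderiv_cnjv_star[where v = v2, OF holo_on_PM(1) star_PM(1) w]
    D_A45p(2,3)[OF cnjv_in_S[OF w]] D_A23p(1)[OF cnjv_in_S[OF w]] stars[OF w] by simp_all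

text \<open>This compares two expressions for \<open>\<partial>Z/\<partial>z\<close> at \<open>z = 0\<close>.  One is the formula for \<open>Z\<close> obtained from the \<open>w\<^sub>1\<close>-equation, whose linear term
in \<open>z\<close> is \<open>L - K\<close>; the other is \<open>Ks\<close>, by definition.\<close>

lemma K_plus_Ks:
  assumes w: "w \<in> S"
  shows "K w + Ks w = L w"
proof -
  have "((\<lambda>z. setz z w $ i) has_field_derivative axis 0 1 $ i) (at 0)" for i
    by (cases "i = 0") (auto simp: axis_def)
  from holo_on_chain[OF hol _ this, of 0] have der: "((\<lambda>z. X (setz z w) $ 0) has_field_derivative Ks w) (at 0)"
    using norm_setz_less[OF w, of 0] \<rho>_pos by (simp add: Ks_def)
  have "\<forall>\<^sub>F z in nhds 0. z \<in> ball (0::complex) \<rho>"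
    using \<rho>_pos by (intro eventually_nhds_in_open) auto
  then have ev: "\<forall>\<^sub>F z in nhds 0. X (setz z w) $ 0 = C w - \<i> / 2 * dderiv (U1 z) (A 1) w - z * (K w - dderiv (U1 z) B w)"
    by eventually_elim (use first_order(1)[OF w] in simp)
  have "((\<lambda>z. C w - \<i> / 2 * dderiv (U1 z) (A 1) w - z * (K w - dderiv (U1 z) B w)) has_field_derivative Ks w) (at 0)"
    using DERIV_cong_ev[OF refl ev refl] der by blast
  moreover have "((\<lambda>z. C w - \<i> / 2 * dderiv (U1 z) (A 1) w - z * (K w - dderiv (U1 z) B w)) has_field_derivative L w - K w) (at 0)"
    unfolding dderiv_U1[OF holo_on_data(1) w] dderiv_U1[OF holo_on_data(2) w] dderiv_v1_A1[OF w]
    by (auto intro!: derivative_eq_intros simp: algebra_simps)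
  ultimately show ?thesis using DERIV_unique by fastforce
qed

abbreviation "Dvecs \<equiv> {v1, v2, v3, v4}"

lemma kills_A45m: "v \<in> Dvecs \<Longrightarrow> kills v A45m"
  using D_A45m by (auto intro: killsI)

text \<open>The derivative of \<open>A45m\<close> along \<open>cnjv v2\<close> is a multiple of \<open>B\<close>, so whatever kills \<open>A45m\<close>
kills \<open>B\<close>.\<close>

lemma D_kills_B: "v \<in> Dvecs \<Longrightarrow> kills v B"
  using kills_scale[of "dderiv (cnjv v2) A45m" "- 12 * \<i>" B] D_bar(1) kills_dderiv[OF kills_A45m holo_on_PM(4)] holo_on_data(2)
  by simp

lemma kills_A1: "kills v3 (A 1)" "kills v4 (A 1)"
  using D_A45p(5,6) killsD[OF D_kills_B] by (auto intro!: killsI)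

lemma D_L_Ks: "v \<in> Dvecs \<Longrightarrow> w \<in> S \<Longrightarrow> 3 * dderiv v L w = 2 * dderiv v Ks w"
  using kills_lincomb[of "dderiv (cnjv v3) A45m" "- 12 * \<i>" L "8 * \<i>" Ks v w] D_bar(2)
    kills_dderiv[OF kills_A45m holo_on_PM(4), of v] holo_on_data(5) holo_on_PM(5) by simp

lemma dderiv_K: "w \<in> S \<Longrightarrow> dderiv v K w = dderiv v L w - dderiv v Ks w"
  using dderiv_lincomb[where F = K and c = 1 and G = L and e = "-1" and H = Ks, OF open_ball _ holo_on_PM(5) holo_on_data(5)]
    K_plus_Ks by (simp add: eq_diff_eq)

lemma star_Ks: "w \<in> S \<Longrightarrow> star Ks w = K w"
  using stars(4) by (simp add: star_def)

text \<open>Two independent relations between the derivatives of \<open>L\<close> and \<open>Ks\<close>: \<open>3 L = 2 Ks\<close> up to functions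
killed by \<open>v\<close>, from \<open>A45m\<close>, and \<open>2 L = Ks\<close> likewise, from \<open>A23m\<close>.  The vector \<open>v1\<close> does not kill \<open>A23m\<close>,
but since \<open>cnjv v1 = - v1\<close> the first relation holds for it with \<open>K = L - Ks\<close> in place of \<open>Ks\<close>, which
again is a second relation.\<close>

lemma D_kills_L_K:
  assumes "v \<in> Dvecs"
  shows "kills v L" "kills v K" "kills v Ks"
proof -
  have "dderiv v L w = 0 \<and> dderiv v Ks w = 0" if w: "w \<in> S" for w
  \<comment> \<open>\<open>v1\<close> is special because \<open>dderiv v1 A23m = 8 * \<i> * B\<close> need not vanish.\<close>
  proof (cases "v = v1")
    case True
    have "cnj (dderiv v1 L (cnjv w)) = - dderiv v1 L w" "cnj (dderiv v1 Ks (cnjv w)) = - dderiv v1 K w"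
      using dderiv_cnjv_star[where v = v1, OF holo_on_PM(5) star_PM(5) w] dderiv_cnjv_star[where v = v1, OF holo_on_data(5) star_Ks w]
        dderiv_uminus[OF holo_on_PM(5) w, of v1] dderiv_uminus[OF holo_on_data(4) w, of v1]
      by (simp_all add: cnjv_v1)
    moreover have "3 * cnj (dderiv v1 L (cnjv w)) = 2 * cnj (dderiv v1 Ks (cnjv w))"
      using D_L_Ks[of v1, OF _ cnjv_in_S[OF w]] by (metis complex_cnj_mult complex_cnj_numeral insertI1)
    ultimately have "3 * dderiv v1 L w = 2 * dderiv v1 K w" by simp
    with D_L_Ks[of v1, OF _ w] dderiv_K[OF w, of v1] have "dderiv v1 L w = 0" by simp
    with D_L_Ks[of v1, OF _ w] True show ?thesis by simp
  next
    case False
    then have "kills v A23m" using assms D_A23m(2-) by (auto intro: killsI)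
    from kills_lincomb[OF D_bar(3) kills_dderiv[OF this holo_on_PM(2)] holo_on_PM(5) holo_on_data(5) w]
    have "2 * dderiv v L w = dderiv v Ks w" by (simp add: add_eq_0_iff)
    then have Ks: "dderiv v Ks w = 2 * dderiv v L w" by simp
    from D_L_Ks[OF assms w] have "dderiv v L w = 0" unfolding Ks by simp
    with Ks show ?thesis by simp
  qed
  then show "kills v L" "kills v Ks" "kills v K" using dderiv_K by (auto intro!: killsI)
qed

lemma Dbar_kills_L_K:
  assumes "v \<in> Dvecs"
  shows "kills (cnjv v) L" "kills (cnjv v) K" "kills (cnjv v) Ks"
  using kills_star[OF D_kills_L_K(1)[OF assms] holo_on_PM(5) star_PM(5)]
    kills_star[OF D_kills_L_K(2)[OF assms] holo_on_data(4) star_K]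
    kills_star[OF D_kills_L_K(3)[OF assms] holo_on_data(5) star_Ks] by simp_all

text \<open>\<open>B\<close> is, up to constants, the derivative of \<open>A23m\<close> along \<open>v1\<close> and that of \<open>A45m\<close> along \<open>cnjv v2\<close>.
Commuting \<open>cnjv v\<close> with one of these leads to derivatives of \<open>L\<close> and \<open>Ks\<close>, which vanish.\<close>

lemma Dbar_kills_B:
  assumes "v \<in> Dvecs"
  shows "kills (cnjv v) B"
proof -
  have A23m: "dderiv v1 A23m w = 8 * \<i> * B w" if "w \<in> S" for w using D_A23m(1)[OF that] .
  have via_A23m: "kills u B" if "kills u (dderiv v1 A23m)" for u
    using kills_scale[OF A23m that holo_on_data(2)] by simp
  have c: "kills (cnjv v2) (dderiv v1 A23m)"
  proof (rule killsI)
    fix w assume w: "w \<in> S"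
    have "dderiv (cnjv v2) (dderiv v1 A23m) w = dderiv v1 (dderiv (cnjv v2) A23m) w"
      by (rule dderiv_commute[OF open_ball holo_on_PM(2) w])
    also have "\<dots> = - 8 * \<i> * dderiv v1 L w + 4 * \<i> * dderiv v1 Ks w"
      by (rule dderiv_lincomb[OF open_ball D_bar(3) holo_on_PM(5) holo_on_data(5) w])
    finally show "dderiv (cnjv v2) (dderiv v1 A23m) w = 0"
      using killsD[OF D_kills_L_K(1) w] killsD[OF D_kills_L_K(3) w] by simp
  qed
  have d: "kills (cnjv v3) B"
  proof (rule kills_scale[OF D_bar(1) _ holo_on_data(2)])
    show "kills (cnjv v3) (dderiv (cnjv v2) A45m)"
    proof (rule killsI)
      fix w assume w: "w \<in> S"
      have "dderiv (cnjv v3) (dderiv (cnjv v2) A45m) w = dderiv (cnjv v2) (dderiv (cnjv v3) A45m) w"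
        by (rule dderiv_commute[OF open_ball holo_on_PM(4) w])
      also have "\<dots> = - 12 * \<i> * dderiv (cnjv v2) L w + 8 * \<i> * dderiv (cnjv v2) Ks w"
        by (rule dderiv_lincomb[OF open_ball D_bar(2) holo_on_PM(5) holo_on_data(5) w])
      finally show "dderiv (cnjv v3) (dderiv (cnjv v2) A45m) w = 0"
        using killsD[OF Dbar_kills_L_K(1) w] killsD[OF Dbar_kills_L_K(3) w] by simp
    qed
  qed (auto simp: complex_eq_iff)
  have "kills v4 A23p"
    using D_A23p(2) killsD[OF kills_A1(1)] killsD[OF D_kills_B] by (auto intro!: killsI)
  then have "kills (cnjv v4) (dderiv v1 A23m)"
    by (intro kills_dderiv holo_on_PM kills_star[OF _ holo_on_PM(1) star_PM(1)])
  moreover have "kills (cnjv v1) B"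
    using D_kills_B holo_on_data(2) by (simp add: cnjv_v1 kills_uminus)
  ultimately show ?thesis using assms via_A23m c d by auto
qed

text \<open>If some \<open>a41 l\<close> is nonzero, the coefficient of \<open>z\<^sup>5\<close> in the first-order equation for \<open>w\<^sub>l\<close> gives the claim.
Otherwise \<open>v4 = 0\<close> and the coefficient of \<open>z\<^sup>4\<close> in the equation for \<open>A45p\<close> does.\<close>

lemma kills_A1_v2: "kills v2 (A 1)"
proof (cases "a41 7 = 0 \<and> a41 8 = 0")
  case True
  then have "a41 l = 0" for l using a41_support[of l] by auto
  then have "v4 = 0 *s v4" by (simp add: vec_eq_iff)
  then have "dderiv v4 A45p w = 0" if "w \<in> S" for w
    using dderiv_smult[OF holo_on_PM(3) that, of 0 v4] by simp
  then show ?thesis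
    using D_A45p(4) killsD[OF D_kills_B] by (auto intro!: killsI)
next
  case False
  then obtain l where "l \<in> {7, 8}" "a41 l \<noteq> 0" by auto
  then show ?thesis using D_A78(2)[of _ l] killsD[OF D_kills_B] by (auto intro!: killsI)
qed

lemma dderiv_U1_eq_0: "(\<And>v. v \<in> Dvecs \<Longrightarrow> kills v F) \<Longrightarrow> holo_on F S \<Longrightarrow> w \<in> S \<Longrightarrow> dderiv (U1 z) F w = 0"
  by (simp add: dderiv_U1 killsD)

text \<open>All higher powers of \<open>z\<close> in the formula for \<open>Z\<close> are now known to vanish.\<close>

lemma Z_eq:
  assumes w: "w \<in> S" and z: "norm z < \<rho>"
  shows "X (setz z w) $ 0 = C w + z * Ks w"
proof -
  have "dderiv (U1 z) (A 1) w = 2 * \<i> * z * L w"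
    using killsD[OF kills_A1(1) w] killsD[OF kills_A1(2) w] killsD[OF kills_A1_v2 w]
    by (simp add: dderiv_U1[OF holo_on_data(1) w] dderiv_v1_A1[OF w])
  then have "X (setz z w) $ 0 = C w + z * (L w - K w)"
    using first_order(1)[OF w z] dderiv_U1_eq_0[OF D_kills_B holo_on_data(2) w] by (simp add: algebra_simps)
  then show ?thesis by (simp add: K_plus_Ks[OF w, symmetric])
qed

text \<open>The unknown second coefficient \<open>j\<close> is absent here: \<open>k1 6 z = 0\<close>, and \<open>k1 4 z - \<i> * k1 5 z = 0\<close>.\<close>

lemma second_order:
  assumes w: "w \<in> S" and z: "norm z < \<rho>"
  shows "dderiv (U2 z) A45m w = 12 * \<i> * z * B w"
    "dderiv (U2 z) (A 6) w = 4 * \<i> * z * C w + 4 * \<i> * z^2 * L w"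
proof -
  obtain j where J: "l \<noteq> 0 \<Longrightarrow> dderiv (U2 z) (A l) w - dderiv (U1 z) (dderiv (U1 z) (A l)) w / 2
       - (cnj (a21 l) * C w - cnj (a11 l) * dderiv (U1 z) C w) - k2' l z * X (setz z w) $ 0
       - (k1 l z * j + 2 * k2 l z * (K w - dderiv (U1 z) B w) + 3 * k3 l z * B w) = 0" for l
    using jet_equations[OF w z] by blast
  have B0: "dderiv (U1 z) B w = 0" by (rule dderiv_U1_eq_0[OF D_kills_B holo_on_data(2) w])
  note d = k_defs a11_def a21_def a31_def a22_def a41_support a32_support
  have k: "k1 4 z = 2 * \<i> * z^3" "k1 5 z = 2 * z^3" "k1 6 z = 0" "k2 4 z = 0" "k2 5 z = 0" "k2 6 z = 2 * \<i> * z^2"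
    "k2' 4 z = 0" "k2' 5 z = 0" "k2' 6 z = 4 * \<i> * z" "k3 4 z = 2 * \<i> * z" "k3 5 z = - 2 * z" "k3 6 z = 0"
    "a11 4 = 0" "a11 5 = 0" "a11 6 = 0" "a21 4 = 0" "a21 5 = 0" "a21 6 = 0"
    by (simp_all add: d)
  have "dderiv (U1 z) (dderiv (U1 z) (A 4)) w - \<i> * dderiv (U1 z) (dderiv (U1 z) (A 5)) w
      = dderiv (U1 z) (\<lambda>w. dderiv (U1 z) (A 4) w - \<i> * dderiv (U1 z) (A 5) w) w"
    by (simp add: dderiv_diff[OF _ _ w] dderiv_cmult[OF _ w] holo_on_dderiv[OF open_ball] holo_on_data holo_on_cmult)
  also have "\<dots> = dderiv (U1 z) (\<lambda>_. 0) w"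
    using first_order_PM(1)[OF _ z] dderiv_PM(4) by (intro dderiv_cong[OF open_ball _ w]) simp
  finally have eq: "dderiv (U1 z) (dderiv (U1 z) (A 4)) w = \<i> * dderiv (U1 z) (dderiv (U1 z) (A 5)) w" by (simp add: dderiv_const)
  show "dderiv (U2 z) A45m w = 12 * \<i> * z * B w"
  proof -
    have A5: "dderiv (U1 z) (dderiv (U1 z) (A 5)) w / 2 = dderiv (U2 z) (A 5) w - 2 * z^3 * j + 6 * z * B w"
      using J[of 5] unfolding k B0 by (simp add: algebra_simps)
    have "dderiv (U2 z) (A 4) w = \<i> * (dderiv (U1 z) (dderiv (U1 z) (A 5)) w / 2) + 2 * \<i> * z^3 * j + 6 * \<i> * z * B w"
      using J[of 4] unfolding k B0 eq by (simp add: algebra_simps)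
    then show ?thesis unfolding dderiv_PM(4)[OF w] A5 by (simp add: algebra_simps)
  qed
  have "dderiv (U1 z) (dderiv (U1 z) (A 6)) w = dderiv (U1 z) (\<lambda>w. 4 * \<i> * z^2 * B w) w"
    using first_order(6)[OF _ z] by (intro dderiv_cong[OF open_ball _ w])
  then have "dderiv (U1 z) (dderiv (U1 z) (A 6)) w = 0"
    by (simp add: dderiv_cmult[OF holo_on_data(2) w] B0)
  then show "dderiv (U2 z) (A 6) w = 4 * \<i> * z * C w + 4 * \<i> * z^2 * L w"
    using J[of 6] K_plus_Ks[OF w, symmetric] unfolding k B0 Z_eq[OF w z]
    by (simp add: algebra_simps power2_eq_square)
qed

lemma E_A45m:
  assumes w: "w \<in> S"
  shows "dderiv n2 A45m w = 0" "dderiv n3 A45m w = 0"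
proof -
  have "[:0, - dderiv (cnjv v2) A45m w - 12 * \<i> * B w, dderiv n2 A45m w, dderiv n3 A45m w:] = 0"
    using second_order(1)[OF w]
    by (intro poly_zero_near_0[OF \<rho>_pos]) (simp add: dderiv_U2[OF holo_on_PM(4) w] algebra_simps eval_nat_numeral)
  then show "dderiv n2 A45m w = 0" "dderiv n3 A45m w = 0" by simp_all
qed

lemma E_A6:
  assumes w: "w \<in> S"
  shows "dderiv n2 (A 6) w = 4 * \<i> * L w" "dderiv n3 (A 6) w = 0"
proof -
  have "[:0, - dderiv (cnjv v2) (A 6) w - 4 * \<i> * C w, dderiv n2 (A 6) w - 4 * \<i> * L w, dderiv n3 (A 6) w:] = 0"
    using second_order(2)[OF w]
    by (intro poly_zero_near_0[OF \<rho>_pos]) (simp add: dderiv_U2[OF holo_on_data(1) w] algebra_simps eval_nat_numeral)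
  then show "dderiv n2 (A 6) w = 4 * \<i> * L w" "dderiv n3 (A 6) w = 0"
    unfolding pCons_eq_0_iff right_minus_eq by blast+
qed

text \<open>First-order equations see \<open>\<phi>\<^sub>l\<close> only up to its part linear in \<open>s\<close>, so the directions \<open>n2\<close> and \<open>n3\<close>, which
come from the terms \<open>z\<^sup>2 s\<^sup>2\<close> and \<open>z\<^sup>3 s\<^sup>2\<close>, need the second order.  The component \<open>A 6\<close> serves
because both \<open>B\<close> and \<open>L\<close> are derivatives of it, and it is real, so that \<open>cnjv n3\<close> kills it along
with \<open>n3\<close>.\<close>

lemma E_kills:
  assumes "v \<in> {n2, n3, cnjv n3}"
  shows "kills v B" "kills v C" "kills v L" "kills v K" "kills v Ks"
proof -
  have star_A6: "star (A 6) w = A 6 w" if "w \<in> S" for w using star_A[OF that] by simp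
  have A6: "kills n3 (A 6)" using E_A6(2) by (rule killsI)
  have A6': "kills (cnjv n3) (A 6)" by (rule kills_star[OF A6 holo_on_data(1) star_A6])
  have B_n3: "kills u B" if "kills u (A 6)" for u
    by (rule kills_scale[OF D_A6 kills_dderiv[OF that holo_on_data(1)] holo_on_data(2)]) simp_all
  have L_n3: "kills u L" if "kills u (A 6)" for u
    by (rule kills_scale[OF E_A6(1) kills_dderiv[OF that holo_on_data(1)] holo_on_PM(5)]) simp_all
  have B_n2: "kills n2 B"
  proof (rule kills_scale[OF D_A6 _ holo_on_data(2)])
    show "kills n2 (dderiv v2 (A 6))"
    proof (rule killsI)
      fix w assume w: "w \<in> S"
      have "dderiv n2 (dderiv v2 (A 6)) w = dderiv v2 (dderiv n2 (A 6)) w" by (rule dderiv_commute[OF open_ball holo_on_data(1) w])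
      also have "\<dots> = dderiv v2 (\<lambda>w. 4 * \<i> * L w) w" using E_A6(1) by (rule dderiv_cong[OF open_ball _ w])
      finally show "dderiv n2 (dderiv v2 (A 6)) w = 0"
        using killsD[OF D_kills_L_K(1) w] by (simp add: dderiv_cmult[OF holo_on_PM(5) w])
    qed
  qed simp_all
  have rel: "3 * dderiv u L w = 2 * dderiv u Ks w" if "kills u A45m" "w \<in> S" for u w
    using kills_lincomb[OF D_bar(2) kills_dderiv[OF that(1) holo_on_PM(4)] holo_on_PM(5) holo_on_data(5) that(2)] by simp
  \<comment> \<open>\<open>cnjv n2 = - n2\<close> supplies a second relation between \<open>L\<close> and \<open>Ks\<close>, as for \<open>v1\<close> before.\<close>
  have n2_LK: "dderiv n2 L w = 0 \<and> dderiv n2 Ks w = 0" if w: "w \<in> S" for w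
  proof -
    have r: "3 * dderiv n2 L w = 2 * dderiv n2 Ks w" if "w \<in> S" for w using E_A45m(1) by (intro rel killsI that)
    have "cnj (dderiv n2 L (cnjv w)) = - dderiv n2 L w" "cnj (dderiv n2 Ks (cnjv w)) = - dderiv n2 K w"
      using dderiv_cnjv_star[where v = n2, OF holo_on_PM(5) star_PM(5) w] dderiv_cnjv_star[where v = n2, OF holo_on_data(5) star_Ks w]
        dderiv_uminus[OF holo_on_PM(5) w, of n2] dderiv_uminus[OF holo_on_data(4) w, of n2]
      by (simp_all add: cnjv_n2)
    moreover have "3 * cnj (dderiv n2 L (cnjv w)) = 2 * cnj (dderiv n2 Ks (cnjv w))"
      using r[OF cnjv_in_S[OF w]] by (metis complex_cnj_mult complex_cnj_numeral)
    ultimately have "3 * dderiv n2 L w = 2 * dderiv n2 K w" by simp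
    with r[OF w] dderiv_K[OF w, of n2] have "dderiv n2 L w = 0" by simp
    with r[OF w] show ?thesis by simp
  qed
  have Ks_n3: "kills n3 Ks"
    using rel[of n3] E_A45m(2) killsD[OF L_n3[OF A6]] by (auto intro!: killsI simp: kills_def)
  have K_n3: "kills n3 K" using dderiv_K killsD[OF Ks_n3] killsD[OF L_n3[OF A6]] by (auto intro!: killsI)
  have B: "kills v B" if "v \<in> {n2, n3, cnjv n3}" for v using that B_n3 A6 A6' B_n2 by auto
  show "kills v B" using B assms .
  have "kills (cnjv v) B"
    using assms B holo_on_data(2) by (auto simp: cnjv_n2 kills_uminus)
  from kills_star[OF this holo_on_data(2)] show "kills v C" using star_B by simp
  show "kills v L" "kills v K" "kills v Ks"
    using assms n2_LK L_n3[OF A6] L_n3[OF A6'] Ks_n3 K_n3 dderiv_K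
      kills_star[OF K_n3 holo_on_data(4) star_K] kills_star[OF Ks_n3 holo_on_data(5) star_Ks]
    by (auto intro!: killsI dest: killsD)
qed

text \<open>The listed vectors span all \<open>w\<close>-directions over the complex numbers, where condition
\<open>nondegenerate\<close> accounts for \<open>w\<^sub>7\<close> and \<open>w\<^sub>8\<close>.\<close>

lemma constant_if_all_kill:
  assumes F: "z_free F" "holo_on F S"
    and k: "\<And>v. v \<in> Dvecs \<Longrightarrow> kills v F" "\<And>v. v \<in> Dvecs \<Longrightarrow> kills (cnjv v) F"
      "\<And>v. v \<in> {n2, n3, cnjv n3} \<Longrightarrow> kills v F"
    and w: "w \<in> S"
  shows "F w = F 0"
proof -
  have d: "dderiv v F w = 0" if w: "w \<in> S" for v w
  proof -
    let ?e = "\<lambda>i. dderiv (axis i 1) F w"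
    note dir = dderiv_dir_add[OF F(2) w] dderiv_smult[OF F(2) w] dderiv_dir_sum[OF F(2) w]
    have expand: "dderiv v F w = (\<Sum>i\<in>UNIV. v $ i * ?e i)" for v
    proof -
      have "v = (\<Sum>i\<in>UNIV. v $ i *s axis i 1)"
        by (simp add: vec_eq_iff axis_def if_distrib cong: if_cong)
      from arg_cong[OF this, of "\<lambda>u. dderiv u F w"] show ?thesis by (simp only: dir)
    qed
    have zero: "(\<Sum>i\<in>UNIV. v $ i * ?e i) = 0" if "kills v F" for v
      using killsD[OF that w] by (simp only: expand[of v, symmetric])
    have e0: "?e 0 = 0" by (rule z_free_dderiv_axis_0[OF F w])
    have e1: "?e 1 = 0" using zero[OF k(1)[of v1]] by (simp add: sum_9 a11_def)
    have e6: "?e 6 = 0" using zero[OF k(3)[of n2]] by (simp add: sum_9 a22_def)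
    have "2 * \<i> * ?e 2 + 2 * ?e 3 = 0" "- 2 * \<i> * ?e 2 + 2 * ?e 3 = 0"
      using zero[OF k(1)[of v2]] zero[OF k(2)[of v2]] by (simp_all add: sum_9 a21_def)
    from imaginary_pair_eq_0[OF this] have e23: "?e 2 = 0" "?e 3 = 0" by simp_all
    have "2 * \<i> * ?e 4 + 2 * ?e 5 = 0" "- 2 * \<i> * ?e 4 + 2 * ?e 5 = 0"
      using zero[OF k(1)[of v3]] zero[OF k(2)[of v3]] by (simp_all add: sum_9 a31_def)
    from imaginary_pair_eq_0[OF this] have e45: "?e 4 = 0" "?e 5 = 0" by simp_all
    have e78: "?e 7 = 0 \<and> ?e 8 = 0"
      using zero[OF k(1)[of v4]] zero[OF k(2)[of v4]] zero[OF k(3)[of n3]] zero[OF k(3)[of "cnjv n3"]]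
      by (intro nondegenerate) (simp_all add: sum_9 a41_support a32_support)
    show ?thesis by (subst expand[of v], subst sum_9) (simp add: e0 e1 e6 e23 e45 e78)
  qed
  have "\<exists>c. \<forall>w\<in>S. F w = c"
  proof (rule has_derivative_zero_constant)
    show "(F has_derivative (\<lambda>h. 0)) (at w within S)" if "w \<in> S" for w
      using holo_on_has_derivative[OF F(2) that] d[OF that] by (simp add: has_derivative_at_withinI)
  qed simp
  then show ?thesis using w \<rho>_pos by (metis centre_in_ball)
qed

lemma C_Ks_constant:
  assumes w: "w \<in> S"
  shows "C w = C 0" "Ks w = Ks 0" "B w = B 0" "K w = K 0"
proof -
  have C: "kills v C" "kills (cnjv v) C" if "v \<in> Dvecs" for v
  proof -
    have "kills (cnjv (cnjv v)) C"
      using star_B by (intro kills_star[OF Dbar_kills_B[OF that] holo_on_data(2)]) auto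
    then show "kills v C" by simp
    show "kills (cnjv v) C"
      using star_B by (intro kills_star[OF D_kills_B[OF that] holo_on_data(2)]) auto
  qed
  show "C w = C 0"
    by (rule constant_if_all_kill[OF z_free_data(3) holo_on_data(3) C E_kills(2) w])
  show "Ks w = Ks 0"
    by (rule constant_if_all_kill[OF z_free_data(5) holo_on_data(5) D_kills_L_K(3) Dbar_kills_L_K(3) E_kills(5) w])
  show "B w = B 0"
    by (rule constant_if_all_kill[OF z_free_data(2) holo_on_data(2) D_kills_B Dbar_kills_B E_kills(1) w])
  show "K w = K 0"
    by (rule constant_if_all_kill[OF z_free_data(4) holo_on_data(4) D_kills_L_K(2) Dbar_kills_L_K(2) E_kills(4) w])
qed

text \<open>When \<open>B\<close>, \<open>C\<close>, \<open>K\<close> and \<open>Ks\<close> vanish, so does \<open>Z\<close>, and the polarized equation says that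
\<open>A l\<close> takes the same value at \<open>w\<close> and at \<open>w - \<phi>(z, s)\<close>.  Expanding this to second order in \<open>s\<close>
shows that all the vectors kill \<open>A l\<close>.\<close>

lemma vanishes_if_data_vanish:
  assumes C0: "C 0 = 0" and Ks0: "Ks 0 = 0" and A0: "\<And>l. l \<noteq> 0 \<Longrightarrow> A l 0 = 0"
    and p: "norm p < \<rho>"
  shows "X p = 0"
proof -
  have 0: "0 \<in> S" using \<rho>_pos by simp
  have CB: "C w = 0" "Ks w = 0" "B w = 0" "K w = 0" if "w \<in> S" for w
    using C_Ks_constant[OF that] C0 Ks0 stars(2)[OF 0] stars(4)[OF 0] by (simp_all add: cnjv_0)
  have Z0: "X (setz z w) $ 0 = 0" if "w \<in> S" "norm z < \<rho>" for z w
    using Z_eq[OF that] CB[OF that(1)] by simp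
  have Al: "A l w = 0" if l: "l \<noteq> 0" and w: "w \<in> S" for l w
  proof -
    have jets: "dderiv (U1 z) (A l) w = 0 \<and> dderiv (U1 z) (dderiv (U1 z) (A l)) w / 2 - dderiv (U2 z) (A l) w = 0"
      if w: "w \<in> S" and z: "norm z < \<rho>" for z w
    proof -
      let ?c = "conj_pt (setz z w)"
      have "\<forall>\<^sub>F s in nhds 0. s \<in> ball (0::complex) \<rho>"
        using \<rho>_pos by (intro eventually_nhds_in_open) auto
      then have ev: "\<forall>\<^sub>F s in nhds 0. A l (?c s) - A l w = 0"
        using eventually_conj_pt_in_ball[OF w, of z]
      proof eventually_elim
        case (elim s)
        have "star (\<lambda>p. X p $ l) (?c s) = A l (?c s)"
          using star_X_eq[OF elim(2) _ l, of s] elim(1) setz_self[of "?c s"] CB[OF elim(2)] by simp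
        moreover have "star (\<lambda>p. X p $ 0) (?c s) = 0"
          using Z0[of "cnjv (?c s)" "cnj s"] elim setz_self[of "cnjv (?c s)"] by (simp add: star_def)
        ultimately show ?case
          using pol[OF norm_setz_less[OF w z] _ l, of s] elim(1) \<rho>_pos Z0[OF w z] X_eq[OF w z l] CB[OF w] by simp
      qed
      from jet2_eventually_0[OF jet2_diff[OF jet2_z_free_along_conj_pt[OF z_free_data(1) holo_on_data(1) w] jet2_const] ev]
      show ?thesis by simp
    qed
    have jet1: "dderiv (U1 z) (A l) w = 0" and jet2: "dderiv (U2 z) (A l) w = 0" if w: "w \<in> S" and z: "norm z < \<rho>" for z w
    proof -
      have "dderiv (U1 z) (dderiv (U1 z) (A l)) w = dderiv (U1 z) (\<lambda>_. 0) w"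
        using jets[OF _ z] by (intro dderiv_cong[OF open_ball _ w]) simp
      then show "dderiv (U1 z) (A l) w = 0" "dderiv (U2 z) (A l) w = 0" using jets[OF w z] by (simp_all add: dderiv_const)
    qed
    have D: "kills v (A l)" if "v \<in> Dvecs" for v
    proof (rule killsI)
      fix w assume w: "w \<in> S"
      have "[:0, dderiv v1 (A l) w, dderiv v2 (A l) w, dderiv v3 (A l) w, dderiv v4 (A l) w:] = 0"
        using jet1[OF w]
        by (intro poly_zero_near_0[OF \<rho>_pos]) (simp add: dderiv_U1[OF holo_on_data(1) w] algebra_simps eval_nat_numeral)
      then show "dderiv v (A l) w = 0" using that by auto
    qed
    have E: "kills v (A l)" if "v \<in> {n2, n3}" for v
    proof (rule killsI)
      fix w assume w: "w \<in> S"
      have "[:0, - dderiv (cnjv v2) (A l) w, dderiv n2 (A l) w, dderiv n3 (A l) w:] = 0"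
        using jet2[OF w]
        by (intro poly_zero_near_0[OF \<rho>_pos]) (simp add: dderiv_U2[OF holo_on_data(1) w] algebra_simps eval_nat_numeral)
      then show "dderiv v (A l) w = 0" using that by auto
    qed
    have real: "kills (cnjv v) (A l)" if "kills v (A l)" for v
      by (rule kills_star[OF that holo_on_data(1) star_A[OF _ l]])
    have "A l w = A l 0"
      by (rule constant_if_all_kill[OF z_free_data(1) holo_on_data(1) D real[OF D] _ w]) (use E real in auto)
    then show ?thesis using A0[OF l] by simp
  qed
  have "X (setz (p $ 0) p) $ i = 0" for i
    using Z0[of p "p $ 0"] X_eq[of p "p $ 0" i] Al[of i p] CB[of p] p
      Finite_Cartesian_Product.norm_nth_le[of p 0] by (cases "i = 0") auto
  then show ?thesis by (simp add: vec_eq_iff)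
qed

text \<open>For imaginary \<open>a41\<close> the vector \<open>v4\<close> is its own conjugate up to sign, so the derivative of the real
function \<open>A l\<close> along it is given both by the equation for \<open>w\<^sub>l\<close>, through \<open>K\<close>, and by its
conjugate, through \<open>Ks\<close>.\<close>

lemma Ks_eq_K_if_no_rotation:
  assumes "l \<in> {7, 8}" "a41 l \<noteq> 0" "\<And>i. cnj (a41 i) = - a41 i" "w \<in> S"
  shows "Ks w = K w"
proof -
  have l: "l \<noteq> 0" using assms(1) by auto
  have "cnjv v4 = - v4" by (simp add: vec_eq_iff assms(3))
  then have "- dderiv v4 (A l) w = cnj (dderiv v4 (A l) (cnjv w))"
    using dderiv_cnjv_star[where v = v4, OF holo_on_data(1) star_A[OF _ l] assms(4)] dderiv_uminus[OF holo_on_data(1) assms(4)] by metis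
  then have "a41 l * (4 * L w - 3 * K w) = a41 l * (4 * L w - 3 * Ks w)"
    using D_A78(1)[OF assms(4,1)] D_A78(1)[OF cnjv_in_S[OF assms(4)] assms(1)] stars[OF assms(4)]
    by (simp add: assms(3))
  then show ?thesis using assms(2) by simp
qed

end

section \<open>Germs and real coordinates on the algebra\<close>

text \<open>An injective linear coordinate map that sends a set onto the standard basis makes this set a
basis.  Additivity and homogeneity are demanded on \<open>V\<close> only, because the coordinate
\<open>germ_dz\<close> below is linear just on differentiable fields.\<close>

lemma basis_of_coordinates:
  fixes J :: "'v::real_vector \<Rightarrow> 'e::euclidean_space"
  assumes V: "subspace V"
    and add: "\<And>g h. g \<in> V \<Longrightarrow> h \<in> V \<Longrightarrow> J (g + h) = J g + J h"
    and scale: "\<And>r g. g \<in> V \<Longrightarrow> J (r *\<^sub>R g) = r *\<^sub>R J g"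
    and inj: "\<And>g. g \<in> V \<Longrightarrow> J g = 0 \<Longrightarrow> g = 0"
    and G: "G \<subseteq> V" "J ` G = Basis"
  shows "dim V = DIM('e) \<and> independent G \<and> span G = V"
proof -
  have J0: "J 0 = 0" using scale[OF subspace_0[OF V], of 0] by simp
  have diff: "J (g - h) = J g - J h" if "g \<in> V" "h \<in> V" for g h
    using add[OF that(1) subspace_scale[OF V that(2), of "-1"]] scale[OF that(2), of "-1"] by simp
  have J_inj: "inj_on J V"
  proof (rule inj_onI)
    fix g h assume "g \<in> V" "h \<in> V" "J g = J h"
    then have "g - h = 0" by (intro inj subspace_diff[OF V]) (simp_all add: diff)
    then show "g = h" by simp
  qed
  note J_eqD = inj_onD[OF J_inj]
  define f where "f = inv_into G J"
  have f: "f b \<in> G" "J (f b) = b" if "b \<in> Basis" for b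
    using that G(2) by (auto simp: f_def inv_into_into f_inv_into_f)
  define F where "F x = (\<Sum>b\<in>Basis. (x \<bullet> b) *\<^sub>R f b)" for x :: 'e
  have F_lin: "linear F"
    unfolding F_def by (intro linearI) (simp_all add: inner_add_left scaleR_add_left sum.distrib scaleR_sum_right)
  have JF_sum: "(\<Sum>b\<in>I. (x \<bullet> b) *\<^sub>R f b) \<in> V \<and> J (\<Sum>b\<in>I. (x \<bullet> b) *\<^sub>R f b) = (\<Sum>b\<in>I. (x \<bullet> b) *\<^sub>R b)"
    if "I \<subseteq> Basis" for I x
    using finite_subset[OF that finite_Basis] that
  proof (induction I rule: finite_induct)
    case empty then show ?case by (simp add: J0 subspace_0[OF V])
  next
    case (insert b I)
    have "f b \<in> V" using f(1)[of b] G(1) insert.prems by auto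
    then show ?case
      using insert f(2)[of b] by (simp add: add scale subspace_add[OF V] subspace_scale[OF V])
  qed
  have JF: "F x \<in> V" "J (F x) = x" for x
    using JF_sum[OF subset_refl, of x] euclidean_representation[of x] unfolding F_def by auto
  have F_inj: "inj F" using JF(2) by (metis injI)
  have F_Basis: "F ` Basis = G"
  proof
    have "F b = f b" if "b \<in> Basis" for b
      using JF[of b] f[OF that] G(1) by (intro J_eqD) auto
    then show "F ` Basis \<subseteq> G" using f(1) by auto
    show "G \<subseteq> F ` Basis"
    proof
      fix g assume g: "g \<in> G"
      then have "J g \<in> Basis" using G(2) by blast
      moreover have "g = F (J g)"
        using g G(1) JF[of "J g"] by (intro J_eqD) auto
      ultimately show "g \<in> F ` Basis" by blast
    qed
  qed
  have "range F = V"
  proof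
    show "V \<subseteq> range F"
    proof
      fix g assume "g \<in> V"
      then have "g = F (J g)" using JF[of "J g"] by (intro J_eqD) auto
      then show "g \<in> range F" by blast
    qed
  qed (use JF in auto)
  then have sp: "span G = V"
    unfolding F_Basis[symmetric] linear_span_image[OF F_lin] span_Basis .
  have "independent (F ` Basis)"
    using linear_independent_injective_image[OF F_lin independent_Basis] F_inj inj_on_subset by blast
  then have ind: "independent G" unfolding F_Basis .
  have "card G = DIM('e)"
    unfolding F_Basis[symmetric] using F_inj inj_on_subset by (intro card_image) blast
  then show ?thesis using sp ind dim_eq_card_independent[OF ind] dim_span[of G] by simp
qed

lemma holo_on_nth: "holo_on (\<lambda>p. p $ i) S"
  by (rule holo_onI[OF bounded_linear_imp_has_derivative[OF bounded_linear_vec_nth]]) simp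

lemma holo_on_mult:
  assumes "holo_on f S" "holo_on g S"
  shows "holo_on (\<lambda>p. f p * g p) S"
  by (rule holo_onI[OF has_derivative_mult[OF assms[THEN holo_on_has_derivative]]])
    (simp_all add: dderiv_smult[OF assms(1)] dderiv_smult[OF assms(2)] algebra_simps)

lemma holo_on_power: "holo_on f S \<Longrightarrow> holo_on (\<lambda>p. f p ^ n) S"
  by (induction n) (simp_all add: holo_on_const holo_on_mult)

lemma holo_on_minus: "holo_on f S \<Longrightarrow> holo_on (\<lambda>p. - f p) S"
  using holo_on_cmult[of f S "-1"] by simp

lemma eventually_nhds_0_ball: "(\<forall>\<^sub>F p in nhds (0 :: 'a::real_normed_vector). P p) \<longleftrightarrow> (\<exists>r>0. \<forall>p\<in>ball 0 r. P p)"
  by (auto simp: eventually_nhds_metric dist_norm)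

lemma holomorphic_near_origin_iff:
  "holomorphic_near_origin f \<longleftrightarrow> (\<exists>r>0. holo_on f (ball 0 r))"
proof
  assume "holomorphic_near_origin f"
  then obtain r where r: "r > 0" and c: "\<And>p. p \<in> ball 0 r \<Longrightarrow>
      \<exists>c. (f has_derivative (\<lambda>v. \<Sum>j\<in>UNIV. c $ j * v $ j)) (at p)"
    unfolding holomorphic_near_origin_def eventually_nhds_0_ball by blast
  have "holo_on f (ball 0 r)"
    unfolding holo_on_def
  proof
    fix p :: "complex^'a" assume "p \<in> ball 0 r"
    then obtain c where "(f has_derivative (\<lambda>v. \<Sum>j\<in>UNIV. c $ j * v $ j)) (at p)" using c by blast
    moreover have "(\<Sum>j\<in>UNIV. c $ j * (a *s v) $ j) = a * (\<Sum>j\<in>UNIV. c $ j * v $ j)" for a v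
      by (simp add: sum_distrib_left mult.left_commute)
    ultimately show "\<exists>f'. (f has_derivative f') (at p) \<and> (\<forall>c v. f' (c *s v) = c * f' v)" by blast
  qed
  with r show "\<exists>r>0. holo_on f (ball 0 r)" by blast
next
  assume "\<exists>r>0. holo_on f (ball 0 r)"
  then obtain r where r: "r > 0" "holo_on f (ball 0 r)" by blast
  have "\<forall>\<^sub>F p in nhds 0. p \<in> ball (0::complex^'a) r"
    using r by (intro eventually_nhds_in_open) auto
  then show "holomorphic_near_origin f"
    unfolding holomorphic_near_origin_def
  proof eventually_elim
    case (elim p)
    have "dderiv v f p = (\<Sum>j\<in>UNIV. (\<chi> j. dderiv (axis j 1) f p) $ j * v $ j)" for v
    proof -
      have "v = (\<Sum>j\<in>UNIV. v $ j *s axis j 1)"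
        by (simp add: vec_eq_iff axis_def if_distrib cong: if_cong)
      from arg_cong[OF this, of "\<lambda>u. dderiv u f p"] show ?thesis
        by (simp only: dderiv_dir_sum[OF r(2) elim] dderiv_smult[OF r(2) elim] vec_lambda_beta mult.commute)
    qed
    then have "(\<lambda>v. dderiv v f p) = (\<lambda>v. \<Sum>j\<in>UNIV. (\<chi> j. dderiv (axis j 1) f p) $ j * v $ j)"
      by (rule ext)
    with holo_on_has_derivative[OF r(2) elim]
    show ?case by (intro exI[of _ "\<chi> j. dderiv (axis j 1) f p"]) simp
  qed
qed

lemma tangent_to_add:
  assumes "tangent_to X R" "tangent_to Y R"
  shows "tangent_to (\<lambda>p. X p + Y p) R"
proof -
  have *: "apply_vf (\<lambda>p. X p + Y p) r p + apply_vf_bar (\<lambda>p. X p + Y p) r p =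
      (apply_vf X r p + apply_vf_bar X r p) + (apply_vf Y r p + apply_vf_bar Y r p)" for r p
    by (simp add: apply_vf_def apply_vf_bar_def distrib_right sum.distrib)
  show ?thesis using assms unfolding tangent_to_def * by eventually_elim simp
qed

lemma tangent_to_scaleR:
  assumes "tangent_to X R"
  shows "tangent_to (\<lambda>p. c *\<^sub>R X p) R"
proof -
  have *: "apply_vf (\<lambda>p. c *\<^sub>R X p) r p + apply_vf_bar (\<lambda>p. c *\<^sub>R X p) r p =
      c *\<^sub>R (apply_vf X r p + apply_vf_bar X r p)" for r p
    by (simp add: apply_vf_def apply_vf_bar_def scaleR_sum_right scaleR_add_right)
  show ?thesis using assms unfolding tangent_to_def * by eventually_elim simp
qed

lemma subspace_aut_CR: "subspace (aut_CR R)"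
  unfolding subspace_def
proof (intro conjI ballI allI)
  show "0 \<in> aut_CR R"
    unfolding aut_CR_def
  proof (rule image_eqI)
    show "0 = germ (\<lambda>_. 0)" by transfer simp
    show "(\<lambda>_. 0) \<in> {X. (\<forall>i. holomorphic_near_origin (\<lambda>p. X p $ i)) \<and> tangent_to X R}"
      by (auto simp: holomorphic_near_origin_iff tangent_to_def apply_vf_def apply_vf_bar_def
          intro!: exI[of _ 1] holo_on_const)
  qed
next
  fix g h assume "g \<in> aut_CR R" "h \<in> aut_CR R"
  then obtain X Y where XY: "g = germ X" "h = germ Y" "\<And>i. holomorphic_near_origin (\<lambda>p. X p $ i)"
    "\<And>i. holomorphic_near_origin (\<lambda>p. Y p $ i)" "tangent_to X R" "tangent_to Y R"
    unfolding aut_CR_def by blast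
  have "holomorphic_near_origin (\<lambda>p. X p $ i + Y p $ i)" for i
  proof -
    obtain r s where "r > 0" "holo_on (\<lambda>p. X p $ i) (ball 0 r)" "s > 0" "holo_on (\<lambda>p. Y p $ i) (ball 0 s)"
      using XY(3,4)[of i] unfolding holomorphic_near_origin_iff by blast
    then show ?thesis
      unfolding holomorphic_near_origin_iff
      by (intro exI[of _ "min r s"] conjI holo_on_add) (auto elim!: holo_on_subset)
  qed
  moreover have "g + h = germ (\<lambda>p. X p + Y p)" unfolding XY by transfer simp
  ultimately show "g + h \<in> aut_CR R"
    unfolding aut_CR_def using tangent_to_add[OF XY(5,6)] by (intro image_eqI) auto
next
  fix c g assume "g \<in> aut_CR R"
  then obtain X where X: "g = germ X" "\<And>i. holomorphic_near_origin (\<lambda>p. X p $ i)" "tangent_to X R"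
    unfolding aut_CR_def by blast
  have "holomorphic_near_origin (\<lambda>p. c *\<^sub>R X p $ i)" for i
    using X(2)[of i] holo_on_cmult[of "\<lambda>p. X p $ i" _ "complex_of_real c"]
    unfolding holomorphic_near_origin_iff scaleR_conv_of_real by blast
  moreover have "c *\<^sub>R g = germ (\<lambda>p. c *\<^sub>R X p)" unfolding X by transfer simp
  ultimately show "c *\<^sub>R g \<in> aut_CR R"
    unfolding aut_CR_def using tangent_to_scaleR[OF X(3)] by (intro image_eqI) auto
qed

lift_definition germ_at_0 :: "'m::finite vf_germ \<Rightarrow> complex^'m" is "\<lambda>X. X 0"
  by (rule eventually_nhds_x_imp_x)

text \<open>The derivative \<open>(\<partial>Z/\<partial>z)(0)\<close>, which is \<open>1\<close> for the weighted Euler field and \<open>\<i>\<close> for the rotations.\<close>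

lift_definition germ_dz :: "9 vf_germ \<Rightarrow> complex" is "\<lambda>X. dderiv (axis 0 1) (\<lambda>p. X p $ 0) 0"
proof -
  fix X Y :: "9 vfield" assume "\<forall>\<^sub>F p in nhds 0. X p = Y p"
  then obtain U where "open U" "0 \<in> U" "\<And>p. p \<in> U \<Longrightarrow> X p = Y p"
    unfolding eventually_nhds by blast
  then show "dderiv (axis 0 1) (\<lambda>p. X p $ 0) 0 = dderiv (axis 0 1) (\<lambda>p. Y p $ 0) 0"
    by (intro dderiv_cong) auto
qed

lemma germ_at_0_add: "germ_at_0 (g + h) = germ_at_0 g + germ_at_0 h"
  and germ_at_0_scaleR: "germ_at_0 (c *\<^sub>R g) = c *\<^sub>R germ_at_0 g"
  by (transfer; simp)+

lemma germ_simps: "germ_at_0 (germ X) = X 0" "germ_dz (germ X) = dderiv (axis 0 1) (\<lambda>p. X p $ 0) 0"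
  by (transfer; simp)+

lemma germ_dz_add:
  assumes "g \<in> aut_CR R" "h \<in> aut_CR R"
  shows "germ_dz (g + h) = germ_dz g + germ_dz h"
proof -
  obtain X Y where XY: "g = germ X" "h = germ Y" "holomorphic_near_origin (\<lambda>p. X p $ 0)"
    "holomorphic_near_origin (\<lambda>p. Y p $ 0)"
    using assms unfolding aut_CR_def by blast
  then obtain r s where rs: "r > 0" "holo_on (\<lambda>p. X p $ 0) (ball 0 r)" "s > 0" "holo_on (\<lambda>p. Y p $ 0) (ball 0 s)"
    unfolding holomorphic_near_origin_iff by blast
  have "g + h = germ (\<lambda>p. X p + Y p)" unfolding XY by transfer simp
  moreover have "holo_on (\<lambda>p. X p $ 0) (ball 0 (min r s))" "holo_on (\<lambda>p. Y p $ 0) (ball 0 (min r s))"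
    using rs by (auto elim!: holo_on_subset)
  ultimately show ?thesis
    using dderiv_add[of "\<lambda>p. X p $ 0" "ball 0 (min r s)" "\<lambda>p. Y p $ 0" 0 "axis 0 1"] rs by (simp add: germ_simps XY)
qed

lemma germ_dz_scaleR:
  assumes "g \<in> aut_CR R"
  shows "germ_dz (c *\<^sub>R g) = c *\<^sub>R germ_dz g"
proof -
  obtain X where X: "g = germ X" "holomorphic_near_origin (\<lambda>p. X p $ 0)"
    using assms unfolding aut_CR_def by blast
  then obtain r where r: "r > 0" "holo_on (\<lambda>p. X p $ 0) (ball 0 r)"
    unfolding holomorphic_near_origin_iff by blast
  have "c *\<^sub>R g = germ (\<lambda>p. c *\<^sub>R X p)" unfolding X by transfer simp
  then have "germ_dz (c *\<^sub>R g) = dderiv (axis 0 1) (\<lambda>p. c *\<^sub>R X p $ 0) 0"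
    by (simp only: germ_simps vector_scaleR_component)
  then show ?thesis
    using dderiv_cmult[OF r(2), of 0 "axis 0 1" "complex_of_real c"] r(1)
    by (simp only: germ_simps X(1) scaleR_conv_of_real centre_in_ball)
qed

context quintic_model begin

lemma solution_of_tangent:
  assumes X: "\<And>i. holomorphic_near_origin (\<lambda>p. X p $ i)" and tan: "tangent_to X Meqns"
  shows "\<exists>\<rho>. model_solution a41 a32 X \<rho>"
proof -
  obtain r where r: "\<And>i. r i > 0" "\<And>i. holo_on (\<lambda>p. X p $ i) (ball 0 (r i))"
    using X unfolding holomorphic_near_origin_iff by metis
  obtain r' where r': "r' > 0" "\<And>p. p \<in> ball 0 r' \<Longrightarrow> p \<in> zero_locus Meqns \<Longrightarrow> tangent_at X p"
    using tan unfolding tangent_to_Meqns eventually_nhds_0_ball by blast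
  define R where "R = Min (insert r' (range r))"
  have R: "R > 0" "R \<le> r'" "R \<le> r i" for i
    using r(1) r'(1) unfolding R_def by (auto intro!: Min_le simp del: Min_insert)
  have hol: "holo_on (\<lambda>p. X p $ i) (ball 0 R)" for i
    using holo_on_subset[OF r(2)[of i]] R(3)[of i] by (simp add: subset_ball)
  have "tangent_at X p" if "p \<in> ball 0 R" "p \<in> zero_locus Meqns" for p
    using r'(2) that R(2) by auto
  from polarized_tangency[OF R(1) hol this] obtain d where d: "d > 0"
    "\<forall>p s. norm p < d \<longrightarrow> norm s < d \<longrightarrow> (\<forall>l. l \<noteq> 0 \<longrightarrow>
    X p $ l - star (\<lambda>p. X p $ l) (conj_pt p s) - phi_z l (p $ 0) s * X p $ 0
      - phi_s l (p $ 0) s * star (\<lambda>p. X p $ 0) (conj_pt p s) = 0)" by blast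
  have "model_solution a41 a32 X (min d R / 2)"
    by unfold_locales (use d R(1) holo_on_subset[OF hol] in \<open>auto simp: subset_ball\<close>)
  then show ?thesis by blast
qed

lemma germ_eq_0_if_data_vanish:
  assumes g: "g \<in> aut_CR Meqns" and z: "germ_at_0 g $ 0 = 0" "germ_dz g = 0"
    and w: "\<And>l. l \<noteq> 0 \<Longrightarrow> Re (germ_at_0 g $ l) = 0"
  shows "g = 0"
proof -
  obtain X where X: "g = germ X" "\<And>i. holomorphic_near_origin (\<lambda>p. X p $ i)" "tangent_to X Meqns"
    using g unfolding aut_CR_def by blast
  obtain \<rho> where "model_solution a41 a32 X \<rho>" using solution_of_tangent[OF X(2,3)] by blast
  then interpret sol: model_solution a41 a32 X \<rho> .
  have setz0: "setz 0 (0 :: complex^9) = 0" by (simp add: vec_eq_iff)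
  have S0: "0 \<in> sol.S" using sol.\<rho>_pos by simp
  have "sol.A l 0 = 0" if "l \<noteq> 0" for l
  proof -
    have "Im (sol.A l 0) = 0"
      using sol.star_A[OF S0 that] by (simp add: star_def cnjv_0 complex_eq_iff)
    moreover have "Re (sol.A l 0) = 0"
      using w[OF that] by (simp add: X(1) germ_simps sol.A_def setz0)
    ultimately show ?thesis by (simp add: complex_eq_iff)
  qed
  moreover have "sol.C 0 = 0" "sol.Ks 0 = 0"
    using z by (simp_all add: X(1) germ_simps sol.C_def sol.Ks_def setz0)
  ultimately have X0: "X p = 0" if "p \<in> ball 0 \<rho>" for p
    using sol.vanishes_if_data_vanish that by simp
  have "\<forall>\<^sub>F p in nhds 0. p \<in> ball (0::complex^9) \<rho>"
    using sol.\<rho>_pos by (intro eventually_nhds_in_open) auto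
  then have "\<forall>\<^sub>F p in nhds 0. X p = 0" by eventually_elim (rule X0)
  then show ?thesis unfolding X(1) by transfer simp
qed

lemma germ_dz_real_if_no_rotation:
  assumes g: "g \<in> aut_CR Meqns" and l: "l \<in> {7, 8}" "a41 l \<noteq> 0" and im: "\<And>i. cnj (a41 i) = - a41 i"
  shows "germ_dz g \<in> \<real>"
proof -
  obtain X where X: "g = germ X" "\<And>i. holomorphic_near_origin (\<lambda>p. X p $ i)" "tangent_to X Meqns"
    using g unfolding aut_CR_def by blast
  obtain \<rho> where "model_solution a41 a32 X \<rho>" using solution_of_tangent[OF X(2,3)] by blast
  then interpret sol: model_solution a41 a32 X \<rho> .
  have setz0: "setz 0 (0 :: complex^9) = 0" by (simp add: vec_eq_iff)
  have S0: "0 \<in> sol.S" using sol.\<rho>_pos by simp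
  have "cnj (sol.Ks 0) = sol.Ks 0"
    using sol.Ks_eq_K_if_no_rotation[OF l im S0] sol.stars(4)[OF S0] by (simp add: cnjv_0)
  then show ?thesis
    by (simp add: X(1) germ_simps sol.Ks_def setz0 Reals_cnj_iff)
qed

end

section \<open>The listed vector fields\<close>

lemma all_nonzero_9: "(\<forall>l::9. l \<noteq> 0 \<longrightarrow> P l) \<longleftrightarrow> P 1 \<and> P 2 \<and> P 3 \<and> P 4 \<and> P 5 \<and> P 6 \<and> P 7 \<and> P 8"
proof -
  have "(\<forall>l::9. l \<noteq> 0 \<longrightarrow> P l) \<longleftrightarrow> (\<forall>l\<in>{l. l \<noteq> 0}. P l)" by blast
  then show ?thesis unfolding nonzero_9 by simp
qed

lemma dderiv_nth: "dderiv v (\<lambda>p. p $ i) p = v $ i"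
  by (rule has_derivative_imp_dderiv[OF bounded_linear_imp_has_derivative[OF bounded_linear_vec_nth]])

lemma dderiv_cmult_nth: "dderiv v (\<lambda>p. c * p $ i) p = c * v $ i"
  using dderiv_cmult[OF holo_on_nth[of i UNIV]] by (simp add: dderiv_nth)

lemma holomorphic_near_origin_component:
  assumes "\<And>i. holo_on (\<lambda>p. X p $ i) UNIV"
  shows "holomorphic_near_origin (\<lambda>p. X p $ i)"
  unfolding holomorphic_near_origin_iff using holo_on_subset[OF assms] by (intro exI[of _ 1]) simp

lemmas holo_on_intros = holo_on_add holo_on_diff holo_on_minus holo_on_mult holo_on_power holo_on_nth holo_on_const

context quintic_model begin

lemma phi_simps:
  "phi 1 = (\<lambda>z s. 2 * \<i> * (z * s))"
  "phi 2 = (\<lambda>z s. 2 * \<i> * (z^2 * s + z * s^2))"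
  "phi 3 = (\<lambda>z s. 2 * (z^2 * s - z * s^2))"
  "phi 4 = (\<lambda>z s. 2 * \<i> * (z^3 * s + z * s^3))"
  "phi 5 = (\<lambda>z s. 2 * (z^3 * s - z * s^3))"
  "phi 6 = (\<lambda>z s. 2 * \<i> * (z^2 * s^2))"
  "phi 7 = (\<lambda>z s. a41 7 * z^4 * s - cnj (a41 7) * (z * s^4) + a32 7 * (z^3 * s^2) - cnj (a32 7) * (z^2 * s^3))"
  "phi 8 = (\<lambda>z s. a41 8 * z^4 * s - cnj (a41 8) * (z * s^4) + a32 8 * (z^3 * s^2) - cnj (a32 8) * (z^2 * s^3))"
  by (simp_all add: fun_eq_iff phi_def k_defs a11_def a21_def a31_def a22_def a41_support a32_support algebra_simps)

lemma Meqns_eq: "Meqns = shared_eqns \<union> {eqn 7 (phi 7), eqn 8 (phi 8)}"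
  unfolding Meqns_def nonzero_9 shared_eqns_def by (simp add: phi_simps(1-6) insert_commute)

text \<open>Parametrizing the submanifold by \<open>z\<close> and the real parts of the \<open>w\<^sub>l\<close> turns tangency of a polynomial
field into a polynomial identity.\<close>

lemma zero_locus_param:
  assumes "p \<in> zero_locus Meqns"
  obtains u :: "9 \<Rightarrow> real" where "\<And>l. l \<noteq> 0 \<Longrightarrow> p $ l = of_real (u l) + phi l (p $ 0) (cnj (p $ 0)) / 2"
proof
  show "p $ l = of_real (Re (p $ l)) + phi l (p $ 0) (cnj (p $ 0)) / 2" if "l \<noteq> 0" for l
  proof -
    have "phi l (p $ 0) (cnj (p $ 0)) = p $ l - cnj (p $ l)"
      using assms that unfolding zero_locus_Meqns by simp
    then show ?thesis by (simp add: complex_eq_iff)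
  qed
qed

lemma germ_in_aut:
  assumes "\<And>i. holo_on (\<lambda>p. X p $ i) UNIV"
    and "\<And>p u z. p $ 0 = z \<Longrightarrow> (\<And>l. l \<noteq> 0 \<Longrightarrow> p $ l = of_real (u l) + phi l z (cnj z) / 2) \<Longrightarrow> tangent_at X p"
  shows "germ X \<in> aut_CR Meqns"
proof -
  have "tangent_at X p" if p: "p \<in> zero_locus Meqns" for p
  proof -
    obtain u :: "9 \<Rightarrow> real" where "\<And>l. l \<noteq> 0 \<Longrightarrow> p $ l = of_real (u l) + phi l (p $ 0) (cnj (p $ 0)) / 2"
      using zero_locus_param[OF p] by blast
    then show ?thesis using assms(2) by blast
  qed
  then have "tangent_to X Meqns" unfolding tangent_to_Meqns by simp
  then show ?thesis unfolding aut_CR_def using holomorphic_near_origin_component[OF assms(1)] by blast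
qed

lemma tangent_at_dw: "l \<noteq> 0 \<Longrightarrow> tangent_at (vf (\<lambda>z w. dw l)) p"
  unfolding tangent_at_def vf_def dw_def by (simp add: axis_def)

lemmas tangent_simps = tangent_at_def all_nonzero_9 vf_def dw_def dz_def axis_def phi_z_def phi_s_def k_defs
  a11_def a21_def a31_def a22_def a41_support a32_support

lemma common_fields_in_aut:
  assumes "X \<in> common_fields"
  shows "germ X \<in> aut_CR Meqns"
proof -
  let ?E = "vf (\<lambda>z w. z *s dz + (2 * w 1) *s dw 1 + (3 * w 2) *s dw 2 + (3 * w 3) *s dw 3
       + (4 * w 4) *s dw 4 + (4 * w 5) *s dw 5 + (4 * w 6) *s dw 6
       + (5 * w 7) *s dw 7 + (5 * w 8) *s dw 8)"
  have "germ (vf (\<lambda>z w. dw l)) \<in> aut_CR Meqns" if "l \<noteq> 0" for l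
    by (rule germ_in_aut[OF _ tangent_at_dw[OF that]]) (simp add: vf_def holo_on_const)
  moreover have "germ ?E \<in> aut_CR Meqns"
  proof (rule germ_in_aut)
    show "holo_on (\<lambda>p. ?E p $ i) UNIV" for i
      unfolding vf_def vector_add_component vector_smult_component by (intro holo_on_intros)
    fix p :: "complex^9" and u :: "9 \<Rightarrow> real" and z
    assume "p $ 0 = z" "\<And>l. l \<noteq> 0 \<Longrightarrow> p $ l = of_real (u l) + phi l z (cnj z) / 2"
    then show "tangent_at ?E p"
      by (simp add: phi_simps tangent_simps) (simp add: field_simps eval_nat_numeral)
  qed
  ultimately show ?thesis using assms unfolding common_fields_def by auto
qed

end

abbreviation "re_im_pair \<equiv> \<lambda>l::9. if l = 7 then 2 * \<i> else if l = 8 then 2 else (0::complex)"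

text \<open>The values \<open>2 \<i>\<close> and \<open>2\<close> at \<open>l = 7, 8\<close> encode the real and the imaginary part of a degree five
monomial: \<open>z\<^sup>4 s\<close> for the first submanifold and \<open>z\<^sup>3 s\<^sup>2\<close> for the second.  The third one uses the real
part of each.\<close>

interpretation M1: quintic_model re_im_pair "\<lambda>_. 0"
proof
  fix x y :: complex
  assume "re_im_pair 7 * x + re_im_pair 8 * y = 0" "cnj (re_im_pair 7) * x + cnj (re_im_pair 8) * y = 0"
  then show "x = 0 \<and> y = 0" by (intro imaginary_pair_eq_0) simp_all
qed auto

interpretation M2: quintic_model "\<lambda>_. 0" re_im_pair
proof
  fix x y :: complex
  assume "re_im_pair 7 * x + re_im_pair 8 * y = 0" "cnj (re_im_pair 7) * x + cnj (re_im_pair 8) * y = 0"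
  then show "x = 0 \<and> y = 0" by (intro imaginary_pair_eq_0) simp_all
qed auto

interpretation M3: quintic_model "\<lambda>l. if l = 8 then 2 * \<i> else 0" "\<lambda>l. if l = 7 then 2 * \<i> else 0"
  by unfold_locales auto

lemma M1_Meqns: "M1.Meqns = M1_eqns"
  unfolding M1.Meqns_eq M1_eqns_def M1.phi_simps by (simp add: algebra_simps)

lemma M2_Meqns: "M2.Meqns = M2_eqns"
  unfolding M2.Meqns_eq M2_eqns_def M2.phi_simps by (simp add: algebra_simps)

lemma M3_Meqns: "M3.Meqns = M3_eqns"
  unfolding M3.Meqns_eq M3_eqns_def M3.phi_simps by (simp add: algebra_simps)

lemma fields1_in_aut: "germ ` fields1 \<subseteq> aut_CR M1_eqns"
  unfolding M1_Meqns[symmetric] fields1_def image_Un Un_subset_iff image_insert image_empty insert_subset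
proof (intro conjI)
  show "germ ` common_fields \<subseteq> aut_CR M1.Meqns" using M1.common_fields_in_aut by blast
qed (rule M1.germ_in_aut | simp only: vf_def vector_add_component vector_smult_component, intro holo_on_intros
    | simp add: M1.phi_simps M1.tangent_simps, simp add: field_simps eval_nat_numeral
    | rule empty_subsetI)+

lemma fields2_in_aut: "germ ` fields2 \<subseteq> aut_CR M2_eqns"
  unfolding M2_Meqns[symmetric] fields2_def image_Un Un_subset_iff image_insert image_empty insert_subset
proof (intro conjI)
  show "germ ` common_fields \<subseteq> aut_CR M2.Meqns" using M2.common_fields_in_aut by blast
qed (rule M2.germ_in_aut | simp only: vf_def vector_add_component vector_smult_component, intro holo_on_intros
    | simp add: M2.phi_simps M2.tangent_simps, simp add: field_simps eval_nat_numeral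
    | rule empty_subsetI)+

lemma fields3_in_aut: "germ ` fields3 \<subseteq> aut_CR M3_eqns"
  unfolding M3_Meqns[symmetric] fields3_def image_Un Un_subset_iff image_insert image_empty insert_subset
proof (intro conjI)
  show "germ ` common_fields \<subseteq> aut_CR M3.Meqns" using M3.common_fields_in_aut by blast
qed (rule M3.germ_in_aut | simp only: vf_def vector_add_component vector_smult_component, intro holo_on_intros
    | simp add: M3.phi_simps M3.tangent_simps, simp add: field_simps eval_nat_numeral
    | rule empty_subsetI)+

text \<open>Real coordinates: \<open>Re W\<^sub>l(0)\<close>, then \<open>(\<partial>Z/\<partial>z)(0)\<close> and \<open>Z(0)\<close>.  Where \<open>(\<partial>Z/\<partial>z)(0)\<close> is forced to be
real, \<open>coord_dil\<close> retains its real part.\<close>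

type_synonym shift_coords = "real \<times> real \<times> real \<times> real \<times> real \<times> real \<times> real \<times> real"

definition coord_w :: "9 vf_germ \<Rightarrow> shift_coords" where
  "coord_w g = (let r = (\<lambda>l. Re (germ_at_0 g $ l)) in (r 1, r 2, r 3, r 4, r 5, r 6, r 7, r 8))"

definition coord :: "9 vf_germ \<Rightarrow> shift_coords \<times> complex \<times> complex" where
  "coord g = (coord_w g, germ_dz g, germ_at_0 g $ 0)"

definition coord_dil :: "9 vf_germ \<Rightarrow> shift_coords \<times> real \<times> complex" where
  "coord_dil g = (coord_w g, Re (germ_dz g), germ_at_0 g $ 0)"

lemma coord_w_add: "coord_w (g + h) = coord_w g + coord_w h"
  and coord_w_scaleR: "coord_w (c *\<^sub>R g) = c *\<^sub>R coord_w g"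
  by (simp_all add: coord_w_def germ_at_0_add germ_at_0_scaleR Let_def)

lemma coord_w_0: "coord_w g = 0 \<longleftrightarrow> (\<forall>l. l \<noteq> 0 \<longrightarrow> Re (germ_at_0 g $ l) = 0)"
  by (simp add: coord_w_def all_nonzero_9 Let_def zero_prod_def)

lemmas coord_simps = coord_def coord_dil_def coord_w_def germ_simps vf_def dz_def dw_def axis_def dderiv_const dderiv_nth
  dderiv_cmult_nth Let_def

lemma coord_fields1: "coord ` germ ` fields1 = Basis"
  unfolding fields1_def common_fields_def
  by (simp add: image_Un image_image coord_simps Basis_prod_def Basis_complex_def zero_prod_def)
    (rule set_eqI, simp only: insert_iff disj_ac)

lemma coord_fields2: "coord ` germ ` fields2 = Basis"
  unfolding fields2_def common_fields_def
  by (simp add: image_Un image_image coord_simps Basis_prod_def Basis_complex_def zero_prod_def)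
    (rule set_eqI, simp only: insert_iff disj_ac)

lemma coord_fields3: "coord_dil ` germ ` fields3 = Basis"
  unfolding fields3_def common_fields_def
  by (simp add: image_Un image_image coord_simps Basis_prod_def Basis_complex_def zero_prod_def)
    (rule set_eqI, simp only: insert_iff disj_ac)

theorem theorem1p2:
  "(dim (aut_CR M1_eqns) = 12 \<and> independent (germ ` fields1)
      \<and> span (germ ` fields1) = aut_CR M1_eqns) \<and>
   (dim (aut_CR M2_eqns) = 12 \<and> independent (germ ` fields2)
      \<and> span (germ ` fields2) = aut_CR M2_eqns) \<and>
   (dim (aut_CR M3_eqns) = 11 \<and> independent (germ ` fields3)
      \<and> span (germ ` fields3) = aut_CR M3_eqns)"
proof (intro conjI[of "_ \<and> _ \<and> _"])
  have add: "coord (g + h) = coord g + coord h" if "g \<in> aut_CR R" "h \<in> aut_CR R" for R g h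
    using germ_dz_add[OF that] by (simp add: coord_def coord_w_add germ_at_0_add)
  have scale: "coord (c *\<^sub>R g) = c *\<^sub>R coord g" if "g \<in> aut_CR R" for R g c
    using germ_dz_scaleR[OF that] by (simp add: coord_def coord_w_scaleR germ_at_0_scaleR)
  have dim: "DIM(shift_coords \<times> complex \<times> complex) = 12" "DIM(shift_coords \<times> real \<times> complex) = 11" by simp_all
  have inj1: "g = 0" if "g \<in> aut_CR M1_eqns" "coord g = 0" for g
  proof -
    have "coord_w g = 0" "germ_dz g = 0" "germ_at_0 g $ 0 = 0"
      using that(2) by (simp_all add: coord_def zero_prod_def)
    then show ?thesis
      using that(1) coord_w_0 unfolding M1_Meqns[symmetric] by (intro M1.germ_eq_0_if_data_vanish) auto
  qed
  show "dim (aut_CR M1_eqns) = 12 \<and> independent (germ ` fields1) \<and> span (germ ` fields1) = aut_CR M1_eqns"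
    using basis_of_coordinates[OF subspace_aut_CR add scale inj1 fields1_in_aut coord_fields1] unfolding dim .
  have inj2: "g = 0" if "g \<in> aut_CR M2_eqns" "coord g = 0" for g
  proof -
    have "coord_w g = 0" "germ_dz g = 0" "germ_at_0 g $ 0 = 0"
      using that(2) by (simp_all add: coord_def zero_prod_def)
    then show ?thesis
      using that(1) coord_w_0 unfolding M2_Meqns[symmetric] by (intro M2.germ_eq_0_if_data_vanish) auto
  qed
  show "dim (aut_CR M2_eqns) = 12 \<and> independent (germ ` fields2) \<and> span (germ ` fields2) = aut_CR M2_eqns"
    using basis_of_coordinates[OF subspace_aut_CR add scale inj2 fields2_in_aut coord_fields2] unfolding dim .
  have add': "coord_dil (g + h) = coord_dil g + coord_dil h" if "g \<in> aut_CR R" "h \<in> aut_CR R" for R g h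
    using germ_dz_add[OF that] by (simp add: coord_dil_def coord_w_add germ_at_0_add)
  have scale': "coord_dil (c *\<^sub>R g) = c *\<^sub>R coord_dil g" if "g \<in> aut_CR R" for R g c
    using germ_dz_scaleR[OF that] by (simp add: coord_dil_def coord_w_scaleR germ_at_0_scaleR)
  have inj3: "g = 0" if g: "g \<in> aut_CR M3_eqns" "coord_dil g = 0" for g
  proof -
    have "germ_dz g \<in> \<real>"
      using g(1) unfolding M3_Meqns[symmetric] by (rule M3.germ_dz_real_if_no_rotation[where l = 8]) auto
    moreover have "coord_w g = 0" "Re (germ_dz g) = 0" "germ_at_0 g $ 0 = 0"
      using g(2) by (simp_all add: coord_dil_def zero_prod_def)
    ultimately have "coord_w g = 0" "germ_dz g = 0" "germ_at_0 g $ 0 = 0"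
      by (simp_all add: complex_eq_iff complex_is_Real_iff)
    then show ?thesis
      using g(1) coord_w_0 unfolding M3_Meqns[symmetric] by (intro M3.germ_eq_0_if_data_vanish) auto
  qed
  show "dim (aut_CR M3_eqns) = 11 \<and> independent (germ ` fields3) \<and> span (germ ` fields3) = aut_CR M3_eqns"
    using basis_of_coordinates[OF subspace_aut_CR add' scale' inj3 fields3_in_aut coord_fields3] unfolding dim .
qed

end
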